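(* Let $d\in(0,1/2)$, let $\mathcal{X}$ be a compact subset of $\mathbb{R}^2$ with $\mathcal{X}\cap\{(x,x):x\in\mathbb{R}\}=\varnothing$, let $\Theta=[0,1/2-d]\times\mathcal{X}$, and let $\theta_0=(\lambda_0,\mu_1^0,\mu_2^0)$ be an interior point of $\Theta$. Let $F_0$ be the c.d.f. of a probability distribution on $\mathbb{R}$ symmetric about $0$, and let $X_1,X_2,\dots$ be i.i.d. real random variables with c.d.f. $G(x)=\lambda_0F_0(x-\mu_1^0)+(1-\lambda_0)F_0(x-\mu_2^0)$. Let $\hat\theta_n$ be the estimator $$\hat\theta_n=\underset{\theta\in\Theta}{\arg\min}\;K_r(\theta;\hat G_n),\qquad K_r(\theta;\hat G_n)=\int_{\mathbb{R}}\big(\tilde G^{(n)}_\theta(x)-\tilde G_n(x)\big)^2\,d\hat G_n(x).$$ If $F_0$ is strictly increasing and Lipschitz on $\mathbb{R}$, then $\hat\theta_n$ converges almost surely to $\theta_0$ as $n\to+\infty$. If, in addition, $F_0$ is twice continuously differentiable on $\mathbb{R}$ with $F_0''\in L^1(\mathbb{R})$, then for all $\alpha>0$, $$n^{1/4-\alpha}(\hat\theta_n-\theta_0)=o_{\mathrm{a.s.}}(1).$$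
   Context: $\hat G_n(x)=\frac1n\sum_{i=1}^n\mathbf{1}_{X_i\le x}$ is the empirical c.d.f. Its smoothed version is $$\tilde G_n(x)=\frac1n\sum_{k=1}^nQ\Big(\frac{x-X_k}{b_n}\Big),\qquad Q(x)=\int_{-\infty}^xq(y)\,dy,$$ where $q$ is an even probability density function with compact support and second-order moment equal to $1$, and $(b_n)_{n\ge1}$ is a sequence of positive real numbers decreasing to $0$ with $nb_n\to+\infty$ and $\sqrt n\,b_n^2=O(1)$. For $\theta=(\lambda,\mu_1,\mu_2)\in\Theta$, $\tilde G^{(n)}_\theta=A_\theta S_rA_\theta^{-1}\tilde G_n$, where, with $\tau_\mu f=f(\cdot-\mu)$ and $\eta=\mu_2-\mu_1$, $$A_\theta=\lambda\tau_{\mu_1}+(1-\lambda)\tau_{\mu_2},\qquad A_\theta^{-1}=\frac{1}{1-\lambda}\sum_{k\ge 0}\Big(\frac{-\lambda}{1-\lambda}\Big)^k\tau_{-\mu_2-k\eta},$$ acting on bounded functions on $\mathbb{R}$, and $(S_rF)(x)=1-F(-x)$. $o_{\mathrm{a.s.}}(1)$ means converging to $0$ almost surely as $n\to+\infty$. *)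

theory Defs
  imports "HOL-Probability.Probability" "HOL-Library.Landau_Symbols"
begin

definition ecdf :: "(nat \<Rightarrow> real) \<Rightarrow> nat \<Rightarrow> real \<Rightarrow> real" where
  "ecdf x n t = (1 / real n) * (\<Sum>i=1..n. indicator {..t} (x i))"

definition smoothing_kernel :: "(real \<Rightarrow> real) \<Rightarrow> bool" where
  "smoothing_kernel q \<longleftrightarrow>
     q \<in> borel_measurable borel \<and> (\<forall>y. 0 \<le> q y) \<and> (\<forall>y. q (- y) = q y) \<and>
     has_bochner_integral lborel q 1 \<and>
     compact (closure {y. q y \<noteq> 0}) \<and>
     has_bochner_integral lborel (\<lambda>y. y\<^sup>2 * q y) 1"

definition kernel_cdf :: "(real \<Rightarrow> real) \<Rightarrow> real \<Rightarrow> real" where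
  "kernel_cdf q t = (LBINT y:{..t}. q y)"

definition smooth_ecdf ::
    "(real \<Rightarrow> real) \<Rightarrow> (nat \<Rightarrow> real) \<Rightarrow> (nat \<Rightarrow> real) \<Rightarrow> nat \<Rightarrow> real \<Rightarrow> real" where
  "smooth_ecdf q b x n t = (1 / real n) * (\<Sum>k=1..n. kernel_cdf q ((t - x k) / b n))"

definition shift :: "real \<Rightarrow> (real \<Rightarrow> real) \<Rightarrow> real \<Rightarrow> real" where
  "shift \<mu> f = (\<lambda>t. f (t - \<mu>))"

text \<open>The parameter triples are ordered as \<open>(\<lambda>, \<mu>\<^sub>1, \<mu>\<^sub>2)\<close>.\<close>

definition mix_op :: "real \<times> real \<times> real \<Rightarrow> (real \<Rightarrow> real) \<Rightarrow> real \<Rightarrow> real" where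
  "mix_op = (\<lambda>(l, \<mu>1, \<mu>2) f t. l * shift \<mu>1 f t + (1 - l) * shift \<mu>2 f t)"

text \<open>For \<open>0 \<le> \<lambda> < 1/2\<close> and bounded \<open>f\<close> the series is absolutely convergent, and
  this operator is the inverse of \<open>mix_op\<close> on bounded functions.\<close>

definition mix_op_inv :: "real \<times> real \<times> real \<Rightarrow> (real \<Rightarrow> real) \<Rightarrow> real \<Rightarrow> real" where
  "mix_op_inv = (\<lambda>(l, \<mu>1, \<mu>2) f t.
     1 / (1 - l) * (\<Sum>k. (- l / (1 - l)) ^ k * shift (- \<mu>2 - real k * (\<mu>2 - \<mu>1)) f t))"

definition reflect_cdf :: "(real \<Rightarrow> real) \<Rightarrow> real \<Rightarrow> real" where
  "reflect_cdf F = (\<lambda>t. 1 - F (- t))"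

definition model_cdf ::
    "(real \<Rightarrow> real) \<Rightarrow> (nat \<Rightarrow> real) \<Rightarrow> (nat \<Rightarrow> real) \<Rightarrow> nat \<Rightarrow> real \<times> real \<times> real \<Rightarrow> real \<Rightarrow> real" where
  "model_cdf q b x n \<theta> = mix_op \<theta> (reflect_cdf (mix_op_inv \<theta> (smooth_ecdf q b x n)))"

text \<open>The integral against the empirical c.d.f. is the Lebesgue-Stieltjes integral.\<close>

definition contrast ::
    "(real \<Rightarrow> real) \<Rightarrow> (nat \<Rightarrow> real) \<Rightarrow> (nat \<Rightarrow> real) \<Rightarrow> nat \<Rightarrow> real \<times> real \<times> real \<Rightarrow> real" where
  "contrast q b x n \<theta> =
     (LINT t|interval_measure (ecdf x n). (model_cdf q b x n \<theta> t - smooth_ecdf q b x n t)\<^sup>2)"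

definition param_space :: "real \<Rightarrow> (real \<times> real) set \<Rightarrow> (real \<times> real \<times> real) set" where
  "param_space d S = {0..1/2 - d} \<times> S"

end

theory Submission
  imports Defs "HOL-Real_Asymp.Real_Asymp"
begin

text \<open>
  Write \<open>R\<^sub>\<theta>\<close> for \<open>A\<^sub>\<theta> S\<^sub>r A\<^sub>\<theta>\<^sup>-\<^sup>1 G - G\<close> and \<open>K \<theta>\<close> for the integral of its square against the true
  distribution. Applying the mixing operator of \<open>(\<lambda>, -\<mu>\<^sub>1, -\<mu>\<^sub>2)\<close> to \<open>R\<^sub>\<theta>\<close> removes the infinite series:
  the result \<open>H\<^sub>\<theta>\<close> is a finite combination of differences \<open>F\<^sub>0 (x - a) - F\<^sub>0 (x + a)\<close> with \<open>a = \<mu>\<^sub>i - \<mu>\<^sup>0\<^sub>j\<close>,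
  and \<open>R\<^sub>\<theta>\<close> is recovered from it by a bounded operator. The cosine transform turns \<open>H\<^sub>\<theta> = 0\<close> into a
  relation between sines, which forces \<open>\<theta> = \<theta>\<^sub>0\<close>; the same transform shows that the derivative of
  \<open>H\<close> at \<open>\<theta>\<^sub>0\<close> is injective, so that \<open>K\<close> grows at least quadratically at \<open>\<theta>\<^sub>0\<close>.

  The contrast differs from \<open>K\<close>, uniformly in \<open>\<theta>\<close>, by at most a multiple of \<open>\<Delta>\<^sub>n + e\<^sub>n\<close>, where
  \<open>\<Delta>\<^sub>n\<close> is the uniform distance between the empirical and the true c.d.f. and \<open>e\<^sub>n\<close> is the \<open>L\<^sup>1\<close> norm
  of the smoothing bias; this holds because the residuals are differences of bounded monotone
  functions. Hoeffding's inequality on a grid of quantiles and Borel--Cantelli make \<open>\<Delta>\<^sub>n\<close> of order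
  \<open>n powr (\<alpha> - 1/2)\<close>, and \<open>e\<^sub>n\<close> is of order \<open>b\<^sub>n\<^sup>2\<close>. Hence \<open>K\<close> at the estimator is of order
  \<open>n powr (\<alpha> - 1/2)\<close>, and its square root bounds the error.
\<close>

section \<open>Inverting the mixing operator\<close>

text \<open>The bound \<open>l \<le> 1/2 - d\<close> keeps the ratio \<open>l / (1 - l)\<close> away
  from 1, so all inverses are bounded by \<open>1 / (2 * d)\<close> and every deviation estimate is
  uniform over the parameter space; this is what permits evaluation at a random minimizer. The
  cosine transform of the symmetric law is a common factor of all terms, but it is known to be
  nonzero only near 0. The relations between sines therefore hold only for small \<open>t\<close>,
  and Taylor coefficients at 0 are compared instead of frequencies. Interiority of the true
  parameter supplies a positive first weight, without which the first location could not be
  identified. The smoothing bias is measured in an integrated norm because with a merely integrable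
  second derivative the pointwise remainder is only \<open>b n\<close> times a local variation of
  the first derivative, which need not be of order \<open>b n\<close>. The contrast deviation is
  linear in the uniform distance, of order almost \<open>n powr (- 1/2)\<close>, while the limit
  contrast grows quadratically: hence the exponent 1/4.\<close>

lemma mix_op_eq: "mix_op (l, m1, m2) f t = l * f (t - m1) + (1 - l) * f (t - m2)"
  by (simp add: mix_op_def shift_def)

lemma mix_op_inv_eq:
  "mix_op_inv (l, m1, m2) f t
     = 1 / (1 - l) * (\<Sum>k. (- l / (1 - l)) ^ k * f (t + m2 + real k * (m2 - m1)))"
  by (simp add: mix_op_inv_def shift_def algebra_simps)

lemma mix_ratio_abs_less:
  fixes l :: real
  assumes "0 \<le> l" "l < 1/2"
  shows "\<bar>- l / (1 - l)\<bar> < 1"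
  using assms by (auto simp: abs_if divide_simps)

text \<open>The moduli of the coefficients form a geometric series with sum
  \<open>(1 - l) / (1 - 2 * l)\<close>, and the prefactor turns this into the operator norm
  \<open>1 / (1 - 2 * l)\<close>. For \<open>l \<le> 1/2 - d\<close> it is at most
  \<open>1 / (2 * d)\<close>, the constant that recurs below.\<close>

lemma summable_mix_series:
  fixes l :: real
  assumes "0 \<le> l" "l < 1/2" "\<And>k. \<bar>g k\<bar> \<le> C"
  shows "summable (\<lambda>k. (- l / (1 - l)) ^ k * g k)"
    and "\<bar>1 / (1 - l) * (\<Sum>k. (- l / (1 - l)) ^ k * g k)\<bar> \<le> C / (1 - 2 * l)"
proof -
  define r where "r = - l / (1 - l)"
  have r: "\<bar>r\<bar> < 1" using mix_ratio_abs_less[OF assms(1,2)] by (simp add: r_def)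
  have s: "summable (\<lambda>k. \<bar>r\<bar> ^ k * C)"
    using r by (intro summable_mult2 summable_geometric) auto
  have le: "norm (r ^ k * g k) \<le> \<bar>r\<bar> ^ k * C" for k
    by (simp add: abs_mult power_abs mult_left_mono assms(3))
  show "summable (\<lambda>k. (- l / (1 - l)) ^ k * g k)"
    unfolding r_def[symmetric] by (rule summable_comparison_test'[OF s, of 0]) (use le in auto)
  have "norm (\<Sum>k. r ^ k * g k) \<le> (\<Sum>k. \<bar>r\<bar> ^ k * C)"
    by (rule norm_suminf_le[OF le s])
  also have "\<dots> = (1 / (1 - \<bar>r\<bar>)) * C"
    using r by (subst suminf_mult2[symmetric]) (auto simp: suminf_geometric intro!: summable_geometric)
  also have "1 / (1 - \<bar>r\<bar>) = (1 - l) / (1 - 2 * l)"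
    using assms(1,2) by (auto simp: r_def divide_simps abs_if)
  finally have "\<bar>\<Sum>k. r ^ k * g k\<bar> \<le> (1 - l) / (1 - 2 * l) * C" by simp
  hence "\<bar>\<Sum>k. r ^ k * g k\<bar> / (1 - l) \<le> C / (1 - 2 * l)"
    using assms(1,2) by (simp add: divide_simps mult_ac)
  thus "\<bar>1 / (1 - l) * (\<Sum>k. (- l / (1 - l)) ^ k * g k)\<bar> \<le> C / (1 - 2 * l)"
    unfolding r_def[symmetric] using assms(1,2) by (simp add: abs_mult)
qed

lemma mix_op_inv_bound:
  assumes "0 \<le> l" "l < 1/2" "\<And>y. \<bar>f y\<bar> \<le> C"
  shows "\<bar>mix_op_inv (l, m1, m2) f t\<bar> \<le> C / (1 - 2 * l)"
  unfolding mix_op_inv_eq by (rule summable_mix_series) (use assms in auto)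

text \<open>The two shifts of \<open>mix_op\<close> cancel between neighbouring terms of the series:
  with \<open>u k = r ^ k * f (t + real k * (m2 - m1))\<close> it telescopes, and
  \<open>u 0 = f t\<close> survives because \<open>u\<close> tends to 0.\<close>

lemma mix_op_inv_mix_op:
  assumes "0 \<le> l" "l < 1/2" "\<And>y. \<bar>f y\<bar> \<le> C"
  shows "mix_op_inv (l, m1, m2) (mix_op (l, m1, m2) f) t = f t"
proof -
  define r where "r = - l / (1 - l)"
  have r: "\<bar>r\<bar> < 1" using mix_ratio_abs_less[OF assms(1,2)] by (simp add: r_def)
  define u where "u = (\<lambda>k. r ^ k * f (t + real k * (m2 - m1)))"
  have "\<bar>u k\<bar> \<le> \<bar>r\<bar> ^ k * C" for k
    by (simp add: u_def abs_mult power_abs mult_left_mono assms(3))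
  moreover have "(\<lambda>k. \<bar>r\<bar> ^ k * C) \<longlonglongrightarrow> 0"
    using r by (intro tendsto_mult_left_zero LIMSEQ_power_zero) auto
  ultimately have "u \<longlonglongrightarrow> 0"
    by (metis (no_types, lifting) Lim_null_comparison eventuallyI real_norm_def)
  from telescope_sums'[OF this] have 1: "(\<lambda>n. u n - u (Suc n)) sums f t"
    by (simp add: u_def)
  have "1 / (1 - l) * (r ^ k * mix_op (l, m1, m2) f (t + m2 + real k * (m2 - m1))) = u k - u (Suc k)" for k
  proof -
    have "mix_op (l, m1, m2) f (t + m2 + real k * (m2 - m1))
      = l * f (t + real (Suc k) * (m2 - m1)) + (1 - l) * f (t + real k * (m2 - m1))"
      by (simp add: mix_op_eq algebra_simps)
    also have "\<dots> = (1 - l) * (f (t + real k * (m2 - m1)) - r * f (t + real (Suc k) * (m2 - m1)))"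
    proof -
      have "(1 - l) * (B - r * A) = (1 - l) * B - (r * (1 - l)) * A" for A B :: real
        by (simp add: algebra_simps)
      moreover have "r * (1 - l) = - l" using assms(2) by (simp add: r_def)
      ultimately show ?thesis by simp
    qed
    finally have "mix_op (l, m1, m2) f (t + m2 + real k * (m2 - m1))
      = (1 - l) * (f (t + real k * (m2 - m1)) - r * f (t + real (Suc k) * (m2 - m1)))" .
    moreover have "1 / (1 - l) * (r ^ k * ((1 - l) * (A - r * B))) = r ^ k * A - r ^ Suc k * B" for A B
      using assms(2) by (simp add: field_simps)
    ultimately show ?thesis by (simp only: u_def)
  qed
  with 1 have "(\<lambda>k. 1 / (1 - l) * (r ^ k * mix_op (l, m1, m2) f (t + m2 + real k * (m2 - m1)))) sums f t"
    by simp
  from sums_mult[OF this, of "1 - l"] assms(2)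
  have "(\<lambda>k. r ^ k * mix_op (l, m1, m2) f (t + m2 + real k * (m2 - m1))) sums ((1 - l) * f t)"
    by (simp only: mult.assoc[symmetric]) simp
  from sums_unique[OF this] show ?thesis
    using assms(2) unfolding mix_op_inv_eq r_def[symmetric] by (simp add: field_simps)
qed

text \<open>Both operators are combinations of translations and therefore commute, which reduces the
  right inverse to the left inverse.\<close>

lemma mix_op_mix_op_inv:
  assumes "0 \<le> l" "l < 1/2" "\<And>y. \<bar>f y\<bar> \<le> C"
  shows "mix_op (l, m1, m2) (mix_op_inv (l, m1, m2) f) t = f t"
proof -
  have "mix_op (l, m1, m2) (mix_op_inv (l, m1, m2) f) t =
      mix_op_inv (l, m1, m2) (mix_op (l, m1, m2) f) t"
  proof -
    have s: "summable (\<lambda>k. (- l / (1 - l)) ^ k * f (y + real k * (m2 - m1)))" for y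
      using summable_mix_series(1)[OF assms(1,2), of "\<lambda>k. f (y + real k * (m2 - m1))" C] assms(3) by simp
    define g where "g = (\<lambda>y k. (- l / (1 - l)) ^ k * f (y + real k * (m2 - m1)))"
    have g: "summable (g y)" for y using s by (simp add: g_def)
    have "mix_op (l, m1, m2) (mix_op_inv (l, m1, m2) f) t
        = 1 / (1 - l) * (l * (\<Sum>k. g (t - m1 + m2) k) + (1 - l) * (\<Sum>k. g (t - m2 + m2) k))"
      unfolding mix_op_inv_eq mix_op_eq g_def by (simp only: distrib_left mult.left_commute)
    also have "l * (\<Sum>k. g (t - m1 + m2) k) + (1 - l) * (\<Sum>k. g (t - m2 + m2) k)
        = (\<Sum>k. l * g (t - m1 + m2) k + (1 - l) * g (t - m2 + m2) k)"
      unfolding suminf_mult[OF g, symmetric]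
      by (rule suminf_add[OF summable_mult[OF g] summable_mult[OF g]])
    also have "(\<lambda>k. l * g (t - m1 + m2) k + (1 - l) * g (t - m2 + m2) k)
       = (\<lambda>k. (- l / (1 - l)) ^ k * mix_op (l, m1, m2) f (t + m2 + real k * (m2 - m1)))"
    proof
      fix k
      have "t + m2 + c - m1 = t - m1 + m2 + c" "t + m2 + c - m2 = t - m2 + m2 + c" for c by simp_all
      thus "l * g (t - m1 + m2) k + (1 - l) * g (t - m2 + m2) k
         = (- l / (1 - l)) ^ k * mix_op (l, m1, m2) f (t + m2 + real k * (m2 - m1))"
        unfolding mix_op_eq g_def by (simp only: distrib_left mult.left_commute)
    qed
    finally show ?thesis unfolding mix_op_inv_eq .
  qed
  thus ?thesis using mix_op_inv_mix_op[OF assms] by simp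
qed

text \<open>Tannery's theorem. The functions may vary with \<open>n\<close> as long as they converge
  along convergent arguments: a constant sequence gives continuity in the parameters, difference
  quotients are used for the quadratic growth.\<close>

lemma mix_op_inv_tendsto:
  assumes l: "l \<longlonglongrightarrow> l'" and m1: "m1 \<longlonglongrightarrow> m1'" and m2: "m2 \<longlonglongrightarrow> m2'"
    and x: "x \<longlonglongrightarrow> x'"
    and d: "0 < d" "\<And>n. 0 \<le> l n" "\<And>n. l n \<le> 1/2 - d"
    and bd: "\<And>n y. \<bar>f n y\<bar> \<le> C"
    and f: "\<And>y y'. y \<longlonglongrightarrow> y' \<Longrightarrow> (\<lambda>n. f n (y n)) \<longlonglongrightarrow> f' y'"
  shows "(\<lambda>n. mix_op_inv (l n, m1 n, m2 n) (f n) (x n)) \<longlonglongrightarrow> mix_op_inv (l', m1', m2') f' x'"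
proof -
  have l': "l' \<le> 1/2 - d" "0 \<le> l'"
    using LIMSEQ_le_const2[OF l, of "1/2 - d"] LIMSEQ_le_const[OF l, of 0] d by auto
  \<comment> \<open>The largest value of \<open>l / (1 - l)\<close> on the admissible weights; its
    powers dominate the series uniformly in \<open>n\<close>.\<close>
  define \<rho> where "\<rho> = (1/2 - d) / (1/2 + d)"
  have "1/2 - d \<ge> 0" using d(2)[of 0] d(3)[of 0] by linarith
  hence \<rho>: "0 \<le> \<rho>" "\<rho> < 1" using d(1) by (auto simp: \<rho>_def)
  have r: "\<bar>- l n / (1 - l n)\<bar> \<le> \<rho>" for n
  proof -
    have "\<bar>- l n / (1 - l n)\<bar> = l n / (1 - l n)" using d(2,3)[of n] d(1) by (auto simp: abs_if divide_simps)
    also have "\<dots> \<le> \<rho>" unfolding \<rho>_def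
      using d(2,3)[of n] d(1) by (intro frac_le) auto
    finally show ?thesis .
  qed
  have "(\<lambda>n. \<Sum>k. (- l n / (1 - l n)) ^ k * f n (x n + m2 n + real k * (m2 n - m1 n)))
     \<longlonglongrightarrow> (\<Sum>k. (- l' / (1 - l')) ^ k * f' (x' + m2' + real k * (m2' - m1')))"
  proof (rule tannerys_theorem[THEN conjunct2, THEN conjunct2])
    fix k
    show "(\<lambda>n. (- l n / (1 - l n)) ^ k * f n (x n + m2 n + real k * (m2 n - m1 n)))
       \<longlonglongrightarrow> (- l' / (1 - l')) ^ k * f' (x' + m2' + real k * (m2' - m1'))"
      using l' d(1) by (intro tendsto_intros f l x m1 m2) auto
  next
    show "summable (\<lambda>k. \<rho> ^ k * C)" using \<rho> by (intro summable_mult2 summable_geometric) auto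
  next
    have "norm ((- l n / (1 - l n)) ^ k * f n (x n + m2 n + real k * (m2 n - m1 n))) \<le> \<rho> ^ k * C" for k n
      unfolding real_norm_def abs_mult power_abs
      using r[of n] bd[of n] \<rho> by (intro mult_mono power_mono) auto
    thus "\<forall>\<^sub>F (k, n) in sequentially \<times>\<^sub>F sequentially.
       norm ((- l n / (1 - l n)) ^ k * f n (x n + m2 n + real k * (m2 n - m1 n))) \<le> \<rho> ^ k * C"
      by (intro always_eventually) auto
  qed auto
  moreover have "(\<lambda>n. 1 / (1 - l n)) \<longlonglongrightarrow> 1 / (1 - l')"
    using l' d(1) by (intro tendsto_intros l) auto
  ultimately show ?thesis unfolding mix_op_inv_eq by (rule tendsto_mult[rotated])
qed

section \<open>Stability of the contrast\<close>

text \<open>A down-closed set of reals is empty, everything, or a closed or open half-line; the open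
  one is reached by left limits of the two c.d.f.s.\<close>

lemma measure_down_closed_diff:
  assumes \<mu>: "real_distribution \<mu>" and \<nu>: "real_distribution \<nu>"
    and \<Delta>: "\<And>x. \<bar>cdf \<mu> x - cdf \<nu> x\<bar> \<le> \<Delta>"
    and D: "\<And>x y. y \<in> D \<Longrightarrow> x \<le> y \<Longrightarrow> x \<in> D"
  shows "\<bar>measure \<mu> D - measure \<nu> D\<bar> \<le> \<Delta>"
proof -
  interpret \<mu>: real_distribution \<mu> by fact
  interpret \<nu>: real_distribution \<nu> by fact
  have \<Delta>0: "\<Delta> \<ge> 0" using \<Delta>[of 0] by linarith
  consider "D = {}" | "D = UNIV" | a where "D = {..a}" | a where "D = {..<a}"
  proof (cases "D = {} \<or> D = UNIV")
    case False
    then obtain z w where z: "z \<notin> D" and w: "w \<in> D" by auto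
    have bd: "bdd_above D" using D z by (intro bdd_aboveI[of _ z]) (meson linear)
    have "D = (if Sup D \<in> D then {..Sup D} else {..<Sup D})"
    proof -
      have "x \<in> D" if "x < Sup D" for x
        using less_cSupD[of D x] w that D by (metis empty_iff less_imp_le)
      moreover have "x \<le> Sup D" if "x \<in> D" for x using cSup_upper[OF that bd] .
      ultimately show ?thesis by (auto simp: less_le split: if_splits)
    qed
    thus ?thesis using that(3,4) by (metis (full_types))
  qed (use that in auto)
  thus ?thesis
  proof cases
    case 2
    have "measure \<mu> UNIV = 1" "measure \<nu> UNIV = 1"
      using \<mu>.prob_space \<nu>.prob_space by auto
    thus ?thesis using 2 \<Delta>0 by simp
  next
    case 3
    thus ?thesis using \<Delta> by (simp add: cdf_def)
  next
    case (4 a)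
    have "((\<lambda>x. \<bar>cdf \<mu> x - cdf \<nu> x\<bar>) \<longlongrightarrow> \<bar>measure \<mu> {..<a} - measure \<nu> {..<a}\<bar>) (at_left a)"
      by (intro tendsto_intros \<mu>.cdf_at_left \<nu>.cdf_at_left)
    hence "\<bar>measure \<mu> {..<a} - measure \<nu> {..<a}\<bar> \<le> \<Delta>"
      by (rule tendsto_upperbound) (use \<Delta> in auto)
    thus ?thesis using 4 by simp
  qed (use \<Delta>0 in auto)
qed

lemma borel_measurable_antimono:
  fixes f :: "real \<Rightarrow> real"
  assumes "antimono f"
  shows "f \<in> borel_measurable borel"
proof -
  have "(\<lambda>x. - f x) \<in> borel_measurable borel"
    by (rule borel_measurable_mono) (use assms in \<open>auto simp: mono_def antimono_def\<close>)
  thus ?thesis by simp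
qed

text \<open>Layer-cake formula: the superlevel sets of an antitone function are down-closed.\<close>

lemma integral_antimono_le:
  fixes f :: "real \<Rightarrow> real"
  assumes \<mu>: "real_distribution \<mu>" and \<nu>: "real_distribution \<nu>"
    and \<Delta>: "\<And>x. \<bar>cdf \<mu> x - cdf \<nu> x\<bar> \<le> \<Delta>"
    and f: "antimono f" "\<And>x. 0 \<le> f x" "\<And>x. f x \<le> C"
  shows "integral\<^sup>L \<mu> f \<le> integral\<^sup>L \<nu> f + C * \<Delta>"
proof -
  interpret \<mu>: real_distribution \<mu> by fact
  interpret \<nu>: real_distribution \<nu> by fact
  have \<Delta>0: "\<Delta> \<ge> 0" using \<Delta>[of 0] by linarith
  have C0: "C \<ge> 0" using f(2)[of 0] f(3)[of 0] by linarith
  have fm[measurable]: "f \<in> borel_measurable borel" by (rule borel_measurable_antimono) fact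
  \<comment> \<open>Tonelli, with \<open>f x\<close> written as the length of
    \<open>{0..<f x}\<close>. Confining \<open>t\<close> to \<open>{0..C}\<close> is what produces
    the factor \<open>C\<close> in the error.\<close>
  have layer: "integral\<^sup>N \<rho> (\<lambda>x. ennreal (f x)) = (\<integral>\<^sup>+t. emeasure \<rho> {x. t < f x} * indicator {0..C} t \<partial>lborel)"
    if "real_distribution \<rho>" for \<rho>
  proof -
    interpret \<rho>: real_distribution \<rho> by fact
    interpret P: pair_sigma_finite \<rho> lborel ..
    have [measurable_cong]: "sets \<rho> = sets borel" by simp
    have "integral\<^sup>N \<rho> (\<lambda>x. ennreal (f x)) = (\<integral>\<^sup>+x. (\<integral>\<^sup>+t. indicator {0..C} t * indicator {t. t < f x} t \<partial>lborel) \<partial>\<rho>)"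
    proof (rule nn_integral_cong)
      fix x
      have "(\<integral>\<^sup>+t. indicator {0..C} t * indicator {t. t < f x} t \<partial>lborel) = (\<integral>\<^sup>+t. indicator {0..<f x} t \<partial>lborel)"
        using f(3)[of x] by (intro nn_integral_cong) (auto split: split_indicator)
      also have "\<dots> = ennreal (f x)" using f(2)[of x] by simp
      finally show "ennreal (f x) = (\<integral>\<^sup>+t. indicator {0..C} t * indicator {t. t < f x} t \<partial>lborel)" ..
    qed
    also have "\<dots> = (\<integral>\<^sup>+t. (\<integral>\<^sup>+x. indicator {0..C} t * indicator {t. t < f x} t \<partial>\<rho>) \<partial>lborel)"
      by (rule P.Fubini'[symmetric]) measurable
    also have "\<dots> = (\<integral>\<^sup>+t. emeasure \<rho> {x. t < f x} * indicator {0..C} t \<partial>lborel)"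
    proof (rule nn_integral_cong)
      fix t
      have "(\<integral>\<^sup>+x. indicator {0..C} t * indicator {t. t < f x} t \<partial>\<rho>)
          = (\<integral>\<^sup>+x. indicator {0..C} t * indicator {x. t < f x} x \<partial>\<rho>)"
        by (intro nn_integral_cong) (auto split: split_indicator)
      also have "\<dots> = indicator {0..C} t * emeasure \<rho> {x. t < f x}"
        by (subst nn_integral_cmult_indicator) auto
      finally show "(\<integral>\<^sup>+x. indicator {0..C} t * indicator {t. t < f x} t \<partial>\<rho>) =
          emeasure \<rho> {x. t < f x} * indicator {0..C} t" by (simp add: mult.commute)
    qed
    finally show ?thesis .
  qed
  have "integral\<^sup>N \<mu> (\<lambda>x. ennreal (f x)) \<le> (\<integral>\<^sup>+t. emeasure \<nu> {x. t < f x} * indicator {0..C} t + ennreal \<Delta> * indicator {0..C} t \<partial>lborel)"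
    unfolding layer[OF \<mu>]
  proof (rule nn_integral_mono)
    fix t
    have "\<bar>measure \<mu> {x. t < f x} - measure \<nu> {x. t < f x}\<bar> \<le> \<Delta>"
      by (rule measure_down_closed_diff[OF \<mu> \<nu> \<Delta>]) (use f(1) in \<open>auto simp: antimono_def intro: less_le_trans\<close>)
    hence "emeasure \<mu> {x. t < f x} \<le> emeasure \<nu> {x. t < f x} + ennreal \<Delta>"
      unfolding \<mu>.emeasure_eq_measure \<nu>.emeasure_eq_measure
      using \<Delta>0 by (subst ennreal_plus[symmetric]) (auto intro!: ennreal_leI simp del: ennreal_plus)
    thus "emeasure \<mu> {x. t < f x} * indicator {0..C} t
        \<le> emeasure \<nu> {x. t < f x} * indicator {0..C} t + ennreal \<Delta> * indicator {0..C} t"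
      by (auto split: split_indicator)
  qed
  also have "\<dots> = integral\<^sup>N \<nu> (\<lambda>x. ennreal (f x)) + ennreal \<Delta> * ennreal C"
  proof (subst nn_integral_add)
    have [measurable_cong]: "sets \<nu> = sets borel" by simp
    show "(\<lambda>t. emeasure \<nu> {x. t < f x} * indicator {0..C} t) \<in> borel_measurable lborel"
    proof -
      have "(\<lambda>t. emeasure \<nu> {x \<in> space \<nu>. t < f x}) \<in> borel_measurable borel" by measurable
      thus ?thesis by simp
    qed
  qed (use layer[OF \<nu>] C0 in \<open>auto simp: nn_integral_cmult_indicator\<close>)
  finally have le: "integral\<^sup>N \<mu> (\<lambda>x. ennreal (f x)) \<le> integral\<^sup>N \<nu> (\<lambda>x. ennreal (f x)) + ennreal (C * \<Delta>)"
    using C0 \<Delta>0 by (simp add: ennreal_mult mult.commute)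
  have int: "integrable \<rho> f" if "real_distribution \<rho>" for \<rho>
  proof -
    interpret \<rho>: real_distribution \<rho> by fact
    show ?thesis using f(2,3) by (intro \<rho>.integrable_const_bound[of _ C]) auto
  qed
  have "ennreal (integral\<^sup>L \<mu> f) \<le> ennreal (integral\<^sup>L \<nu> f + C * \<Delta>)"
    using le f(2) C0 \<Delta>0 by (simp add: nn_integral_eq_integral int \<mu> \<nu> ennreal_plus[symmetric] del: ennreal_plus)
  thus ?thesis using f(2) C0 \<Delta>0 by (subst (asm) ennreal_le_iff) auto
qed

lemma integral_antimono_diff:
  fixes f :: "real \<Rightarrow> real"
  assumes "real_distribution \<mu>" "real_distribution \<nu>"
    "\<And>x. \<bar>cdf \<mu> x - cdf \<nu> x\<bar> \<le> \<Delta>"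
    "antimono f" "\<And>x. 0 \<le> f x" "\<And>x. f x \<le> C"
  shows "\<bar>integral\<^sup>L \<mu> f - integral\<^sup>L \<nu> f\<bar> \<le> C * \<Delta>"
  using integral_antimono_le[OF assms]
    integral_antimono_le[OF assms(2,1) _ assms(4-6), where \<Delta> = \<Delta>] assms(3)
  by (auto simp: abs_le_iff abs_minus_commute)

text \<open>At the smoothed empirical c.d.f. its square is the integrand of \<open>contrast\<close>;
  at the true c.d.f. it is the residual of the overview. Keeping \<open>F\<close> as an argument
  lets one set of estimates serve both.\<close>

definition residual :: "real \<times> real \<times> real \<Rightarrow> (real \<Rightarrow> real) \<Rightarrow> real \<Rightarrow> real" where
  "residual \<theta> F x = mix_op \<theta> (reflect_cdf (mix_op_inv \<theta> F)) x - F x"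

lemma residual_eq:
  "residual (l, m1, m2) F x = 1 - l * mix_op_inv (l, m1, m2) F (m1 - x)
     - (1 - l) * mix_op_inv (l, m1, m2) F (m2 - x) - F x"
  by (simp add: residual_def mix_op_eq reflect_cdf_def algebra_simps)

text \<open>The coefficients alternate in sign. Collected by sign, each part is a nonnegative
  combination of translates of \<open>F\<close>, hence monotone whatever the sign of
  \<open>m2 - m1\<close>.\<close>

lemma mix_op_inv_mono_split:
  assumes l: "0 \<le> l" "l \<le> 1/2 - d" "0 < d"
    and F: "mono F" "\<And>x. 0 \<le> F x" "\<And>x. F x \<le> (1::real)"
  obtains U V where "mono U" "mono V" "\<And>x. 0 \<le> U x" "\<And>x. 0 \<le> V x"
    "\<And>x. U x \<le> 1 / (2 * d)" "\<And>x. V x \<le> 1 / (2 * d)"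
    "\<And>x. mix_op_inv (l, m1, m2) F x = U x - V x"
proof -
  define r where "r = - l / (1 - l)"
  have r: "\<bar>r\<bar> < 1" using mix_ratio_abs_less[of l] l by (simp add: r_def)
  \<comment> \<open>The series of \<open>mix_op_inv\<close> with the powers of \<open>r\<close>
    replaced by weights \<open>w\<close>, so that both signs are treated at once.\<close>
  define W where "W = (\<lambda>w x. 1 / (1 - l) * (\<Sum>k. w k * F (x + m2 + real k * (m2 - m1))))"
  have *: "mono (W w)" "\<And>x. 0 \<le> W w x" "\<And>x. W w x \<le> 1 / (2 * d)"
    and sm: "\<And>x. summable (\<lambda>k. w k * F (x + m2 + real k * (m2 - m1)))"
    if w: "\<And>k. 0 \<le> w k" "\<And>k. w k \<le> \<bar>r\<bar> ^ k" for w
  proof -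
    have g: "summable (\<lambda>k. \<bar>r\<bar> ^ k)" using r by (intro summable_geometric) auto
    have b: "w k * F y \<le> \<bar>r\<bar> ^ k" for k y
      using mult_mono[OF w(2) F(3)[of y], of k] F(2)[of y] by simp
    show s: "summable (\<lambda>k. w k * F (x + m2 + real k * (m2 - m1)))" for x
      by (rule summable_comparison_test'[OF g, of 0]) (use w F(2) b in \<open>auto simp: abs_mult\<close>)
    show "mono (W w)"
      unfolding W_def using l w F(1)
      by (intro monoI mult_left_mono suminf_le s mult_left_mono monoD[OF F(1)]) auto
    show "0 \<le> W w x" for x
      unfolding W_def using l w F(2) by (intro mult_nonneg_nonneg suminf_nonneg s) auto
    show "W w x \<le> 1 / (2 * d)" for x
    proof -
      have "(\<Sum>k. w k * F (x + m2 + real k * (m2 - m1))) \<le> (\<Sum>k. \<bar>r\<bar> ^ k)"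
        by (rule suminf_le[OF b s g])
      also have "\<dots> = (1 - l) / (1 - 2 * l)"
        using l r by (subst suminf_geometric) (auto simp: r_def divide_simps abs_if)
      finally have "W w x \<le> 1 / (1 - l) * ((1 - l) / (1 - 2 * l))"
        unfolding W_def using l by (intro mult_left_mono) auto
      also have "\<dots> = 1 / (1 - 2 * l)" using l by simp
      also have "\<dots> \<le> 1 / (2 * d)" using l by (intro divide_left_mono) auto
      finally show ?thesis .
    qed
  qed
  define p n where "p = (\<lambda>k. max (r ^ k) 0)" and "n = (\<lambda>k. max (- (r ^ k)) 0)"
  have p: "\<And>k. 0 \<le> p k" "\<And>k. p k \<le> \<bar>r\<bar> ^ k" and n: "\<And>k. 0 \<le> n k" "\<And>k. n k \<le> \<bar>r\<bar> ^ k"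
    using abs_ge_self[of "r ^ _"] abs_ge_minus_self[of "r ^ _"]
    by (auto simp: p_def n_def power_abs[symmetric])
  have "mix_op_inv (l, m1, m2) F x = W p x - W n x" for x
  proof -
    have "W p x - W n x = 1 / (1 - l) * ((\<Sum>k. p k * F (x + m2 + real k * (m2 - m1))) - (\<Sum>k. n k * F (x + m2 + real k * (m2 - m1))))"
      by (simp only: W_def right_diff_distrib)
    also have "(\<Sum>k. p k * F (x + m2 + real k * (m2 - m1))) - (\<Sum>k. n k * F (x + m2 + real k * (m2 - m1)))
       = (\<Sum>k. p k * F (x + m2 + real k * (m2 - m1)) - n k * F (x + m2 + real k * (m2 - m1)))"
      by (rule suminf_diff[OF sm[OF p] sm[OF n]])
    also have "(\<lambda>k. p k * F (x + m2 + real k * (m2 - m1)) - n k * F (x + m2 + real k * (m2 - m1)))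
        = (\<lambda>k. r ^ k * F (x + m2 + real k * (m2 - m1)))"
      by (auto simp: fun_eq_iff p_def n_def max_def)
    finally show ?thesis by (simp only: mix_op_inv_eq r_def)
  qed
  thus ?thesis using that *[OF p] *[OF n] by blast
qed

text \<open>The monotone pieces enter at reflected arguments and become antitone. Of the resulting
  terms, \<open>1 - F\<close> and the image of \<open>V\<close> carry a plus sign and form the first
  piece; the image of \<open>U\<close> carries a minus sign and forms the second.\<close>

lemma residual_split:
  assumes l: "0 \<le> l" "l \<le> 1/2 - d" "0 < d"
    and F: "mono F" "\<And>x. 0 \<le> F x" "\<And>x. F x \<le> (1::real)"
  obtains U V where "antimono U" "antimono V" "\<And>x. 0 \<le> U x" "\<And>x. 0 \<le> V x"
    "\<And>x. U x \<le> 1 + 1 / (2 * d)" "\<And>x. V x \<le> 1 + 1 / (2 * d)"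
    "\<And>x. residual (l, m1, m2) F x = U x - V x"
proof -
  obtain U V where UV: "mono U" "mono V" "\<And>x. 0 \<le> U x" "\<And>x. 0 \<le> V x"
    "\<And>x. U x \<le> 1 / (2 * d)" "\<And>x. V x \<le> 1 / (2 * d)"
    "\<And>x. mix_op_inv (l, m1, m2) F x = U x - V x"
    using mix_op_inv_mono_split[OF assms, of m1 m2] by metis
  define mx where "mx = (\<lambda>W x :: real. l * W (m1 - x) + (1 - l) * W (m2 - x) :: real)"
  have mx: "antimono (mx W)" "0 \<le> mx W x" "mx W x \<le> 1 / (2 * d)"
    if W: "mono W" "\<And>x. 0 \<le> W x" "\<And>x. W x \<le> 1 / (2 * d)" for W x
  proof -
    show "antimono (mx W)" unfolding mx_def
      using l by (intro antimonoI add_mono mult_left_mono monoD[OF W(1)]) auto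
    show "0 \<le> mx W x" unfolding mx_def using l W by auto
    show "mx W x \<le> 1 / (2 * d)"
      unfolding mx_def using l W(3) by (intro convex_bound_le) auto
  qed
  show ?thesis
  proof (rule that[of "\<lambda>x. 1 - F x + mx V x" "mx U"])
    show "antimono (\<lambda>x. 1 - F x + mx V x)"
      using mx(1)[OF UV(2,4,6)] F(1) by (intro antimonoI add_mono) (auto simp: antimono_def mono_def)
    show "antimono (mx U)" "\<And>x. 0 \<le> mx U x" using mx[OF UV(1,3,5)] by auto
    fix x
    note V = mx(2,3)[OF UV(2,4,6), of x] and U = mx(3)[OF UV(1,3,5), of x]
    show "0 \<le> 1 - F x + mx V x" using V F(3)[of x] by linarith
    show "1 - F x + mx V x \<le> 1 + 1 / (2 * d)" using V F(2)[of x] by linarith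
    show "mx U x \<le> 1 + 1 / (2 * d)" using U by linarith
    show "residual (l, m1, m2) F x = 1 - F x + mx V x - mx U x"
      by (simp add: residual_eq mx_def UV(7) right_diff_distrib)
  qed
qed

lemma residual_measurable [measurable]:
  assumes "0 \<le> l" "l \<le> 1/2 - d" "0 < d" "mono F" "\<And>x. 0 \<le> F x" "\<And>x. F x \<le> (1::real)"
  shows "residual (l, m1, m2) F \<in> borel_measurable borel"
proof -
  obtain U V where UV: "antimono U" "antimono V" "\<And>x. residual (l, m1, m2) F x = U x - V x"
    using residual_split[OF assms, of m1 m2] by metis
  have "residual (l, m1, m2) F = (\<lambda>x. U x - V x)" using UV(3) by auto
  thus ?thesis using UV(1,2)[THEN borel_measurable_antimono] by simp
qed

lemma residual_bound:
  assumes "0 \<le> l" "l \<le> 1/2 - d" "0 < d" "mono F" "\<And>x. 0 \<le> F x" "\<And>x. F x \<le> (1::real)"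
  shows "\<bar>residual (l, m1, m2) F x\<bar> \<le> 1 + 1 / (2 * d)"
proof -
  obtain U V where UV: "\<And>x. 0 \<le> U x" "\<And>x. 0 \<le> V x"
    "\<And>x. U x \<le> 1 + 1 / (2 * d)" "\<And>x. V x \<le> 1 + 1 / (2 * d)"
    "\<And>x. residual (l, m1, m2) F x = U x - V x"
    using residual_split[OF assms, of m1 m2] by metis
  show ?thesis using UV(1-4)[of x] by (simp add: UV(5) abs_le_iff)
qed

text \<open>The square of \<open>U - V\<close> is the sum of the two squares minus twice the
  product. As \<open>U\<close> and \<open>V\<close> are antitone and nonnegative, both parts are
  antitone with values between 0 and \<open>2 * C\<^sup>2\<close>, so each contributes
  \<open>2 * C\<^sup>2 * \<Delta>\<close>.\<close>

lemma integral_residual_sq_measure_diff: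
  assumes l: "0 \<le> l" "l \<le> 1/2 - d" "0 < d"
    and F: "mono F" "\<And>x. 0 \<le> F x" "\<And>x. F x \<le> (1::real)"
    and \<mu>: "real_distribution \<mu>" and \<nu>: "real_distribution \<nu>"
    and \<Delta>: "\<And>x. \<bar>cdf \<mu> x - cdf \<nu> x\<bar> \<le> \<Delta>"
  shows "\<bar>(\<integral>x. (residual (l, m1, m2) F x)\<^sup>2 \<partial>\<mu>) - (\<integral>x. (residual (l, m1, m2) F x)\<^sup>2 \<partial>\<nu>)\<bar>
    \<le> 4 * (1 + 1 / (2 * d))\<^sup>2 * \<Delta>"
proof -
  define C where "C = 1 + 1 / (2 * d)"
  obtain U V where UV: "antimono U" "antimono V" "\<And>x. 0 \<le> U x" "\<And>x. 0 \<le> V x"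
    "\<And>x. U x \<le> C" "\<And>x. V x \<le> C" "\<And>x. residual (l, m1, m2) F x = U x - V x"
    using residual_split[OF l F, of m1 m2] unfolding C_def by metis
  have C: "C \<ge> 0" using UV(3,5)[of 0] by linarith
  define A where "A = (\<lambda>x. (U x)\<^sup>2 + (V x)\<^sup>2)"
  define B where "B = (\<lambda>x. 2 * (U x * V x))"
  have mono: "antimono A" "antimono B"
    using UV(1-4) unfolding A_def B_def
    by (auto simp: antimono_def intro!: add_mono power_mono mult_mono)
  have sq: "(U x)\<^sup>2 \<le> C\<^sup>2" "(V x)\<^sup>2 \<le> C\<^sup>2" "U x * V x \<le> C\<^sup>2" for x
    using UV(3-6)[of x] C by (auto simp: power2_eq_square intro!: mult_mono)
  have bd: "0 \<le> A x" "A x \<le> 2 * C\<^sup>2" "0 \<le> B x" "B x \<le> 2 * C\<^sup>2" for x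
    using UV(3,4)[of x] sq[of x] add_mono[OF sq(1)[of x] sq(2)[of x]] by (auto simp: A_def B_def)
  have int: "integrable \<rho> A" "integrable \<rho> B" if "real_distribution \<rho>" for \<rho>
  proof -
    interpret \<rho>: real_distribution \<rho> by fact
    show "integrable \<rho> A" "integrable \<rho> B"
      using bd mono[THEN borel_measurable_antimono]
      by (auto intro!: \<rho>.integrable_const_bound[of _ "2 * C\<^sup>2"])
  qed
  have "(\<integral>x. (residual (l, m1, m2) F x)\<^sup>2 \<partial>\<rho>) = integral\<^sup>L \<rho> A - integral\<^sup>L \<rho> B" if "real_distribution \<rho>" for \<rho>
    by (subst Bochner_Integration.integral_diff[symmetric, OF int[OF that]])
       (auto simp: UV(7) A_def B_def power2_diff mult.assoc)
  hence "(\<integral>x. (residual (l, m1, m2) F x)\<^sup>2 \<partial>\<mu>) - (\<integral>x. (residual (l, m1, m2) F x)\<^sup>2 \<partial>\<nu>)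
     = (integral\<^sup>L \<mu> A - integral\<^sup>L \<nu> A) - (integral\<^sup>L \<mu> B - integral\<^sup>L \<nu> B)"
    using \<mu> \<nu> by simp
  moreover have "\<bar>integral\<^sup>L \<mu> A - integral\<^sup>L \<nu> A\<bar> \<le> 2 * C\<^sup>2 * \<Delta>"
    by (rule integral_antimono_diff[OF \<mu> \<nu> \<Delta> mono(1) bd(1,2)])
  moreover have "\<bar>integral\<^sup>L \<mu> B - integral\<^sup>L \<nu> B\<bar> \<le> 2 * C\<^sup>2 * \<Delta>"
    by (rule integral_antimono_diff[OF \<mu> \<nu> \<Delta> mono(2) bd(3,4)])
  ultimately show ?thesis unfolding C_def[symmetric] by linarith
qed

section \<open>Stability of the residual under an integrated change of its c.d.f\<close>

lemma mix_op_inv_diff: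
  assumes "0 \<le> l" "l < 1/2" "\<And>y. \<bar>f y\<bar> \<le> C" "\<And>y. \<bar>g y\<bar> \<le> C'"
  shows "mix_op_inv (l, m1, m2) (\<lambda>x. f x - g x) t = mix_op_inv (l, m1, m2) f t - mix_op_inv (l, m1, m2) g t"
proof -
  note s = summable_mix_series(1)[OF assms(1,2)]
  show ?thesis unfolding mix_op_inv_eq
    unfolding right_diff_distrib
    by (subst suminf_diff[symmetric, OF s[of _ C] s[of _ C']])
       (use assms(3,4) in \<open>auto simp: right_diff_distrib\<close>)
qed

text \<open>The integral against \<open>\<nu>\<close> is not translation invariant, so the
  hypothesis controls all reflected translates at once. Every term of the series is such a
  translate, and the geometric weights sum to at most \<open>1 / (2 * d)\<close>.\<close>

lemma nn_integral_mix_op_inv_le: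
  fixes D :: "real \<Rightarrow> real"
  assumes l: "0 \<le> l" "l \<le> 1/2 - d" "0 < d" and e: "0 \<le> e"
    and D[measurable]: "D \<in> borel_measurable borel" and bd: "\<And>y. \<bar>D y\<bar> \<le> C"
    and \<nu>: "sets \<nu> = sets borel"
    and le: "\<And>s. (\<integral>\<^sup>+x. ennreal \<bar>D (s - x)\<bar> \<partial>\<nu>) \<le> ennreal e"
  shows "(\<integral>\<^sup>+x. ennreal \<bar>mix_op_inv (l, m1, m2) D (s - x)\<bar> \<partial>\<nu>) \<le> ennreal (e / (2 * d))"
proof -
  note [measurable_cong] = \<nu>
  define r where "r = \<bar>- l / (1 - l)\<bar>"
  have r: "0 \<le> r" "r < 1" using mix_ratio_abs_less[of l] l by (auto simp: r_def)
  have ss: "summable (\<lambda>k. r ^ k * \<bar>D (y + m2 + real k * (m2 - m1))\<bar>)" for y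
    by (rule summable_comparison_test'[of "\<lambda>k. r ^ k * C" 0])
       (use r bd in \<open>auto intro!: summable_mult2 summable_geometric mult_left_mono\<close>)
  have gs: "(\<lambda>k. 1 / (1 - l) * r ^ k * e) sums (1 / (1 - l) * (1 / (1 - r)) * e)"
    using r by (intro sums_mult sums_mult2 geometric_sums) auto
  have ge: "1 / (1 - l) * (1 / (1 - r)) * e \<le> e / (2 * d)"
  proof -
    have "1 / (1 - l) * (1 / (1 - r)) = 1 / (1 - 2 * l)"
      using l by (auto simp: r_def divide_simps abs_if)
    also have "\<dots> \<le> 1 / (2 * d)" using l by (intro divide_left_mono) auto
    finally have "1 / (1 - l) * (1 / (1 - r)) * e \<le> 1 / (2 * d) * e"
      by (rule mult_right_mono) fact
    thus ?thesis by simp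
  qed
  have "(\<integral>\<^sup>+x. ennreal \<bar>mix_op_inv (l, m1, m2) D (s - x)\<bar> \<partial>\<nu>)
     \<le> (\<integral>\<^sup>+x. (\<Sum>k. ennreal (1 / (1 - l) * r ^ k) * ennreal \<bar>D (s + m2 + real k * (m2 - m1) - x)\<bar>) \<partial>\<nu>)"
  proof (rule nn_integral_mono)
    fix x
    have "\<bar>mix_op_inv (l, m1, m2) D (s - x)\<bar> \<le> 1 / (1 - l) * (\<Sum>k. r ^ k * \<bar>D (s - x + m2 + real k * (m2 - m1))\<bar>)"
    proof -
      have "norm (\<Sum>k. (- l / (1 - l)) ^ k * D (s - x + m2 + real k * (m2 - m1)))
         \<le> (\<Sum>k. r ^ k * \<bar>D (s - x + m2 + real k * (m2 - m1))\<bar>)"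
        by (rule norm_suminf_le[OF _ ss]) (simp add: abs_mult power_abs r_def)
      thus ?thesis unfolding mix_op_inv_eq using l by (simp add: abs_mult divide_right_mono)
    qed
    also have "\<dots> = (\<Sum>k. 1 / (1 - l) * (r ^ k * \<bar>D (s - x + m2 + real k * (m2 - m1))\<bar>))"
      by (rule suminf_mult[symmetric, OF ss])
    finally have "ennreal \<bar>mix_op_inv (l, m1, m2) D (s - x)\<bar> \<le> ennreal \<dots>" by (rule ennreal_leI)
    also have "\<dots> = (\<Sum>k. ennreal (1 / (1 - l) * (r ^ k * \<bar>D (s - x + m2 + real k * (m2 - m1))\<bar>)))"
      using l r by (intro suminf_ennreal2[symmetric] summable_mult ss) auto
    also have "\<dots> = (\<Sum>k. ennreal (1 / (1 - l) * r ^ k) * ennreal \<bar>D (s + m2 + real k * (m2 - m1) - x)\<bar>)"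
    proof (rule suminf_cong)
      fix k
      have eq: "s - x + m2 + real k * (m2 - m1) = s + m2 + real k * (m2 - m1) - x" by simp
      show "ennreal (1 / (1 - l) * (r ^ k * \<bar>D (s - x + m2 + real k * (m2 - m1))\<bar>))
        = ennreal (1 / (1 - l) * r ^ k) * ennreal \<bar>D (s + m2 + real k * (m2 - m1) - x)\<bar>"
        unfolding eq using l r by (subst ennreal_mult[symmetric]) (auto simp: mult_ac)
    qed
    finally show "ennreal \<bar>mix_op_inv (l, m1, m2) D (s - x)\<bar> \<le> \<dots>" .
  qed
  also have "\<dots> = (\<Sum>k. ennreal (1 / (1 - l) * r ^ k) * (\<integral>\<^sup>+x. ennreal \<bar>D (s + m2 + real k * (m2 - m1) - x)\<bar> \<partial>\<nu>))"
    by (subst nn_integral_suminf) (auto simp: nn_integral_cmult)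
  also have "\<dots> \<le> (\<Sum>k. ennreal (1 / (1 - l) * r ^ k) * ennreal e)"
    by (intro suminf_le mult_left_mono le) auto
  also have "\<dots> = (\<Sum>k. ennreal (1 / (1 - l) * r ^ k * e))"
    using l r e by (intro suminf_cong ennreal_mult[symmetric]) auto
  also have "\<dots> = ennreal (1 / (1 - l) * (1 / (1 - r)) * e)"
    using gs l r e by (intro suminf_ennreal_eq) auto
  also have "\<dots> \<le> ennreal (e / (2 * d))" using ge by (rule ennreal_leI)
  finally show ?thesis .
qed

text \<open>The residual is affine in its c.d.f., so the difference of residuals is built from
  \<open>F - H\<close>; bounded residuals then turn the difference of squares into a multiple of it.
  \<open>le\<close> serves the reflected arguments and \<open>le0\<close> the unreflected last
  term.\<close>

lemma integral_residual_sq_diff: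
  assumes l: "0 \<le> l" "l \<le> 1/2 - d" "0 < d"
    and F: "mono F" "\<And>x. 0 \<le> F x" "\<And>x. F x \<le> (1::real)"
    and H: "mono H" "\<And>x. 0 \<le> H x" "\<And>x. H x \<le> (1::real)"
    and \<nu>: "real_distribution \<nu>" and e: "0 \<le> e"
    and le: "\<And>s. (\<integral>\<^sup>+x. ennreal \<bar>F (s - x) - H (s - x)\<bar> \<partial>\<nu>) \<le> ennreal e"
    and le0: "(\<integral>\<^sup>+x. ennreal \<bar>F x - H x\<bar> \<partial>\<nu>) \<le> ennreal e"
  shows "\<bar>(\<integral>x. (residual (l, m1, m2) F x)\<^sup>2 \<partial>\<nu>) - (\<integral>x. (residual (l, m1, m2) H x)\<^sup>2 \<partial>\<nu>)\<bar>
    \<le> 2 * (1 + 1 / (2 * d))\<^sup>2 * e"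
proof -
  interpret \<nu>: real_distribution \<nu> by fact
  define C where "C = 1 + 1 / (2 * d)"
  have C: "C \<ge> 0" using l by (simp add: C_def)
  have [measurable]: "F \<in> borel_measurable borel" "H \<in> borel_measurable borel"
    using F(1) H(1) by (auto intro: borel_measurable_mono)
  define D where "D = (\<lambda>x. F x - H x)"
  have [measurable]: "D \<in> borel_measurable borel" unfolding D_def by measurable
  have Db: "\<bar>D y\<bar> \<le> 1" for y
    using F(2,3)[of y] H(2,3)[of y] by (auto simp: D_def abs_le_iff)
  define RF RH where "RF = residual (l, m1, m2) F" and "RH = residual (l, m1, m2) H"
  define N where "N = mix_op_inv (l, m1, m2) D"
  have RFH: "RF x - RH x = - (l * N (m1 - x)) - (1 - l) * N (m2 - x) - D x" for x
    unfolding RF_def RH_def residual_eq N_def D_def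
    by (subst (1 2) mix_op_inv_diff[of _ _ 1 _ 1])
       (use l F H in \<open>auto simp: algebra_simps abs_of_nonneg\<close>)
  have mR[measurable]: "RF \<in> borel_measurable borel" "RH \<in> borel_measurable borel"
    unfolding RF_def RH_def using residual_measurable[OF l F] residual_measurable[OF l H] by auto
  have mN[measurable]: "N \<in> borel_measurable borel"
    unfolding N_def mix_op_inv_eq by measurable
  have bR: "\<bar>RF x\<bar> \<le> C" "\<bar>RH x\<bar> \<le> C" for x
    unfolding RF_def RH_def C_def using residual_bound[OF l F] residual_bound[OF l H] by auto
  have NI: "(\<integral>\<^sup>+x. ennreal \<bar>N (s - x)\<bar> \<partial>\<nu>) \<le> ennreal (e / (2 * d))" for s
    unfolding N_def by (rule nn_integral_mix_op_inv_le[OF l e _ Db]) (use le in \<open>auto simp: D_def\<close>)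
  have "(\<integral>\<^sup>+x. ennreal \<bar>RF x - RH x\<bar> \<partial>\<nu>)
     \<le> (\<integral>\<^sup>+x. (ennreal l * ennreal \<bar>N (m1 - x)\<bar> + ennreal (1 - l) * ennreal \<bar>N (m2 - x)\<bar>) + ennreal \<bar>D x\<bar> \<partial>\<nu>)"
  proof (rule nn_integral_mono)
    fix x
    have "\<bar>RF x - RH x\<bar> \<le> l * \<bar>N (m1 - x)\<bar> + (1 - l) * \<bar>N (m2 - x)\<bar> + \<bar>D x\<bar>"
    proof -
      have "\<bar>l * N (m1 - x)\<bar> = l * \<bar>N (m1 - x)\<bar>" "\<bar>(1 - l) * N (m2 - x)\<bar> = (1 - l) * \<bar>N (m2 - x)\<bar>"
        using l by (auto simp: abs_mult)
      thus ?thesis unfolding RFH by linarith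
    qed
    thus "ennreal \<bar>RF x - RH x\<bar> \<le> (ennreal l * ennreal \<bar>N (m1 - x)\<bar> + ennreal (1 - l) * ennreal \<bar>N (m2 - x)\<bar>) + ennreal \<bar>D x\<bar>"
      using l by (simp add: ennreal_mult[symmetric] ennreal_plus[symmetric] ennreal_leI del: ennreal_plus)
  qed
  also have "\<dots> = ennreal l * (\<integral>\<^sup>+x. ennreal \<bar>N (m1 - x)\<bar> \<partial>\<nu>) + ennreal (1 - l) * (\<integral>\<^sup>+x. ennreal \<bar>N (m2 - x)\<bar> \<partial>\<nu>)
      + (\<integral>\<^sup>+x. ennreal \<bar>D x\<bar> \<partial>\<nu>)"
    by (simp add: nn_integral_add nn_integral_cmult)
  also have "\<dots> \<le> ennreal l * ennreal (e / (2 * d)) + ennreal (1 - l) * ennreal (e / (2 * d)) + ennreal e"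
    by (intro add_mono mult_left_mono NI) (use le0 in \<open>auto simp: D_def\<close>)
  also have "\<dots> = ennreal (C * e)"
  proof -
    define E where "E = e / (2 * d)"
    have "C * e = l * E + (1 - l) * E + e" "0 \<le> E"
      using l e by (simp_all add: C_def E_def field_simps)
    thus ?thesis unfolding E_def[symmetric] using l e by (simp add: ennreal_mult)
  qed
  finally have RI: "(\<integral>\<^sup>+x. ennreal \<bar>RF x - RH x\<bar> \<partial>\<nu>) \<le> ennreal (C * e)" .
  have int2: "integrable \<nu> (\<lambda>x. (RF x)\<^sup>2)" "integrable \<nu> (\<lambda>x. (RH x)\<^sup>2)"
    using C bR by (auto intro!: \<nu>.integrable_const_bound[of _ "C\<^sup>2"] simp: abs_le_square_iff[symmetric])
  have int1: "integrable \<nu> (\<lambda>x. \<bar>RF x - RH x\<bar>)"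
  proof (rule \<nu>.integrable_const_bound[of _ "2 * C"])
    have "\<bar>RF x - RH x\<bar> \<le> 2 * C" for x using bR[of x] by linarith
    thus "AE x in \<nu>. norm \<bar>RF x - RH x\<bar> \<le> 2 * C" by auto
  qed auto
  have I1: "(\<integral>x. \<bar>RF x - RH x\<bar> \<partial>\<nu>) \<le> C * e"
    using RI C e by (subst (asm) nn_integral_eq_integral[OF int1]) (auto simp: ennreal_le_iff)
  have "\<bar>(\<integral>x. (RF x)\<^sup>2 \<partial>\<nu>) - (\<integral>x. (RH x)\<^sup>2 \<partial>\<nu>)\<bar> = \<bar>\<integral>x. (RF x)\<^sup>2 - (RH x)\<^sup>2 \<partial>\<nu>\<bar>"
    by (simp add: Bochner_Integration.integral_diff int2)
  also have "\<dots> \<le> (\<integral>x. \<bar>(RF x)\<^sup>2 - (RH x)\<^sup>2\<bar> \<partial>\<nu>)" by (rule integral_abs_bound)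
  also have "\<dots> \<le> (\<integral>x. 2 * C * \<bar>RF x - RH x\<bar> \<partial>\<nu>)"
  proof (rule integral_mono)
    fix x
    have "\<bar>(RF x)\<^sup>2 - (RH x)\<^sup>2\<bar> = \<bar>RF x + RH x\<bar> * \<bar>RF x - RH x\<bar>"
      by (simp add: power2_eq_square abs_mult[symmetric] algebra_simps)
    also have "\<dots> \<le> 2 * C * \<bar>RF x - RH x\<bar>"
      using bR[of x] by (intro mult_right_mono) auto
    finally show "\<bar>(RF x)\<^sup>2 - (RH x)\<^sup>2\<bar> \<le> 2 * C * \<bar>RF x - RH x\<bar>" .
  qed (use int1 int2 in auto)
  also have "\<dots> = 2 * C * (\<integral>x. \<bar>RF x - RH x\<bar> \<partial>\<nu>)" by simp
  also have "\<dots> \<le> 2 * C * (C * e)" using I1 C by (intro mult_left_mono) auto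
  also have "\<dots> = 2 * C\<^sup>2 * e" by (simp add: power2_eq_square)
  finally show ?thesis unfolding RF_def RH_def C_def .
qed

section \<open>Linear relations between sines\<close>

lemma sin_sum_deriv_eq_0:
  fixes c a :: "'i \<Rightarrow> real"
  assumes \<epsilon>: "0 < \<epsilon>" and z: "\<And>t. \<bar>t\<bar> < \<epsilon> \<Longrightarrow> (\<Sum>i\<in>I. c i * sin (t * a i)) = 0"
    and t: "\<bar>t\<bar> < \<epsilon>"
  shows "(\<Sum>i\<in>I. c i * a i * cos (t * a i)) = 0" "(\<Sum>i\<in>I. c i * (a i)\<^sup>2 * sin (t * a i)) = 0"
proof -
  have open': "open {-\<epsilon><..<\<epsilon>}" by simp
  have 1: "(\<Sum>i\<in>I. c i * a i * cos (t * a i)) = 0" if t: "\<bar>t\<bar> < \<epsilon>" for t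
  proof -
    have "((\<lambda>t. \<Sum>i\<in>I. c i * sin (t * a i)) has_real_derivative (\<Sum>i\<in>I. c i * a i * cos (t * a i))) (at t)"
      by (auto intro!: derivative_eq_intros simp: mult_ac sum_distrib_left)
    moreover have "((\<lambda>t. \<Sum>i\<in>I. c i * sin (t * a i)) has_real_derivative 0) (at t)"
      by (rule has_field_derivative_transform_within_open[OF DERIV_const[of 0] open'])
         (use z t in auto)
    ultimately show ?thesis by (rule DERIV_unique)
  qed
  have "((\<lambda>t. \<Sum>i\<in>I. c i * a i * cos (t * a i)) has_real_derivative (\<Sum>i\<in>I. - (c i * (a i)\<^sup>2 * sin (t * a i)))) (at t)"
    by (auto intro!: derivative_eq_intros sum.cong simp: power2_eq_square)
  moreover have "((\<lambda>t. \<Sum>i\<in>I. c i * a i * cos (t * a i)) has_real_derivative 0) (at t)"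
    by (rule has_field_derivative_transform_within_open[OF DERIV_const[of 0] open'])
       (use 1 t in auto)
  ultimately have "(\<Sum>i\<in>I. - (c i * (a i)\<^sup>2 * sin (t * a i))) = 0" by (rule DERIV_unique)
  thus "(\<Sum>i\<in>I. c i * (a i)\<^sup>2 * sin (t * a i)) = 0" by (simp add: sum_negf)
  show "(\<Sum>i\<in>I. c i * a i * cos (t * a i)) = 0" using 1 t .
qed

text \<open>Up to sign and factorial these are the odd Taylor coefficients at 0. Two derivatives
  return a sine sum with \<open>c i\<close> multiplied by \<open>(a i)\<^sup>2\<close>, which drives
  the induction; one further derivative at 0 turns the sines into factors
  \<open>a i\<close>.\<close>

lemma sin_sum_odd_power_sums:
  fixes c a :: "'i \<Rightarrow> real"
  assumes \<epsilon>: "0 < \<epsilon>" and z: "\<And>t. \<bar>t\<bar> < \<epsilon> \<Longrightarrow> (\<Sum>i\<in>I. c i * sin (t * a i)) = 0"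
  shows "(\<Sum>i\<in>I. c i * a i ^ (2 * k + 1)) = 0"
  using z
proof (induction k arbitrary: c)
  case 0
  from sin_sum_deriv_eq_0(1)[OF \<epsilon> 0, of 0] show ?case using \<epsilon> by simp
next
  case (Suc k)
  have "(\<Sum>i\<in>I. (c i * (a i)\<^sup>2) * a i ^ (2 * k + 1)) = 0"
    by (rule Suc.IH) (use sin_sum_deriv_eq_0(2)[OF \<epsilon> Suc.prems] in auto)
  thus ?case by (simp add: power2_eq_square mult_ac)
qed

text \<open>Odd polynomials vanishing at the unwanted squares isolate one modulus.\<close>

lemma odd_power_sums_isolate:
  fixes c a :: "'i \<Rightarrow> real"
  assumes "finite I" and z: "\<And>k. (\<Sum>i\<in>I. c i * a i ^ (2 * k + 1)) = 0"
  shows "(\<Sum>i\<in>{i\<in>I. (a i)\<^sup>2 = v}. c i * a i) = 0"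
proof -
  \<comment> \<open>Multiplying each coefficient by a linear factor in \<open>(a i)\<^sup>2\<close>
    only combines odd power sums of consecutive odd orders, so all of them still vanish.\<close>
  have *: "(\<Sum>i\<in>I. c i * (\<Prod>w\<in>W. (a i)\<^sup>2 - w) * a i ^ (2 * k + 1)) = 0" if "finite W" for W k
    using that
  proof (induction W arbitrary: k rule: finite_induct)
    case empty
    thus ?case using z by simp
  next
    case (insert w W)
    have "(\<Sum>i\<in>I. c i * (\<Prod>w\<in>insert w W. (a i)\<^sup>2 - w) * a i ^ (2 * k + 1))
       = (\<Sum>i\<in>I. c i * (\<Prod>w\<in>W. (a i)\<^sup>2 - w) * a i ^ (2 * (Suc k) + 1)
                - w * (c i * (\<Prod>w\<in>W. (a i)\<^sup>2 - w) * a i ^ (2 * k + 1)))"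
      using insert by (intro sum.cong) (auto simp: algebra_simps power2_eq_square)
    also have "\<dots> = 0"
      unfolding sum_subtractf sum_distrib_left[symmetric] insert.IH by simp
    finally show ?case .
  qed
  define W where "W = (\<lambda>i. (a i)\<^sup>2) ` I - {v}"
  have W: "finite W" "v \<notin> W" using assms(1) by (auto simp: W_def)
  have "(\<Sum>i\<in>I. c i * (\<Prod>w\<in>W. (a i)\<^sup>2 - w) * a i)
      = (\<Sum>i\<in>{i\<in>I. (a i)\<^sup>2 = v}. c i * (\<Prod>w\<in>W. (a i)\<^sup>2 - w) * a i)"
  proof (rule sum.mono_neutral_right)
    show "\<forall>i\<in>I - {i \<in> I. (a i)\<^sup>2 = v}. c i * (\<Prod>w\<in>W. (a i)\<^sup>2 - w) * a i = 0"
    proof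
      fix i assume "i \<in> I - {i \<in> I. (a i)\<^sup>2 = v}"
      hence "(a i)\<^sup>2 \<in> W" by (auto simp: W_def)
      hence "(\<Prod>w\<in>W. (a i)\<^sup>2 - w) = 0" using W(1) by (intro prod_zero) auto
      thus "c i * (\<Prod>w\<in>W. (a i)\<^sup>2 - w) * a i = 0" by simp
    qed
  qed (use assms(1) in auto)
  also have "\<dots> = (\<Prod>w\<in>W. v - w) * (\<Sum>i\<in>{i\<in>I. (a i)\<^sup>2 = v}. c i * a i)"
    by (auto simp: sum_distrib_left intro!: sum.cong)
  finally have "(\<Prod>w\<in>W. v - w) * (\<Sum>i\<in>{i\<in>I. (a i)\<^sup>2 = v}. c i * a i) = 0"
    using *[OF W(1), of 0] by simp
  moreover have "(\<Prod>w\<in>W. v - w) \<noteq> 0" using W by (auto simp: prod_zero_iff)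
  ultimately show ?thesis by simp
qed

text \<open>The shifts are \<open>\<mu>\<^sub>i - \<mu>\<^sup>0\<^sub>j\<close> and the coefficients the products of the mixing weights.\<close>

lemma mixture_params_unique:
  fixes l l0 m1 m2 n1 n2 :: real
  assumes l: "0 \<le> l" "l < 1/2" and l0: "0 < l0" "l0 < 1/2" and m: "m1 \<noteq> m2" and n: "n1 \<noteq> n2"
    and \<epsilon>: "0 < \<epsilon>"
    and z: "\<And>t. \<bar>t\<bar> < \<epsilon> \<Longrightarrow> l * l0 * sin (t * (m1 - n1)) + l * (1 - l0) * sin (t * (m1 - n2))
        + (1 - l) * l0 * sin (t * (m2 - n1)) + (1 - l) * (1 - l0) * sin (t * (m2 - n2)) = 0"
  shows "l = l0" "m1 = n1" "m2 = n2"
proof -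
  define c where "c = (\<lambda>i::nat. [l * l0, l * (1 - l0), (1 - l) * l0, (1 - l) * (1 - l0)] ! i)"
  define a where "a = (\<lambda>i::nat. [m1 - n1, m1 - n2, m2 - n1, m2 - n2] ! i)"
  have sum4: "(\<Sum>i<4. g i) = g 0 + g 1 + g 2 + (g 3 :: real)" for g :: "nat \<Rightarrow> real"
    by (simp add: eval_nat_numeral)
  have "(\<Sum>i<4. c i * sin (t * a i)) = 0" if "\<bar>t\<bar> < \<epsilon>" for t
    unfolding sum4 using z[OF that] by (simp add: c_def a_def)
  from odd_power_sums_isolate[OF _ sin_sum_odd_power_sums[OF \<epsilon> this]]
  have "(\<Sum>i\<in>{i\<in>{..<4}. (a i)\<^sup>2 = v}. c i * a i) = 0" for v by simp
  hence "(\<Sum>i<4. if (a i)\<^sup>2 = v then c i * a i else 0) = 0" for v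
    by (simp add: sum.If_cases Int_def)
  hence "(if (a 0)\<^sup>2 = v then c 0 * a 0 else 0) + (if (a 1)\<^sup>2 = v then c 1 * a 1 else 0)
     + (if (a 2)\<^sup>2 = v then c 2 * a 2 else 0) + (if (a 3)\<^sup>2 = v then c 3 * a 3 else 0) = 0" for v
    unfolding sum4 .
  moreover have "a 0 = m1 - n1" "a 1 = m1 - n2" "a 2 = m2 - n1" "a 3 = m2 - n2"
    "c 0 = l * l0" "c 1 = l * (1 - l0)" "c 2 = (1 - l) * l0" "c 3 = (1 - l) * (1 - l0)"
    by (simp_all add: a_def c_def)
  ultimately have iso: "(if (m1 - n1)\<^sup>2 = v then l * l0 * (m1 - n1) else 0) + (if (m1 - n2)\<^sup>2 = v then l * (1 - l0) * (m1 - n2) else 0)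
     + (if (m2 - n1)\<^sup>2 = v then (1 - l) * l0 * (m2 - n1) else 0) + (if (m2 - n2)\<^sup>2 = v then (1 - l) * (1 - l0) * (m2 - n2) else 0) = 0" for v
    by (simp only:)
  define e h h0 where "e = m2 - n2" and "h = m2 - m1" and "h0 = n2 - n1"
  have hh: "h \<noteq> 0" "h0 \<noteq> 0" using m n by (auto simp: h_def h0_def)
  have diffs: "m1 - n1 = e + h0 - h" "m1 - n2 = e - h" "m2 - n1 = e + h0" "m2 - n2 = e"
    by (simp_all add: e_def h_def h0_def)
  \<comment> \<open>As \<open>l\<close> and \<open>l0\<close> lie below 1/2, \<open>p\<close>
    exceeds every other weight and \<open>wc\<close> exceeds \<open>wa\<close>. These strict
    inequalities decide all cases below.\<close>
  define wa wb wc p where w_defs: "wa = l * l0" "wb = l * (1 - l0)" "wc = (1 - l) * l0" "p = (1 - l) * (1 - l0)"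
  have "0 \<le> wa" "0 \<le> wb" "0 < wc" "wa < wc" "wb < p" "wc < p"
    using l l0 mult_nonneg_nonneg[of l l0] mult_strict_right_mono[of l "1 - l" l0]
      mult_strict_right_mono[of l "1 - l" "1 - l0"] mult_strict_left_mono[of l0 "1 - l0" "1 - l"]
    by (auto simp: w_defs)
  hence w: "0 \<le> wa" "0 \<le> wb" "0 < wc" "wa < wc" "wa < p" "wb < p" "wc < p" by auto
  have iso': "(if e + h0 - h = u \<or> e + h0 - h = - u then wa * (e + h0 - h) else 0)
     + (if e - h = u \<or> e - h = - u then wb * (e - h) else 0)
     + (if e + h0 = u \<or> e + h0 = - u then wc * (e + h0) else 0)
     + (if e = u \<or> e = - u then p * e else 0) = 0" for u
    using iso[of "u\<^sup>2"] unfolding diffs w_defs[symmetric] power2_eq_iff .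
  \<comment> \<open>At modulus \<open>\<bar>e\<bar>\<close> the term \<open>p * e\<close> must be
    cancelled by shifts equal to \<open>- e\<close>. As \<open>h\<close> and \<open>h0\<close> are
    nonzero, \<open>wb\<close> can contribute there only if \<open>h = 2 * e\<close>, and
    \<open>wc\<close> only if \<open>h0 = - 2 * e\<close>; \<open>wa\<close> alone is too
    small.\<close>
  have e0: "e = 0"
  proof (rule ccontr)
    assume e: "e \<noteq> 0"
    have nz: "e * q \<noteq> 0" if "q > 0" for q using e that by simp
    define u where "u = (if e + h0 - h = e \<or> e + h0 - h = - e then wa * (e + h0 - h) else 0)"
    have u: "u = 0 \<or> u = e * wa \<or> u = - (e * wa) \<and> e + h0 - h = - e"
    proof -
      have "(if a = e \<or> a = - e then wa * a else 0) = 0 \<or> (if a = e \<or> a = - e then wa * a else 0) = e * wa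
        \<or> (if a = e \<or> a = - e then wa * a else 0) = - (e * wa) \<and> a = - e" for a by auto
      thus ?thesis unfolding u_def .
    qed
    note iso_e = iso'[of e, folded u_def]
    consider "h = 2 * e" "h0 = - 2 * e" | "h = 2 * e" "h0 \<noteq> - 2 * e" | "h \<noteq> 2 * e" "h0 = - 2 * e" | "h \<noteq> 2 * e" "h0 \<noteq> - 2 * e"
      by blast
    thus False
    proof cases
      case 1
      \<comment> \<open>Here the shift of weight \<open>wa\<close> is \<open>- 3 * e\<close>, alone
        in its modulus, so \<open>wa\<close> vanishes. Then \<open>l = 0\<close> removes
        \<open>wb\<close> as well, and \<open>p\<close> would have to equal
        \<open>wc\<close>.\<close>
      have "wa * (- 3 * e) = 0" using iso'[of "3 * e"] e 1 by (auto split: if_splits)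
      hence "wa = 0" using e by simp
      hence "l = 0" using l0 by (simp add: w_defs)
      hence "wb = 0" by (simp add: w_defs)
      have "p * e = wc * e" using iso'[of e] e 1 \<open>wa = 0\<close> \<open>wb = 0\<close> by (auto split: if_splits)
      with e w show False by simp
    next
      case 2
      have "e * (p - wb) = 0 \<or> e * (p - wb + wa) = 0"
        using u iso_e e 2 hh by (auto simp: algebra_simps)
      thus False using nz[of "p - wb"] nz[of "p - wb + wa"] w by auto
    next
      case 3
      have "e * (p - wc) = 0 \<or> e * (p - wc + wa) = 0"
        using u iso_e e 3 hh by (auto simp: algebra_simps)
      thus False using nz[of "p - wc"] nz[of "p - wc + wa"] w by auto
    next
      case 4
      have ne: "e - h \<noteq> e" "e - h \<noteq> - e" "e + h0 \<noteq> e" "e + h0 \<noteq> - e" using 4 hh by auto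
      have "e * p = 0 \<or> e * (p - wa) = 0 \<or> e * (p + wa) = 0"
        using u iso_e ne by (auto simp: algebra_simps)
      thus False using nz[of "p - wa"] nz[of "p + wa"] nz[of p] w by auto
    qed
  qed
  show "m2 = n2" using e0 by (simp add: e_def)
  \<comment> \<open>If the gaps differ, the term \<open>wc * h0\<close> cannot be cancelled:
    \<open>wb\<close> contributes only for \<open>h = - h0\<close>, with the same sign, and
    \<open>wa\<close> only for \<open>h = 2 * h0\<close>, where it is too small.\<close>
  have h: "h = h0"
  proof (rule ccontr)
    assume ne: "h \<noteq> h0"
    have nz: "h0 * q \<noteq> 0" if "q > 0" for q using hh that by simp
    have "h0 * (wc + wb) = 0 \<or> h0 * (wc - wa) = 0 \<or> h0 * wc = 0"
    proof (cases "h = - h0")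
      case True
      thus ?thesis using iso'[of h0] e0 hh ne by (auto split: if_splits simp: algebra_simps)
    next
      case False
      hence "- h \<noteq> h0" "- h \<noteq> - h0" "h0 - h \<noteq> h0" using ne hh by auto
      thus ?thesis using iso'[of h0] e0 hh by (auto split: if_splits simp: algebra_simps)
    qed
    thus False using nz[of "wc + wb"] nz[of "wc - wa"] nz[of wc] w by auto
  qed
  show "m1 = n1" using h e0 by (simp add: h_def h0_def e_def)
  \<comment> \<open>With equal gaps the shifts of \<open>wb\<close> and \<open>wc\<close> are
    opposite, so modulus \<open>\<bar>h0\<bar>\<close> balances these two weights, and their
    equality is \<open>l = l0\<close>.\<close>
  have "wc * h0 = wb * h0" using iso'[of h0] e0 h hh by (auto split: if_splits)
  hence "wc = wb" using hh by simp
  thus "l = l0" by (simp add: w_defs algebra_simps)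
qed

text \<open>The Taylor coefficients of both sides at orders 1, 3 and 5 are compared.\<close>

lemma sin_cos_relation_trivial:
  fixes l A B h :: real
  assumes h: "h \<noteq> 0" and \<epsilon>: "0 < \<epsilon>"
    and z: "\<And>t. \<bar>t\<bar> < \<epsilon> \<Longrightarrow> l * sin (t * h) = A * t + B * t * cos (t * h)"
  shows "l = 0" "A = 0" "B = 0"
proof -
  \<comment> \<open>Differentiating twice reproduces a relation of the same shape with new
    coefficients and no linear term, so the step can be iterated. Its first conjunct is the
    first-order coefficient; the second and third rounds give \<open>l1 * h = B1\<close> and
    \<open>l1 * h = 3 * B1\<close>.\<close>
  have step: "l * h = A + B \<and> (\<forall>t. \<bar>t\<bar> < \<epsilon> \<longrightarrow> (- l * h\<^sup>2 + 2 * B * h) * sin (t * h) = 0 * t + (- B * h\<^sup>2) * t * cos (t * h))"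
    if z: "\<And>t. \<bar>t\<bar> < \<epsilon> \<Longrightarrow> l * sin (t * h) = A * t + B * t * cos (t * h)" for l A B
  proof -
    have open': "open {-\<epsilon><..<\<epsilon>}" by simp
    have 1: "l * h * cos (t * h) - A - B * cos (t * h) + B * t * h * sin (t * h) = 0" if t: "\<bar>t\<bar> < \<epsilon>" for t
    proof -
      have "((\<lambda>t. l * sin (t * h) - A * t - B * t * cos (t * h)) has_real_derivative
         (l * h * cos (t * h) - A - B * cos (t * h) + B * t * h * sin (t * h))) (at t)"
        by (auto intro!: derivative_eq_intros simp: algebra_simps)
      moreover have "((\<lambda>t. l * sin (t * h) - A * t - B * t * cos (t * h)) has_real_derivative 0) (at t)"
        by (rule has_field_derivative_transform_within_open[OF DERIV_const[of 0] open'])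
           (use z t in auto)
      ultimately show ?thesis by (rule DERIV_unique)
    qed
    have 2: "(- l * h\<^sup>2 + 2 * B * h) * sin (t * h) = 0 * t + (- B * h\<^sup>2) * t * cos (t * h)" if t: "\<bar>t\<bar> < \<epsilon>" for t
    proof -
      have "((\<lambda>t. l * h * cos (t * h) - A - B * cos (t * h) + B * t * h * sin (t * h)) has_real_derivative
         (- l * h\<^sup>2 * sin (t * h) + 2 * B * h * sin (t * h) + B * h\<^sup>2 * t * cos (t * h))) (at t)"
        by (auto intro!: derivative_eq_intros simp: algebra_simps power2_eq_square)
      moreover have "((\<lambda>t. l * h * cos (t * h) - A - B * cos (t * h) + B * t * h * sin (t * h)) has_real_derivative 0) (at t)"
        by (rule has_field_derivative_transform_within_open[OF DERIV_const[of 0] open'])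
           (use 1 t in auto)
      ultimately have "- l * h\<^sup>2 * sin (t * h) + 2 * B * h * sin (t * h) + B * h\<^sup>2 * t * cos (t * h) = 0" by (rule DERIV_unique)
      thus ?thesis by (simp add: algebra_simps)
    qed
    show ?thesis using 1[of 0] 2 \<epsilon> by auto
  qed
  have s1: "l * h = A + B" using step[OF z] by blast
  define l1 B1 where "l1 = - l * h\<^sup>2 + 2 * B * h" and "B1 = - B * h\<^sup>2"
  have z1: "\<And>t. \<bar>t\<bar> < \<epsilon> \<Longrightarrow> l1 * sin (t * h) = 0 * t + B1 * t * cos (t * h)"
    using step[OF z] unfolding l1_def B1_def by blast
  have s2: "l1 * h = 0 + B1" using step[OF z1] by blast
  have "(- l1 * h\<^sup>2 + 2 * B1 * h) * h = 0 + (- B1 * h\<^sup>2)"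
    using step[OF conjunct2[OF step[OF z1], rule_format]] by blast
  hence "(l1 * h - 3 * B1) * h\<^sup>2 = 0" by algebra
  hence "l1 * h = 3 * B1" using h by simp
  with h s2 have "B1 = 0" by simp
  thus "B = 0" using h by (simp add: B1_def)
  with s2 h \<open>B1 = 0\<close> show "l = 0" by (simp add: l1_def)
  with s1 \<open>B = 0\<close> show "A = 0" by simp
qed

section \<open>Cosine transforms\<close>

text \<open>The interval is half-open because it is the section in \<open>x\<close>, at fixed
  \<open>y\<close>, of the condition \<open>x - a < y \<le> x + a\<close> under which a c.d.f.
  difference counts \<open>y\<close>.\<close>

lemma lborel_integral_cos_interval:
  fixes t a y :: real
  assumes "t \<noteq> 0" "0 \<le> a"
  shows "(\<integral>x. cos (t * x) * indicator {y - a..<y + a} x \<partial>lborel) = 2 * sin (t * a) / t * cos (t * y)"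
proof -
  have "(\<integral>x. cos (t * x) * indicator {y - a..<y + a} x \<partial>lborel) = (\<integral>x. cos (t * x) * indicator {y - a..y + a} x \<partial>lborel)"
  proof (rule integral_cong_AE)
    show "AE x in lborel. cos (t * x) * indicator {y - a..<y + a} x = cos (t * x) * indicator {y - a..y + a} x"
      using AE_lborel_singleton[of "y + a"] by eventually_elim (auto split: split_indicator)
  qed auto
  also have "\<dots> = sin (t * (y + a)) / t - sin (t * (y - a)) / t"
    using assms by (intro integral_FTC_Icc_real) (auto intro!: derivative_eq_intros simp: DERIV_isCont)
  also have "\<dots> = 2 * sin (t * a) / t * cos (t * y)"
    using assms by (simp add: sin_add sin_diff distrib_left right_diff_distrib field_simps)
  finally show ?thesis .
qed

text \<open>A c.d.f. is not integrable, but its symmetric difference is the mass of a bounded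
  interval. Interchanging the integrals factors its transform into an interval part, which carries
  \<open>a\<close>, and the transform of \<open>P\<close>, which is common to all
  \<open>a\<close>.\<close>

lemma lborel_cos_cdf_diff:
  fixes t a :: real
  assumes "real_distribution P" and t: "t \<noteq> 0"
  shows "integrable lborel (\<lambda>x. cos (t * x) * (cdf P (x + a) - cdf P (x - a)))"
    and "(\<integral>x. cos (t * x) * (cdf P (x + a) - cdf P (x - a)) \<partial>lborel)
       = 2 * sin (t * a) / t * (\<integral>y. cos (t * y) \<partial>P)"
proof -
  interpret P: real_distribution P by fact
  interpret PL: pair_sigma_finite P lborel ..
  note [measurable_cong] = P.events_eq_borel
  have *: "integrable lborel (\<lambda>x. cos (t * x) * (cdf P (x + a) - cdf P (x - a))) \<and>
    (\<integral>x. cos (t * x) * (cdf P (x + a) - cdf P (x - a)) \<partial>lborel)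
       = 2 * sin (t * a) / t * (\<integral>y. cos (t * y) \<partial>P)" if a: "0 \<le> a" for a
  proof -
    define g where "g = (\<lambda>y x. cos (t * x) * indicator {y - a..<y + a} x :: real)"
    have gm: "case_prod g \<in> borel_measurable (P \<Otimes>\<^sub>M lborel)"
    proof -
      have "case_prod g = (\<lambda>z. cos (t * snd z) * (if fst z - a \<le> snd z \<and> snd z < fst z + a then 1 else 0))"
        by (auto simp: g_def fun_eq_iff)
      also have "\<dots> \<in> borel_measurable (P \<Otimes>\<^sub>M lborel)" by measurable
      finally show ?thesis .
    qed
    have gi: "integrable lborel (g y)" for y
      unfolding g_def
      by (rule Bochner_Integration.integrable_bound[of _ "indicator {y - a..<y + a} :: real \<Rightarrow> real"])
         (use a in \<open>auto simp: abs_mult split: split_indicator intro!: integrable_real_indicator\<close>)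
    have gint: "integrable (P \<Otimes>\<^sub>M lborel) (case_prod g)"
    proof (rule PL.Fubini_integrable)
      show "integrable P (\<lambda>y. \<integral>x. norm (case_prod g (y, x)) \<partial>lborel)"
      proof (rule P.integrable_const_bound[of _ "2 * a"])
        show "(\<lambda>y. \<integral>x. norm (case_prod g (y, x)) \<partial>lborel) \<in> borel_measurable P"
          using gm by measurable
        have "norm (\<integral>x. norm (g y x) \<partial>lborel) \<le> 2 * a" for y
        proof -
          have "(\<integral>x. norm (g y x) \<partial>lborel) \<le> (\<integral>x. indicator {y - a..<y + a} x \<partial>lborel)"
            using a by (intro integral_mono integrable_norm gi integrable_real_indicator)
              (auto simp: g_def abs_mult split: split_indicator)
          also have "\<dots> = 2 * a" using a by simp
          finally show ?thesis by simp
        qed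
        thus "AE y in P. norm (\<integral>x. norm (case_prod g (y, x)) \<partial>lborel) \<le> 2 * a" by auto
      qed
    qed (use gm gi in auto)
    have inner: "(\<integral>y. g y x \<partial>P) = cos (t * x) * (cdf P (x + a) - cdf P (x - a))" for x
    proof -
      have "(\<integral>y. g y x \<partial>P) = (\<integral>y. cos (t * x) * indicator {x - a<..x + a} y \<partial>P)"
        by (intro Bochner_Integration.integral_cong) (auto simp: g_def split: split_indicator)
      also have "\<dots> = cos (t * x) * measure P {x - a<..x + a}" by simp
      also have "measure P {x - a<..x + a} = cdf P (x + a) - cdf P (x - a)"
        using P.cdf_diff_eq[of "x - a" "x + a"] a by (cases "a = 0") auto
      finally show ?thesis .
    qed
    have "integrable lborel (\<lambda>x. \<integral>y. g y x \<partial>P)"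
      using PL.integrable_snd[OF gint] by simp
    moreover have "(\<integral>x. (\<integral>y. g y x \<partial>P) \<partial>lborel) = (\<integral>y. (\<integral>x. g y x \<partial>lborel) \<partial>P)"
      by (rule PL.Fubini_integral[OF gint])
    ultimately show ?thesis
      unfolding inner by (simp add: g_def lborel_integral_cos_interval[OF t a])
  qed
  have "integrable lborel (\<lambda>x. cos (t * x) * (cdf P (x + a) - cdf P (x - a))) \<and>
    (\<integral>x. cos (t * x) * (cdf P (x + a) - cdf P (x - a)) \<partial>lborel)
       = 2 * sin (t * a) / t * (\<integral>y. cos (t * y) \<partial>P)"
  proof (cases "0 \<le> a")
    case False
    have eq: "(\<lambda>x. cos (t * x) * (cdf P (x + a) - cdf P (x - a))) =
       (\<lambda>x. - (cos (t * x) * (cdf P (x + - a) - cdf P (x - - a))))"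
      by (simp add: algebra_simps)
    show ?thesis unfolding eq using *[of "- a"] False by simp
  qed (use * in blast)
  thus "integrable lborel (\<lambda>x. cos (t * x) * (cdf P (x + a) - cdf P (x - a)))"
    "(\<integral>x. cos (t * x) * (cdf P (x + a) - cdf P (x - a)) \<partial>lborel)
       = 2 * sin (t * a) / t * (\<integral>y. cos (t * y) \<partial>P)" by auto
qed

lemma isCont_eventually_pos:
  fixes f :: "real \<Rightarrow> real"
  assumes "isCont f x" "0 < f x"
  shows "\<forall>\<^sub>F y in nhds x. 0 < f y"
proof -
  have "(f \<longlongrightarrow> f x) (nhds x)"
    using assms(1) unfolding isCont_def tendsto_at_iff_tendsto_nhds .
  thus ?thesis by (rule order_tendstoD(1)) fact
qed

text \<open>By dominated convergence the transform is continuous at 0, where it equals 1.\<close>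

lemma cos_transform_nonzero:
  assumes "real_distribution P"
  obtains \<epsilon> where "0 < \<epsilon>" "\<And>t. \<bar>t\<bar> < \<epsilon> \<Longrightarrow> (\<integral>y. cos (t * y) \<partial>P) \<noteq> (0::real)"
proof -
  interpret P: real_distribution P by fact
  define \<phi> where "\<phi> = (\<lambda>t. \<integral>y. cos (t * y) \<partial>P)"
  have "isCont \<phi> 0"
  proof (rule continuous_at_sequentiallyI)
    fix u :: "nat \<Rightarrow> real" assume u: "u \<longlonglongrightarrow> 0"
    have lim: "(\<lambda>n. cos (u n * y)) \<longlonglongrightarrow> cos (0 * y)" for y
      by (intro tendsto_intros u)
    show "(\<lambda>n. \<phi> (u n)) \<longlonglongrightarrow> \<phi> 0"
      unfolding \<phi>_def
      by (rule integral_dominated_convergence[where w = "\<lambda>_. 1"])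
         (use lim in auto)
  qed
  moreover have "\<phi> 0 = 1" using P.prob_space by (simp add: \<phi>_def)
  ultimately have "\<forall>\<^sub>F t in nhds 0. \<phi> t > 0"
    by (intro isCont_eventually_pos) auto
  then obtain \<epsilon> where "\<epsilon> > 0" "\<And>t. dist t 0 < \<epsilon> \<Longrightarrow> \<phi> t > 0"
    unfolding eventually_nhds_metric by blast
  thus ?thesis using that[of \<epsilon>] by (force simp: \<phi>_def)
qed

lemma real_distribution_eq_density:
  assumes "real_distribution P"
    and f: "\<And>x. (cdf P has_real_derivative f x) (at x)" "f \<in> borel_measurable borel"
  shows "P = density lborel f" and "\<And>x. 0 \<le> f x"
proof -
  interpret P: real_distribution P by fact
  have f0: "0 \<le> f x" for x
    using mono_on_imp_deriv_nonneg[of UNIV "cdf P" "f x" x] f(1) P.cdf_nondecreasing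
    by (auto simp: mono_on_def)
  thus "\<And>x. 0 \<le> f x" .
  have tail: "emeasure P {x<..} = ennreal (1 - cdf P x)" for x
  proof -
    have "measure P {x<..} = measure P (space P - {..x})"
      by (rule arg_cong[where f = "measure P"]) auto
    also have "\<dots> = 1 - cdf P x" unfolding cdf_def by (subst P.prob_compl) auto
    finally show ?thesis by (simp add: P.emeasure_eq_measure)
  qed
  show "P = density lborel f"
  proof (rule measure_eqI_lessThan)
    fix x
    show "emeasure P {x<..} < \<infinity>" by (simp add: P.emeasure_eq_measure)
    have "emeasure (density lborel f) {x<..} = (\<integral>\<^sup>+y. ennreal (f y) * indicator {x<..} y \<partial>lborel)"
      using f(2) by (subst emeasure_density) auto
    also have "\<dots> = (\<integral>\<^sup>+y. ennreal (f y) * indicator {x..} y \<partial>lborel)"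
      using AE_lborel_singleton[of x] by (intro nn_integral_cong_AE) (auto split: split_indicator)
    also have "\<dots> = ennreal (1 - cdf P x)"
      by (rule nn_integral_FTC_atLeast[OF f(2,1) f0 P.cdf_lim_at_top_prob])
    finally show "emeasure P {x<..} = emeasure (density lborel f) {x<..}" using tail by simp
  qed auto
qed

text \<open>The density counterpart of \<open>lborel_cos_cdf_diff\<close>, needed because
  differentiating the c.d.f. difference in its shift produces \<open>f (x + h) + f (x - h)\<close>.
  Translation moves \<open>h\<close> into the cosine, and in the sum over both signs the sine terms
  cancel.\<close>

lemma lborel_cos_shifted_density:
  assumes "real_distribution P"
    and f: "\<And>x. (cdf P has_real_derivative f x) (at x)" "f \<in> borel_measurable borel"
  shows "integrable lborel (\<lambda>x. cos (t * x) * (f (x + h) + f (x - h)))"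
    and "(\<integral>x. cos (t * x) * (f (x + h) + f (x - h)) \<partial>lborel) = 2 * cos (t * h) * (\<integral>y. cos (t * y) \<partial>P)"
proof -
  interpret P: real_distribution P by fact
  note f0 = real_distribution_eq_density(2)[OF assms]
  note [measurable] = f(2)
  have int: "integrable P g \<longleftrightarrow> integrable lborel (\<lambda>x. f x * g x)"
    "integral\<^sup>L P g = (\<integral>x. f x * g x \<partial>lborel)" if "g \<in> borel_measurable borel" for g :: "real \<Rightarrow> real"
    using integrable_density[of g lborel f] integral_density[of g lborel f] that f0 f(2)
    by (auto simp: real_distribution_eq_density(1)[OF assms, symmetric])
  have sh: "integrable lborel (\<lambda>x. cos (t * x) * f (x + k)) \<and>
    (\<integral>x. cos (t * x) * f (x + k) \<partial>lborel) = (\<integral>y. cos (t * (y - k)) \<partial>P)" for k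
  proof -
    have "integrable P (\<lambda>y. cos (t * (y - k)))"
      by (rule P.integrable_const_bound[of _ 1]) auto
    hence i: "integrable lborel (\<lambda>y. f y * cos (t * (y - k)))"
      by (subst (asm) int) auto
    have "integrable lborel (\<lambda>x. f (k + 1 * x) * cos (t * ((k + 1 * x) - k)))"
      using lborel_integrable_real_affine[OF i, of 1 k] by simp
    hence 1: "integrable lborel (\<lambda>x. cos (t * x) * f (x + k))" by (simp add: add_ac mult_ac)
    have "(\<integral>y. cos (t * (y - k)) \<partial>P) = (\<integral>y. f y * cos (t * (y - k)) \<partial>lborel)" by (rule int) auto
    also have "\<dots> = (\<integral>x. f (k + 1 * x) * cos (t * ((k + 1 * x) - k)) \<partial>lborel)"
      by (subst lborel_integral_real_affine[where c = 1 and t = k]) auto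
    finally show ?thesis using 1 by (simp add: add_ac mult_ac)
  qed
  have eq: "(\<lambda>x. cos (t * x) * (f (x + h) + f (x - h))) = (\<lambda>x. cos (t * x) * f (x + h) + cos (t * x) * f (x + - h))"
    by (simp add: distrib_left)
  show "integrable lborel (\<lambda>x. cos (t * x) * (f (x + h) + f (x - h)))"
    unfolding eq using sh[of h] sh[of "- h"] by (intro Bochner_Integration.integrable_add) blast+
  have ic: "integrable P (\<lambda>y. cos (t * (y - k)))" for k
    by (rule P.integrable_const_bound[of _ 1]) auto
  have "(\<integral>x. cos (t * x) * (f (x + h) + f (x - h)) \<partial>lborel)
     = (\<integral>y. cos (t * (y - h)) \<partial>P) + (\<integral>y. cos (t * (y - - h)) \<partial>P)"
    unfolding eq using sh[of h] sh[of "- h"] by (subst Bochner_Integration.integral_add) auto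
  also have "\<dots> = (\<integral>y. 2 * cos (t * h) * cos (t * y) \<partial>P)"
    by (subst Bochner_Integration.integral_add[symmetric, OF ic ic])
       (auto intro!: Bochner_Integration.integral_cong simp: right_diff_distrib distrib_left cos_add cos_diff)
  finally show "(\<integral>x. cos (t * x) * (f (x + h) + f (x - h)) \<partial>lborel) = 2 * cos (t * h) * (\<integral>y. cos (t * y) \<partial>P)"
    by simp
qed

text \<open>The base point moves with \<open>n\<close>, so differentiability at the limit point
  would not suffice. The mean value theorem replaces the quotient by \<open>f\<close> at an
  intermediate point, and continuity of \<open>f\<close> finishes.\<close>

lemma tendsto_difference_quotient:
  fixes F f :: "real \<Rightarrow> real" and y s \<delta> :: "nat \<Rightarrow> real"
  assumes F: "\<And>x. (F has_real_derivative f x) (at x)" and f: "isCont f y'"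
    and y: "y \<longlonglongrightarrow> y'" and s: "s \<longlonglongrightarrow> 0" and v: "(\<lambda>n. s n / \<delta> n) \<longlonglongrightarrow> v"
  shows "(\<lambda>n. (F (y n + s n) - F (y n)) / \<delta> n) \<longlonglongrightarrow> f y' * v"
proof -
  have "\<exists>\<xi>. \<bar>\<xi> - y n\<bar> \<le> \<bar>s n\<bar> \<and> F (y n + s n) - F (y n) = s n * f \<xi>" for n
  proof (cases "s n" "0 :: real" rule: linorder_cases)
    case less
    from MVT2[of "y n + s n" "y n" F f] F less
    obtain z where "y n + s n < z" "z < y n" "F (y n) - F (y n + s n) = (y n - (y n + s n)) * f z" by auto
    thus ?thesis by (intro exI[of _ z]) auto
  next
    case greater
    from MVT2[of "y n" "y n + s n" F f] F greater
    obtain z where "y n < z" "z < y n + s n" "F (y n + s n) - F (y n) = (y n + s n - y n) * f z" by auto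
    thus ?thesis by (intro exI[of _ z]) auto
  qed (auto intro: exI[of _ "y n"])
  then obtain \<xi> where \<xi>: "\<And>n. \<bar>\<xi> n - y n\<bar> \<le> \<bar>s n\<bar>" "\<And>n. F (y n + s n) - F (y n) = s n * f (\<xi> n)" by metis
  have "(\<lambda>n. \<xi> n - y n) \<longlonglongrightarrow> 0"
    by (rule Lim_null_comparison[OF _ tendsto_rabs_zero[OF s]]) (use \<xi>(1) in auto)
  from tendsto_add[OF this y] have "\<xi> \<longlonglongrightarrow> y'" by simp
  hence "(\<lambda>n. f (\<xi> n) * (s n / \<delta> n)) \<longlonglongrightarrow> f y' * v"
    by (intro tendsto_mult isCont_tendsto_compose[OF f] v)
  thus ?thesis by (simp add: \<xi>(2) mult.commute)
qed

section \<open>Identifiability\<close>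

text \<open>A strictly increasing c.d.f. gives positive mass to every nonempty interval
  \<open>{x<..y}\<close>, so a continuous nonnegative function that vanishes almost everywhere
  vanishes everywhere.\<close>

lemma real_distribution_zero_integral:
  fixes f :: "real \<Rightarrow> real"
  assumes "real_distribution P" and sm: "strict_mono (cdf P)"
    and f: "\<And>x. isCont f x" "\<And>x. 0 \<le> f x" "integrable P f" "integral\<^sup>L P f = 0"
  shows "f x = 0"
proof (rule ccontr)
  assume "f x \<noteq> 0"
  interpret P: real_distribution P by fact
  have "f x > 0" using \<open>f x \<noteq> 0\<close> f(2)[of x] by simp
  have z: "AE y in P. f y = 0"
    using f(2-4) by (subst integral_nonneg_eq_0_iff_AE[symmetric]) auto
  have "\<forall>\<^sub>F y in nhds x. f y > 0"
    using f(1)[of x] \<open>f x > 0\<close> by (rule isCont_eventually_pos)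
  then obtain e where e: "e > 0" "\<And>y. dist y x < e \<Longrightarrow> f y > 0"
    unfolding eventually_nhds_metric by blast
  have nz: "f y \<noteq> 0" if "y \<in> {x<..x + e / 2}" for y
    using e(2)[of y] that e(1) by (auto simp: dist_real_def)
  from z have "AE y in P. y \<notin> {x<..x + e / 2}"
    by eventually_elim (use nz in blast)
  hence "emeasure P {x<..x + e / 2} = 0"
    by (subst (asm) AE_iff_measurable[of "{x<..x + e / 2}"]) auto
  hence "cdf P (x + e / 2) - cdf P x = 0"
    using P.cdf_diff_eq[of x "x + e / 2"] e(1) by (simp add: P.emeasure_eq_measure)
  moreover have "cdf P x < cdf P (x + e / 2)" using sm e(1) by (auto simp: strict_mono_def)
  ultimately show False by simp
qed

text \<open>\<open>PG\<close> is the law of one observation. The condition \<open>0 < l0\<close> is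
  what interiority of the true parameter provides: at weight 0 the location \<open>n1\<close> would
  drop out of the law.\<close>

locale symmetric_mixture =
  fixes P0 PG :: "real measure" and l0 n1 n2 d L :: real
  assumes P0: "real_distribution P0" and PG: "real_distribution PG"
    and sym: "\<And>x. cdf P0 (- x) = 1 - cdf P0 x"
    and strict: "strict_mono (cdf P0)"
    and lipschitz: "L-lipschitz_on UNIV (cdf P0)"
    and l0: "0 < l0" "l0 \<le> 1/2 - d" and d: "0 < d"
    and n: "n1 \<noteq> n2"
    and cdf_PG: "\<And>x. cdf PG x = l0 * cdf P0 (x - n1) + (1 - l0) * cdf P0 (x - n2)"
begin

abbreviation "F \<equiv> cdf P0"
abbreviation "G \<equiv> cdf PG"

sublocale P0: real_distribution P0 by (rule P0)
sublocale PG: real_distribution PG by (rule PG)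

lemma F_diff_le: "\<bar>F x - F y\<bar> \<le> L * \<bar>x - y\<bar>"
  using lipschitz_onD[OF lipschitz, of x y] by (simp add: dist_real_def)

lemma isCont_F: "isCont F x"
  using lipschitz_on_continuous_on[OF lipschitz] by (simp add: continuous_on_eq_continuous_at)

lemma strict_G: "strict_mono G"
proof (rule strict_monoI)
  fix x y :: real assume "x < y"
  hence "F (x - n1) < F (y - n1)" "F (x - n2) < F (y - n2)" using strict by (auto simp: strict_mono_def)
  thus "G x < G y" unfolding cdf_PG using l0 d by (intro add_strict_mono mult_strict_left_mono) auto
qed

lemma mono_G: "mono G" using PG.cdf_nondecreasing by (auto simp: mono_def)

lemma isCont_G: "isCont G x"
proof -
  have "isCont (\<lambda>x. l0 * F (x - n1) + (1 - l0) * F (x - n2)) x"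
    by (intro continuous_intros isCont_o2[OF _ isCont_F])
  moreover have "G = (\<lambda>x. l0 * F (x - n1) + (1 - l0) * F (x - n2))" using cdf_PG by auto
  ultimately show ?thesis by simp
qed

lemma G_diff_le: "\<bar>G x - G y\<bar> \<le> L * \<bar>x - y\<bar>"
proof -
  have "G x - G y = l0 * (F (x - n1) - F (y - n1)) + (1 - l0) * (F (x - n2) - F (y - n2))"
    by (simp add: cdf_PG algebra_simps)
  also have "\<bar>\<dots>\<bar> \<le> l0 * \<bar>F (x - n1) - F (y - n1)\<bar> + (1 - l0) * \<bar>F (x - n2) - F (y - n2)\<bar>"
    using l0 d by (intro order_trans[OF abs_triangle_ineq]) (auto simp: abs_mult)
  also have "\<dots> \<le> L * \<bar>x - y\<bar>"
    using l0 d F_diff_le[of "x - n1" "y - n1"] F_diff_le[of "x - n2" "y - n2"]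
    by (intro convex_bound_le) auto
  finally show ?thesis .
qed

lemma G_01: "0 \<le> G x" "G x \<le> 1"
  using PG.cdf_nonneg PG.cdf_bounded_prob by auto

section \<open>The limit contrast and its finite reduction\<close>

definition K :: "real \<Rightarrow> real \<Rightarrow> real \<Rightarrow> real" where
  "K l m1 m2 = (\<integral>x. (residual (l, m1, m2) G x)\<^sup>2 \<partial>PG)"

definition E :: "real \<Rightarrow> real \<Rightarrow> real" where
  "E a x = F (x - a) - F (x + a)"

definition H :: "real \<Rightarrow> real \<Rightarrow> real \<Rightarrow> real \<Rightarrow> real" where
  "H l m1 m2 x = l * l0 * E (m1 - n1) x + l * (1 - l0) * E (m1 - n2) x
     + (1 - l) * l0 * E (m2 - n1) x + (1 - l) * (1 - l0) * E (m2 - n2) x"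

text \<open>Symmetry turns the reflected c.d.f. into a mixture of unreflected translates of
  \<open>F\<close> at opposite locations, so that the reduced residual involves only differences of
  \<open>F\<close>.\<close>

lemma G_reflected: "1 - G (m - x) = l0 * F (x - m + n1) + (1 - l0) * F (x - m + n2)"
proof -
  have F: "F (m - x - k) = 1 - F (x - m + k)" for k
    using sym[of "x - m + k"] by (simp add: algebra_simps)
  show ?thesis unfolding cdf_PG F by (simp add: algebra_simps)
qed

text \<open>Reflection conjugates the mixing operator into the one with opposite locations. The
  latter therefore undoes the inverse hidden behind the reflection, and it commutes with the outer
  mixing operator. Concretely, regrouping by the location outside the reflection pairs the values of
  \<open>N\<close> so that \<open>inv\<close> recombines them into \<open>G\<close>.\<close>

lemma mix_op_residual:
  assumes "0 \<le> l" "l < 1/2"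
  shows "mix_op (l, - m1, - m2) (residual (l, m1, m2) G) x = H l m1 m2 x"
proof -
  define N where "N = mix_op_inv (l, m1, m2) G"
  have inv: "l * N (y - m1) + (1 - l) * N (y - m2) = G y" for y
    using mix_op_mix_op_inv[OF assms, of G 1 m1 m2 y] G_01 by (simp add: mix_op_eq N_def)
  have "mix_op (l, - m1, - m2) (residual (l, m1, m2) G) x
     = l * (1 - l * N (- x) - (1 - l) * N (m2 - m1 - x) - G (x + m1))
       + (1 - l) * (1 - l * N (m1 - m2 - x) - (1 - l) * N (- x) - G (x + m2))"
    by (simp add: mix_op_eq residual_eq N_def[symmetric] algebra_simps)
  also have "\<dots> = l * (1 - (l * N (m1 - x - m1) + (1 - l) * N (m1 - x - m2)) - G (x + m1))
     + (1 - l) * (1 - (l * N (m2 - x - m1) + (1 - l) * N (m2 - x - m2)) - G (x + m2))"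
    by (simp add: algebra_simps)
  also have "\<dots> = l * ((1 - G (m1 - x)) - G (x + m1)) + (1 - l) * ((1 - G (m2 - x)) - G (x + m2))"
    unfolding inv ..
  also have "\<dots> = H l m1 m2 x"
    unfolding G_reflected unfolding H_def E_def cdf_PG by (simp add: algebra_simps)
  finally show ?thesis .
qed

lemma residual_tendsto:
  assumes "l \<longlonglongrightarrow> l'" "m1 \<longlonglongrightarrow> m1'" "m2 \<longlonglongrightarrow> m2'" "x \<longlonglongrightarrow> x'"
    and l: "\<And>k. 0 \<le> l k" "\<And>k. l k \<le> 1/2 - d"
  shows "(\<lambda>k. residual (l k, m1 k, m2 k) G (x k)) \<longlonglongrightarrow> residual (l', m1', m2') G x'"
proof -
  have N: "(\<lambda>k. mix_op_inv (l k, m1 k, m2 k) G (y k)) \<longlonglongrightarrow> mix_op_inv (l', m1', m2') G y'"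
    if "y \<longlonglongrightarrow> y'" for y y'
    by (rule mix_op_inv_tendsto[OF assms(1-3) that d l, of "\<lambda>_. G" 1])
       (use G_01 isCont_tendsto_compose[OF isCont_G] in auto)
  show ?thesis unfolding residual_eq
    by (intro tendsto_intros N assms isCont_tendsto_compose[OF isCont_G])
qed

lemma isCont_residual:
  assumes "0 \<le> l" "l \<le> 1/2 - d"
  shows "isCont (residual (l, m1, m2) G) x"
  by (rule continuous_at_sequentiallyI, rule residual_tendsto[OF tendsto_const tendsto_const tendsto_const _ assms])

lemma residual_G_bound:
  assumes "0 \<le> l" "l \<le> 1/2 - d"
  shows "\<bar>residual (l, m1, m2) G x\<bar> \<le> 1 + 1 / (2 * d)"
  by (rule residual_bound[OF assms d mono_G G_01])

lemma residual_sq_bound: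
  assumes "0 \<le> l" "l \<le> 1/2 - d"
  shows "(residual (l, m1, m2) G x)\<^sup>2 \<le> (1 + 1 / (2 * d))\<^sup>2"
  using residual_G_bound[OF assms] d by (simp add: power2_le_iff_abs_le)

lemma residual_G_measurable:
  assumes "0 \<le> l" "l \<le> 1/2 - d"
  shows "residual (l, m1, m2) G \<in> borel_measurable borel"
  by (rule residual_measurable[OF assms d mono_G G_01])

lemma integrable_residual_sq:
  assumes "0 \<le> l" "l \<le> 1/2 - d"
  shows "integrable PG (\<lambda>x. (residual (l, m1, m2) G x)\<^sup>2)"
  using residual_sq_bound[OF assms] residual_G_measurable[OF assms]
  by (intro PG.integrable_const_bound[of _ "(1 + 1 / (2 * d))\<^sup>2"]) auto

lemma H_zero_imp_params:
  assumes l: "0 \<le> l" "l < 1/2" and m: "m1 \<noteq> m2" and z: "\<And>x. H l m1 m2 x = 0"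
  shows "l = l0" "m1 = n1" "m2 = n2"
proof -
  obtain e where e: "0 < e" "\<And>t. \<bar>t\<bar> < e \<Longrightarrow> (\<integral>y. cos (t * y) \<partial>P0) \<noteq> (0::real)"
    using cos_transform_nonzero[OF P0] by blast
  have z: "l * l0 * sin (t * (m1 - n1)) + l * (1 - l0) * sin (t * (m1 - n2))
        + (1 - l) * l0 * sin (t * (m2 - n1)) + (1 - l) * (1 - l0) * sin (t * (m2 - n2)) = 0" if t: "\<bar>t\<bar> < e" for t
  proof (cases "t = 0")
    case False
    define \<phi> where "\<phi> = (\<integral>y. cos (t * y) \<partial>P0)"
    note C = lborel_cos_cdf_diff[OF P0 False, folded \<phi>_def]
    define D where "D = (\<lambda>a x. cos (t * x) * (F (x + a) - F (x - a)))"
    have D: "integrable lborel (D a)" "integral\<^sup>L lborel (D a) = 2 * sin (t * a) / t * \<phi>" for a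
      using C[of a] by (simp_all add: D_def)
    have "0 = (\<integral>x. - (cos (t * x) * H l m1 m2 x) \<partial>lborel)" by (simp add: z)
    also have "\<dots> = (\<integral>x. l * l0 * D (m1 - n1) x + l * (1 - l0) * D (m1 - n2) x
        + (1 - l) * l0 * D (m2 - n1) x + (1 - l) * (1 - l0) * D (m2 - n2) x \<partial>lborel)"
      by (intro Bochner_Integration.integral_cong) (auto simp: H_def E_def D_def algebra_simps)
    also have "\<dots> = l * l0 * (2 * sin (t * (m1 - n1)) / t * \<phi>) + l * (1 - l0) * (2 * sin (t * (m1 - n2)) / t * \<phi>)
        + (1 - l) * l0 * (2 * sin (t * (m2 - n1)) / t * \<phi>) + (1 - l) * (1 - l0) * (2 * sin (t * (m2 - n2)) / t * \<phi>)"
      by (simp add: D del: mult_eq_0_iff)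
    also have "\<dots> = (l * l0 * sin (t * (m1 - n1)) + l * (1 - l0) * sin (t * (m1 - n2))
        + (1 - l) * l0 * sin (t * (m2 - n1)) + (1 - l) * (1 - l0) * sin (t * (m2 - n2))) * (2 / t * \<phi>)"
    proof -
      have "c1 * (2 * s1 / t * \<phi>) + c2 * (2 * s2 / t * \<phi>) + c3 * (2 * s3 / t * \<phi>) + c4 * (2 * s4 / t * \<phi>)
        = (c1 * s1 + c2 * s2 + c3 * s3 + c4 * s4) * (2 / t * \<phi>)" for c1 c2 c3 c4 s1 s2 s3 s4
        using False by (simp add: field_simps)
      thus ?thesis .
    qed
    finally show ?thesis using e(2)[OF t] False by (simp add: \<phi>_def)
  qed auto
  show "l = l0" "m1 = n1" "m2 = n2"
    using mixture_params_unique[OF l l0(1) _ m n e(1) z] l0(2) d by auto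
qed

lemma K_zero_imp_params:
  assumes l: "0 \<le> l" "l \<le> 1/2 - d" and m: "m1 \<noteq> m2" and K: "K l m1 m2 = 0"
  shows "l = l0" "m1 = n1" "m2 = n2"
proof -
  have "(residual (l, m1, m2) G x)\<^sup>2 = 0" for x
    by (rule real_distribution_zero_integral[OF PG strict_G])
       (use K integrable_residual_sq[OF l] isCont_residual[OF l] in \<open>auto simp: K_def intro!: continuous_intros\<close>)
  hence "residual (l, m1, m2) G = (\<lambda>_. 0)" by auto
  hence "H l m1 m2 x = 0" for x
    using mix_op_residual[of l m1 m2 x] l d by (simp add: mix_op_eq)
  thus "l = l0" "m1 = n1" "m2 = n2" using H_zero_imp_params[of l m1 m2] l d m by auto
qed

text \<open>The diagonal shifts are 0; the cross shifts are opposite and carry the equal weight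
  \<open>l0 * (1 - l0)\<close>, so they cancel by oddness of \<open>E\<close> in its shift.\<close>

lemma H_true_params: "H l0 n1 n2 x = 0"
proof -
  have "E 0 x = 0" "E (n2 - n1) x = - E (n1 - n2) x"
    by (simp_all add: E_def algebra_simps)
  thus ?thesis by (simp add: H_def)
qed

lemma K_true_params: "K l0 n1 n2 = 0"
proof -
  have "residual (l0, n1, n2) G x = mix_op_inv (l0, - n1, - n2) (\<lambda>_. 0) x" for x
  proof -
    have "mix_op (l0, - n1, - n2) (residual (l0, n1, n2) G) = (\<lambda>_. 0)"
      using mix_op_residual[of l0 n1 n2] H_true_params l0 d by auto
    thus ?thesis
      using mix_op_inv_mix_op[of l0 "residual (l0, n1, n2) G" _ "- n1" "- n2" x] residual_G_bound[of l0 n1 n2] l0 d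
      by fastforce
  qed
  thus ?thesis by (simp add: K_def mix_op_inv_eq)
qed

lemma K_tendsto:
  assumes "l \<longlonglongrightarrow> l'" "m1 \<longlonglongrightarrow> m1'" "m2 \<longlonglongrightarrow> m2'"
    and l: "\<And>k. 0 \<le> l k" "\<And>k. l k \<le> 1/2 - d"
  shows "(\<lambda>k. K (l k) (m1 k) (m2 k)) \<longlonglongrightarrow> K l' m1' m2'"
proof -
  have l': "0 \<le> l'" "l' \<le> 1/2 - d"
    using LIMSEQ_le_const[OF assms(1)] LIMSEQ_le_const2[OF assms(1)] l by blast+
  show ?thesis unfolding K_def
  proof (rule integral_dominated_convergence[where w = "\<lambda>_. (1 + 1 / (2 * d))\<^sup>2"])
    show "AE x in PG. (\<lambda>k. (residual (l k, m1 k, m2 k) G x)\<^sup>2) \<longlonglongrightarrow> (residual (l', m1', m2') G x)\<^sup>2"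
      by (intro AE_I2 tendsto_intros residual_tendsto assms l)
    show "AE x in PG. norm ((residual (l k, m1 k, m2 k) G x)\<^sup>2) \<le> (1 + 1 / (2 * d))\<^sup>2" for k
      using residual_sq_bound[OF l] by simp
  qed (use residual_G_measurable l l' in auto)
qed

end

section \<open>Quadratic growth at the true parameter\<close>

context symmetric_mixture
begin

lemma E_minus: "E (- a) x = - E a x"
  by (simp add: E_def)

lemma E_diff_le: "\<bar>E a x - E b x\<bar> \<le> 2 * L * \<bar>a - b\<bar>"
  using F_diff_le[of "x - a" "x - b"] F_diff_le[of "x + a" "x + b"]
  unfolding E_def by (simp add: abs_minus_commute)

lemma E_bound: "\<bar>E a x\<bar> \<le> 1"
  using P0.cdf_nonneg[of "x - a"] P0.cdf_bounded_prob[of "x - a"]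
    P0.cdf_nonneg[of "x + a"] P0.cdf_bounded_prob[of "x + a"]
  by (simp add: E_def abs_le_iff)

lemma L_nonneg: "0 \<le> L"
  using lipschitz by (rule lipschitz_on_nonneg)

text \<open>The terms of \<open>H\<close> at the true parameter cancel, so they can be subtracted one by one.\<close>

lemma H_expand:
  "H l m1 m2 x = (l - l0) * (l0 * E (m1 - n1) x + (1 - l0) * E (m1 - n2) x
      - l0 * E (m2 - n1) x - (1 - l0) * E (m2 - n2) x)
    + l0\<^sup>2 * (E (m1 - n1) x - E 0 x) + l0 * (1 - l0) * (E (m1 - n2) x - E (n1 - n2) x)
    + l0 * (1 - l0) * (E (m2 - n1) x - E (n2 - n1) x) + (1 - l0)\<^sup>2 * (E (m2 - n2) x - E 0 x)"
proof -
  have "E 0 x = 0" by (simp add: E_def)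
  moreover have "E (n2 - n1) x = - E (n1 - n2) x" using E_minus[of "n1 - n2"] by simp
  ultimately show ?thesis unfolding H_def by (simp add: algebra_simps power2_eq_square)
qed

text \<open>The constants are crude: four weights and four values of \<open>E\<close>, all of
  modulus at most 1. The bound makes the quotients of \<open>H\<close> by the parameter distance
  uniformly bounded.\<close>

lemma H_bound: "\<bar>H l m1 m2 x\<bar> \<le> 4 * \<bar>l - l0\<bar> + 4 * L * (\<bar>m1 - n1\<bar> + \<bar>m2 - n2\<bar>)"
proof -
  have l01: "0 \<le> l0" "l0 \<le> 1" using l0 d by auto
  have c: "l0\<^sup>2 \<le> 1" "l0 * (1 - l0) \<le> 1" "(1 - l0)\<^sup>2 \<le> 1" "0 \<le> l0 * (1 - l0)"
    using l01 by (auto simp: power_le_one_iff mult_le_one)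
  have u: "\<bar>q * e\<bar> \<le> c" if "0 \<le> q" "q \<le> 1" "\<bar>e\<bar> \<le> c" for q e c :: real
    using mult_mono[of "\<bar>q\<bar>" 1 "\<bar>e\<bar>" c] that by (simp add: abs_mult)
  define B where "B = l0 * E (m1 - n1) x + (1 - l0) * E (m1 - n2) x - l0 * E (m2 - n1) x - (1 - l0) * E (m2 - n2) x"
  have "\<bar>B\<bar> \<le> 4"
    unfolding B_def
    using u[of l0 "E (m1 - n1) x" 1] u[of "1 - l0" "E (m1 - n2) x" 1] u[of l0 "E (m2 - n1) x" 1]
      u[of "1 - l0" "E (m2 - n2) x" 1] E_bound[of _ x] l01 by (auto simp: abs_le_iff)
  hence 1: "\<bar>(l - l0) * B\<bar> \<le> 4 * \<bar>l - l0\<bar>"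
    using mult_left_mono[of "\<bar>B\<bar>" 4 "\<bar>l - l0\<bar>"] by (simp add: abs_mult mult.commute)
  define c1 c2 where "c1 = L * \<bar>m1 - n1\<bar>" and "c2 = L * \<bar>m2 - n2\<bar>"
  have D: "\<bar>E (m1 - n1) x - E 0 x\<bar> \<le> 2 * c1" "\<bar>E (m1 - n2) x - E (n1 - n2) x\<bar> \<le> 2 * c1"
    "\<bar>E (m2 - n1) x - E (n2 - n1) x\<bar> \<le> 2 * c2" "\<bar>E (m2 - n2) x - E 0 x\<bar> \<le> 2 * c2"
    using E_diff_le[of "m1 - n1" x 0] E_diff_le[of "m1 - n2" x "n1 - n2"]
      E_diff_le[of "m2 - n1" x "n2 - n1"] E_diff_le[of "m2 - n2" x 0] by (simp_all add: c1_def c2_def)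
  have "\<bar>H l m1 m2 x\<bar> \<le> 4 * \<bar>l - l0\<bar> + 4 * c1 + 4 * c2"
    unfolding H_expand B_def[symmetric]
    using 1 u[OF zero_le_power2 c(1) D(1)] u[OF c(4,2) D(2)] u[OF c(4,2) D(3)] u[OF zero_le_power2 c(3) D(4)]
    by linarith
  thus ?thesis by (simp add: c1_def c2_def algebra_simps)
qed

end

section \<open>Linearization at the true parameter\<close>

locale smooth_symmetric_mixture = symmetric_mixture +
  fixes f :: "real \<Rightarrow> real"
  assumes F_deriv: "\<And>x. (cdf P0 has_real_derivative f x) (at x)"
    and f_cont: "\<And>x. isCont f x"
begin

text \<open>The derivative of \<open>H\<close> at the true parameter in direction
  \<open>(v, u1, u2)\<close>. Writing \<open>f (x + 0) + f (x - 0)\<close> for twice the density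
  fits \<open>lborel_cos_shifted_density\<close> at shift 0.\<close>

definition dH :: "real \<times> real \<times> real \<Rightarrow> real \<Rightarrow> real" where
  "dH = (\<lambda>(v, u1, u2) x. v * (F (x + (n2 - n1)) - F (x - (n2 - n1)))
     - (l0\<^sup>2 * u1 + (1 - l0)\<^sup>2 * u2) * (f (x + 0) + f (x - 0))
     - l0 * (1 - l0) * (u1 + u2) * (f (x + (n2 - n1)) + f (x - (n2 - n1))))"

lemma f_measurable: "f \<in> borel_measurable borel"
  by (intro borel_measurable_continuous_onI) (use f_cont continuous_at_imp_continuous_on in blast)

lemma E_quotient_tendsto:
  assumes "x \<longlonglongrightarrow> x'" "a \<longlonglongrightarrow> a'" "(\<lambda>k. (a k - a') / \<delta> k) \<longlonglongrightarrow> v"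
  shows "(\<lambda>k. (E (a k) (x k) - E a' (x k)) / \<delta> k) \<longlonglongrightarrow> - (f (x' + a') + f (x' - a')) * v"
proof -
  have s: "(\<lambda>k. a k - a') \<longlonglongrightarrow> 0" using assms(2) by (simp add: LIM_zero_iff)
  have "(\<lambda>k. (F ((x k + a') + (a k - a')) - F (x k + a')) / \<delta> k) \<longlonglongrightarrow> f (x' + a') * v"
    by (rule tendsto_difference_quotient[OF F_deriv f_cont]) (intro tendsto_intros assms s)+
  moreover have "(\<lambda>k. (F ((x k - a') + - (a k - a')) - F (x k - a')) / \<delta> k) \<longlonglongrightarrow> f (x' - a') * (- v)"
  proof (rule tendsto_difference_quotient[OF F_deriv f_cont])
    show "(\<lambda>k. - (a k - a')) \<longlonglongrightarrow> 0" using tendsto_minus[OF s] by simp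
    show "(\<lambda>k. - (a k - a') / \<delta> k) \<longlonglongrightarrow> - v"
      using tendsto_minus[OF assms(3)] by (simp only: minus_divide_left)
  qed (intro tendsto_intros assms)
  ultimately have "(\<lambda>k. (F ((x k - a') + - (a k - a')) - F (x k - a')) / \<delta> k
      - (F ((x k + a') + (a k - a')) - F (x k + a')) / \<delta> k) \<longlonglongrightarrow> f (x' - a') * (- v) - f (x' + a') * v"
    by (rule tendsto_diff[rotated])
  thus ?thesis by (simp add: E_def diff_divide_distrib add_divide_distrib algebra_simps)
qed

text \<open>The argument \<open>x\<close> moves too, which is the mode of convergence that
  \<open>mix_op_inv_tendsto\<close> asks for.\<close>

lemma H_quotient_tendsto:
  assumes l: "l \<longlonglongrightarrow> l0" "(\<lambda>k. (l k - l0) / \<delta> k) \<longlonglongrightarrow> v"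
    and m1: "m1 \<longlonglongrightarrow> n1" "(\<lambda>k. (m1 k - n1) / \<delta> k) \<longlonglongrightarrow> u1"
    and m2: "m2 \<longlonglongrightarrow> n2" "(\<lambda>k. (m2 k - n2) / \<delta> k) \<longlonglongrightarrow> u2"
    and x: "x \<longlonglongrightarrow> x'"
  shows "(\<lambda>k. H (l k) (m1 k) (m2 k) (x k) / \<delta> k) \<longlonglongrightarrow> dH (v, u1, u2) x'"
proof -
  have E: "(\<lambda>k. E (a k) (x k)) \<longlonglongrightarrow> E a' x'" if "a \<longlonglongrightarrow> a'" for a a'
    unfolding E_def by (intro tendsto_intros isCont_tendsto_compose[OF isCont_F] that x)
  have Q: "(\<lambda>k. (E (a k) (x k) - E a' (x k)) / \<delta> k) \<longlonglongrightarrow> - (f (x' + a') + f (x' - a')) * w"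
    if "a \<longlonglongrightarrow> a'" "(\<lambda>k. (a k - a') / \<delta> k) \<longlonglongrightarrow> w" for a a' w
    using E_quotient_tendsto[OF x that] .
  have "(\<lambda>k. (l k - l0) / \<delta> k * (l0 * E (m1 k - n1) (x k) + (1 - l0) * E (m1 k - n2) (x k)
      - l0 * E (m2 k - n1) (x k) - (1 - l0) * E (m2 k - n2) (x k))
    + l0\<^sup>2 * ((E (m1 k - n1) (x k) - E 0 (x k)) / \<delta> k) + l0 * (1 - l0) * ((E (m1 k - n2) (x k) - E (n1 - n2) (x k)) / \<delta> k)
    + l0 * (1 - l0) * ((E (m2 k - n1) (x k) - E (n2 - n1) (x k)) / \<delta> k) + (1 - l0)\<^sup>2 * ((E (m2 k - n2) (x k) - E 0 (x k)) / \<delta> k))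
    \<longlonglongrightarrow> v * (l0 * E (n1 - n1) x' + (1 - l0) * E (n1 - n2) x' - l0 * E (n2 - n1) x' - (1 - l0) * E (n2 - n2) x')
      + l0\<^sup>2 * (- (f (x' + 0) + f (x' - 0)) * u1) + l0 * (1 - l0) * (- (f (x' + (n1 - n2)) + f (x' - (n1 - n2))) * u1)
      + l0 * (1 - l0) * (- (f (x' + (n2 - n1)) + f (x' - (n2 - n1))) * u2) + (1 - l0)\<^sup>2 * (- (f (x' + 0) + f (x' - 0)) * u2)"
  proof (intro tendsto_add tendsto_mult tendsto_diff tendsto_const l(2) E m1(1) m2(1) Q)
    show "(\<lambda>k. m1 k - n1) \<longlonglongrightarrow> 0" "(\<lambda>k. m2 k - n2) \<longlonglongrightarrow> 0" using m1(1) m2(1) by (simp_all add: LIM_zero_iff)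
  qed (use m1(2) m2(2) in simp_all)
  moreover have "H (l k) (m1 k) (m2 k) (x k) / \<delta> k = (l k - l0) / \<delta> k * (l0 * E (m1 k - n1) (x k) + (1 - l0) * E (m1 k - n2) (x k)
      - l0 * E (m2 k - n1) (x k) - (1 - l0) * E (m2 k - n2) (x k))
    + l0\<^sup>2 * ((E (m1 k - n1) (x k) - E 0 (x k)) / \<delta> k) + l0 * (1 - l0) * ((E (m1 k - n2) (x k) - E (n1 - n2) (x k)) / \<delta> k)
    + l0 * (1 - l0) * ((E (m2 k - n1) (x k) - E (n2 - n1) (x k)) / \<delta> k) + (1 - l0)\<^sup>2 * ((E (m2 k - n2) (x k) - E 0 (x k)) / \<delta> k)" for k
    unfolding H_expand by (simp only: add_divide_distrib times_divide_eq_right times_divide_eq_left)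
  moreover have "v * (l0 * E (n1 - n1) x' + (1 - l0) * E (n1 - n2) x' - l0 * E (n2 - n1) x' - (1 - l0) * E (n2 - n2) x')
      + l0\<^sup>2 * (- (f (x' + 0) + f (x' - 0)) * u1) + l0 * (1 - l0) * (- (f (x' + (n1 - n2)) + f (x' - (n1 - n2))) * u1)
      + l0 * (1 - l0) * (- (f (x' + (n2 - n1)) + f (x' - (n2 - n1))) * u2) + (1 - l0)\<^sup>2 * (- (f (x' + 0) + f (x' - 0)) * u2)
     = dH (v, u1, u2) x'"
  proof -
    have "x' + (n1 - n2) = x' - (n2 - n1)" "x' - (n1 - n2) = x' + (n2 - n1)" by auto
    moreover define p q r s where "p = F (x' + (n2 - n1))" and "q = F (x' - (n2 - n1))"
      and "r = f (x' + (n2 - n1))" and "s = f (x' - (n2 - n1))"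
    ultimately show ?thesis
      unfolding dH_def E_def by (simp only: prod.case) (simp add: algebra_simps power2_eq_square)
  qed
  ultimately show ?thesis by simp
qed

text \<open>The cosine transform of \<open>dH\<close> is a nonzero multiple of
  \<open>v * sin (t * h) - A * t - B * t * cos (t * h)\<close> for small nonzero \<open>t\<close>,
  so \<open>sin_cos_relation_trivial\<close> applies with the gap \<open>h\<close> between the
  locations.\<close>

lemma dH_zero_imp:
  assumes z: "\<And>x. dH (v, u1, u2) x = 0"
  shows "v = 0" "u1 = 0" "u2 = 0"
proof -
  obtain e where e: "0 < e" "\<And>t. \<bar>t\<bar> < e \<Longrightarrow> (\<integral>y. cos (t * y) \<partial>P0) \<noteq> (0::real)"
    using cos_transform_nonzero[OF P0] by blast
  define h A B where "h = n2 - n1" and "A = l0\<^sup>2 * u1 + (1 - l0)\<^sup>2 * u2" and "B = l0 * (1 - l0) * (u1 + u2)"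
  have dH: "dH (v, u1, u2) x = v * (F (x + h) - F (x - h)) - A * (f (x + 0) + f (x - 0)) - B * (f (x + h) + f (x - h))" for x
    by (simp add: dH_def h_def A_def B_def)
  have "v * sin (t * h) = A * t + B * t * cos (t * h)" if t: "\<bar>t\<bar> < e" for t
  proof (cases "t = 0")
    case False
    define \<phi> where "\<phi> = (\<integral>y. cos (t * y) \<partial>P0)"
    define D where "D = (\<lambda>a x. cos (t * x) * (F (x + a) - F (x - a)))"
    define S where "S = (\<lambda>a x. cos (t * x) * (f (x + a) + f (x - a)))"
    have D: "integrable lborel (D a)" "integral\<^sup>L lborel (D a) = 2 * sin (t * a) / t * \<phi>" for a
      using lborel_cos_cdf_diff[OF P0 False, of a] by (simp_all add: D_def \<phi>_def)
    have S: "integrable lborel (S a)" "integral\<^sup>L lborel (S a) = 2 * cos (t * a) * \<phi>" for a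
      using lborel_cos_shifted_density[OF P0 F_deriv f_measurable, of t a] by (simp_all add: S_def \<phi>_def)
    have "0 = (\<integral>x. cos (t * x) * dH (v, u1, u2) x \<partial>lborel)" by (simp add: z)
    also have "\<dots> = (\<integral>x. v * D h x - A * S 0 x - B * S h x \<partial>lborel)"
      by (intro Bochner_Integration.integral_cong) (simp_all add: dH D_def S_def algebra_simps)
    also have "\<dots> = v * (2 * sin (t * h) / t * \<phi>) - A * (2 * cos (t * 0) * \<phi>) - B * (2 * cos (t * h) * \<phi>)"
      by (simp only: Bochner_Integration.integral_diff Bochner_Integration.integrable_diff integrable_mult_right D S integral_mult_right_zero)
    also have "\<dots> = 2 * \<phi> / t * (v * sin (t * h) - A * t - B * t * cos (t * h))"
      using False by (simp add: field_simps)
    finally show ?thesis using e(2)[OF t] False by (simp add: \<phi>_def)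
  qed auto
  from sin_cos_relation_trivial[OF _ e(1) this] n have "v = 0" "A = 0" "B = 0" by (simp_all add: h_def)
  thus "v = 0" by simp
  \<comment> \<open>\<open>B = 0\<close> forces opposite location changes; then \<open>A = 0\<close>
    reads \<open>u1 * (2 * l0 - 1) = 0\<close>, where \<open>l0 < 1/2\<close> matters.\<close>
  have u: "u2 = - u1" using \<open>B = 0\<close> l0 d by (simp add: B_def)
  have "u1 * (2 * l0 - 1) = 0" using \<open>A = 0\<close> by (simp add: A_def u power2_eq_square algebra_simps)
  thus "u1 = 0" using l0 d by simp
  with u show "u2 = 0" by simp
qed

text \<open>A limiting direction along which \<open>K\<close> is negligible against
  \<open>\<delta>\<^sup>2\<close> must be zero. The rescaled residuals are inverse images of the
  rescaled \<open>H\<close> and converge to the inverse image \<open>D'\<close> of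
  \<open>dH\<close>. Dominated convergence makes the integral of the square of \<open>D'\<close>
  zero; full support, continuity and invertibility then give \<open>dH = 0\<close>.\<close>

lemma K_quadratic_growth_seq:
  assumes l: "l \<longlonglongrightarrow> l0" "(\<lambda>k. (l k - l0) / \<delta> k) \<longlonglongrightarrow> v"
    and m1: "m1 \<longlonglongrightarrow> n1" "(\<lambda>k. (m1 k - n1) / \<delta> k) \<longlonglongrightarrow> u1"
    and m2: "m2 \<longlonglongrightarrow> n2" "(\<lambda>k. (m2 k - n2) / \<delta> k) \<longlonglongrightarrow> u2"
    and lk: "\<And>k. 0 \<le> l k" "\<And>k. l k \<le> 1/2 - d"
    and \<delta>: "\<And>k. 0 < \<delta> k" "\<And>k. \<bar>l k - l0\<bar> \<le> \<delta> k" "\<And>k. \<bar>m1 k - n1\<bar> \<le> \<delta> k" "\<And>k. \<bar>m2 k - n2\<bar> \<le> \<delta> k"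
    and K: "(\<lambda>k. K (l k) (m1 k) (m2 k) / (\<delta> k)\<^sup>2) \<longlonglongrightarrow> 0"
  shows "v = 0" "u1 = 0" "u2 = 0"
proof -
  define C where "C = 4 + 8 * L"
  have C0: "0 \<le> C" using L_nonneg by (simp add: C_def)
  define h where "h = (\<lambda>k x. H (l k) (m1 k) (m2 k) x / \<delta> k)"
  define D where "D = (\<lambda>k x. residual (l k, m1 k, m2 k) G x / \<delta> k)"
  have hb: "\<bar>h k x\<bar> \<le> C" for k x
  proof -
    have "\<bar>H (l k) (m1 k) (m2 k) x\<bar> \<le> 4 * \<delta> k + 4 * L * (\<delta> k + \<delta> k)"
      by (rule order_trans[OF H_bound])
         (intro add_mono mult_left_mono \<delta>(2-4) mult_nonneg_nonneg L_nonneg, auto)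
    thus ?thesis using \<delta>(1)[of k] by (simp add: h_def C_def abs_div field_simps)
  qed
  have hlim: "(\<lambda>k. h k (x k)) \<longlonglongrightarrow> dH (v, u1, u2) x'" if "x \<longlonglongrightarrow> x'" for x x'
    unfolding h_def by (rule H_quotient_tendsto[OF l m1 m2 that])
  have Deq: "D k x = mix_op_inv (l k, - m1 k, - m2 k) (h k) x" for k x
  proof -
    have "mix_op (l k, - m1 k, - m2 k) (D k) = h k"
    proof
      fix y
      have "mix_op (l k, - m1 k, - m2 k) (D k) y
         = mix_op (l k, - m1 k, - m2 k) (residual (l k, m1 k, m2 k) G) y / \<delta> k"
        by (simp add: mix_op_eq D_def add_divide_distrib)
      also have "\<dots> = h k y" using lk[of k] d by (subst mix_op_residual) (auto simp: h_def)
      finally show "mix_op (l k, - m1 k, - m2 k) (D k) y = h k y" .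
    qed
    moreover have "\<bar>D k y\<bar> \<le> (1 + 1 / (2 * d)) / \<delta> k" for y
      using residual_G_bound[OF lk, of k _ _ y] \<delta>(1)[of k] by (simp add: D_def abs_div divide_right_mono)
    ultimately show ?thesis
      using mix_op_inv_mix_op[of "l k" "D k" "(1 + 1 / (2 * d)) / \<delta> k" "- m1 k" "- m2 k" x] lk[of k] d by simp
  qed
  have Db: "\<bar>D k x\<bar> \<le> C / (2 * d)" for k x
  proof -
    have "\<bar>D k x\<bar> \<le> C / (1 - 2 * l k)"
      unfolding Deq using lk[of k] d hb by (intro mix_op_inv_bound) auto
    also have "\<dots> \<le> C / (2 * d)" using lk[of k] d C0 by (intro divide_left_mono) auto
    finally show ?thesis .
  qed
  define D' where "D' = mix_op_inv (l0, - n1, - n2) (dH (v, u1, u2))"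
  have Dlim: "(\<lambda>k. D k (x k)) \<longlonglongrightarrow> D' x'" if "x \<longlonglongrightarrow> x'" for x x'
    unfolding Deq D'_def
    by (rule mix_op_inv_tendsto[OF l(1) tendsto_minus[OF m1(1)] tendsto_minus[OF m2(1)] that d lk hb hlim])
  have dHb: "\<bar>dH (v, u1, u2) x\<bar> \<le> C" for x
    by (rule LIMSEQ_le_const2[OF tendsto_rabs[OF hlim[OF tendsto_const]]]) (use hb in auto)
  have dHc: "isCont (dH (v, u1, u2)) x" for x
    unfolding dH_def prod.case
    by (intro continuous_intros isCont_o2[OF _ isCont_F] isCont_o2[OF _ f_cont])
  have D'c: "isCont D' x" for x
  proof (rule continuous_at_sequentiallyI)
    fix u assume u: "u \<longlonglongrightarrow> x"
    show "(\<lambda>k. D' (u k)) \<longlonglongrightarrow> D' x"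
      unfolding D'_def
      by (rule mix_op_inv_tendsto[OF tendsto_const tendsto_const tendsto_const u d])
         (use l0 dHb isCont_tendsto_compose[OF dHc] in auto)
  qed
  have D'b: "\<bar>D' x\<bar> \<le> C / (2 * d)" for x
    by (rule LIMSEQ_le_const2[OF tendsto_rabs[OF Dlim[OF tendsto_const]]]) (use Db in auto)
  have Cd: "0 \<le> C / (2 * d)" using C0 d by simp
  have Dsq: "(D k x)\<^sup>2 \<le> (C / (2 * d))\<^sup>2" "(D' x)\<^sup>2 \<le> (C / (2 * d))\<^sup>2" for k x
    using Db[of k x] D'b[of x] by (simp_all add: power2_le_iff_abs_le[OF Cd])
  have D'm: "D' \<in> borel_measurable borel"
    by (intro borel_measurable_continuous_onI continuous_at_imp_continuous_on) (use D'c in blast)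
  have "(\<lambda>k. \<integral>x. (D k x)\<^sup>2 \<partial>PG) \<longlonglongrightarrow> (\<integral>x. (D' x)\<^sup>2 \<partial>PG)"
  proof (rule integral_dominated_convergence[where w = "\<lambda>_. (C / (2 * d))\<^sup>2"])
    show "AE x in PG. (\<lambda>k. (D k x)\<^sup>2) \<longlonglongrightarrow> (D' x)\<^sup>2"
      by (intro AE_I2 tendsto_power Dlim tendsto_const)
    show "(\<lambda>x. (D k x)\<^sup>2) \<in> borel_measurable PG" for k
      unfolding D_def using residual_G_measurable[OF lk, of k] by simp
  qed (use Dsq D'm in auto)
  moreover have "(\<integral>x. (D k x)\<^sup>2 \<partial>PG) = K (l k) (m1 k) (m2 k) / (\<delta> k)\<^sup>2" for k
    by (simp add: D_def K_def power_divide)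
  ultimately have D'I: "(\<integral>x. (D' x)\<^sup>2 \<partial>PG) = 0" using K LIMSEQ_unique by fastforce
  have "(D' x)\<^sup>2 = 0" for x
  proof (rule real_distribution_zero_integral[OF PG strict_G _ _ _ D'I])
    show "integrable PG (\<lambda>x. (D' x)\<^sup>2)"
      using Dsq(2) D'm by (intro PG.integrable_const_bound[of _ "(C / (2 * d))\<^sup>2"]) auto
  qed (use D'c in \<open>auto intro!: continuous_intros\<close>)
  hence D'0: "D' x = 0" for x by simp
  have "dH (v, u1, u2) x = 0" for x
    using mix_op_mix_op_inv[of l0 "dH (v, u1, u2)" C "- n1" "- n2" x] dHb l0 d D'0
    by (simp add: mix_op_eq D'_def[symmetric])
  thus "v = 0" "u1 = 0" "u2 = 0" using dH_zero_imp by blast+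
qed

text \<open>If it failed, the choices \<open>c = \<rho> = 1 / (k + 1)\<close> would give parameters
  tending to the true one with \<open>K\<close> negligible against the squared distance. Normalized
  differences have a limit on the unit sphere, yet \<open>K_quadratic_growth_seq\<close> makes this
  limit 0.\<close>

lemma K_quadratic_growth:
  obtains c \<rho> where "0 < c" "0 < \<rho>"
    "\<And>l m1 m2. 0 \<le> l \<Longrightarrow> l \<le> 1/2 - d \<Longrightarrow> dist (l, m1, m2) (l0, n1, n2) < \<rho> \<Longrightarrow>
       c * (dist (l, m1, m2) (l0, n1, n2))\<^sup>2 \<le> K l m1 m2"
proof (rule ccontr)
  assume neg: "\<not> thesis"
  note witness = that
  have "\<exists>l m1 m2. 0 \<le> l \<and> l \<le> 1/2 - d \<and> dist (l, m1, m2) (l0, n1, n2) < e \<and>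
       K l m1 m2 < e * (dist (l, m1, m2) (l0, n1, n2))\<^sup>2" if "e > 0" for e
    using witness[of e e] that neg by (meson not_less)
  from this[of "1 / real (Suc _)"] have "\<exists>l m1 m2. 0 \<le> l \<and> l \<le> 1/2 - d \<and> dist (l, m1, m2) (l0, n1, n2) < 1 / real (Suc k) \<and>
       K l m1 m2 < 1 / real (Suc k) * (dist (l, m1, m2) (l0, n1, n2))\<^sup>2" for k
    by (metis of_nat_0_less_iff zero_less_Suc zero_less_divide_1_iff)
  then obtain l m1 m2 where lm: "\<And>k. 0 \<le> l k" "\<And>k. l k \<le> 1/2 - d"
    "\<And>k. dist (l k, m1 k, m2 k) (l0, n1, n2) < 1 / real (Suc k)"
    "\<And>k. K (l k) (m1 k) (m2 k) < 1 / real (Suc k) * (dist (l k, m1 k, m2 k) (l0, n1, n2))\<^sup>2"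
    by metis
  define \<theta> where "\<theta> = (\<lambda>k. (l k, m1 k, m2 k) - (l0, n1, n2))"
  define \<delta> where "\<delta> = (\<lambda>k. norm (\<theta> k))"
  have \<delta>_dist: "\<delta> k = dist (l k, m1 k, m2 k) (l0, n1, n2)" for k by (simp add: \<delta>_def \<theta>_def dist_norm)
  have K0: "0 \<le> K l m1 m2" for l m1 m2 by (simp add: K_def)
  have \<delta>0: "0 < \<delta> k" for k
  proof (rule ccontr)
    assume "\<not> 0 < \<delta> k"
    hence "\<delta> k = 0" by (simp add: \<delta>_def)
    thus False using lm(4)[of k] K0[of "l k" "m1 k" "m2 k"] by (simp add: \<delta>_dist[symmetric])
  qed
  define u where "u = (\<lambda>k. (1 / \<delta> k) *\<^sub>R \<theta> k)"
  have un: "norm (u k) = 1" for k using \<delta>0[of k] by (simp add: u_def \<delta>_def)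
  hence "\<forall>k. u k \<in> sphere 0 1" by simp
  then obtain u' r where r: "strict_mono r" "(u \<circ> r) \<longlonglongrightarrow> u'" "u' \<in> sphere 0 1"
    using compact_sphere[of "0 :: real \<times> real \<times> real" 1] unfolding compact_def by metis
  obtain v u1 u2 where u': "u' = (v, u1, u2)" by (cases u') auto
  have \<delta>lim: "\<delta> \<longlonglongrightarrow> 0"
    by (rule Lim_null_comparison[OF _ LIMSEQ_inverse_real_of_nat])
       (use lm(3) \<delta>0 in \<open>auto simp: \<delta>_dist inverse_eq_divide intro!: eventuallyI less_imp_le\<close>)
  have comp: "\<bar>l k - l0\<bar> \<le> \<delta> k" "\<bar>m1 k - n1\<bar> \<le> \<delta> k" "\<bar>m2 k - n2\<bar> \<le> \<delta> k" for k
  proof -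
    have "norm (fst (\<theta> k)) \<le> norm (\<theta> k)" "norm (fst (snd (\<theta> k))) \<le> norm (\<theta> k)" "norm (snd (snd (\<theta> k))) \<le> norm (\<theta> k)"
      using norm_fst_le[of "fst (\<theta> k)" "snd (\<theta> k)"] norm_snd_le[of "snd (\<theta> k)" "fst (\<theta> k)"]
        norm_fst_le[of "fst (snd (\<theta> k))" "snd (snd (\<theta> k))"] norm_snd_le[of "snd (snd (\<theta> k))" "fst (snd (\<theta> k))"]
      by simp_all
    thus "\<bar>l k - l0\<bar> \<le> \<delta> k" "\<bar>m1 k - n1\<bar> \<le> \<delta> k" "\<bar>m2 k - n2\<bar> \<le> \<delta> k"
      by (simp_all add: \<theta>_def \<delta>_def)
  qed
  have \<delta>r: "(\<lambda>k. \<delta> (r k)) \<longlonglongrightarrow> 0" using LIMSEQ_subseq_LIMSEQ[OF \<delta>lim r(1)] by (simp add: o_def)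
  have lim0: "(\<lambda>k. g (r k)) \<longlonglongrightarrow> a" if "\<And>k. \<bar>g k - a\<bar> \<le> \<delta> k" for g :: "nat \<Rightarrow> real" and a
  proof -
    have "(\<lambda>k. g (r k) - a) \<longlonglongrightarrow> 0"
      by (rule Lim_null_comparison[OF _ \<delta>r]) (use that in auto)
    thus ?thesis by (simp add: LIM_zero_iff)
  qed
  have ur: "(\<lambda>k. u (r k)) \<longlonglongrightarrow> u'" using r(2) by (simp add: o_def)
  have q: "(\<lambda>k. (l (r k) - l0) / \<delta> (r k)) \<longlonglongrightarrow> v" "(\<lambda>k. (m1 (r k) - n1) / \<delta> (r k)) \<longlonglongrightarrow> u1"
    "(\<lambda>k. (m2 (r k) - n2) / \<delta> (r k)) \<longlonglongrightarrow> u2"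
    using tendsto_fst[OF ur] tendsto_fst[OF tendsto_snd[OF ur]] tendsto_snd[OF tendsto_snd[OF ur]]
    by (simp_all add: u' u_def \<theta>_def)
  have "(\<lambda>k. K (l k) (m1 k) (m2 k) / (\<delta> k)\<^sup>2) \<longlonglongrightarrow> 0"
  proof (rule Lim_null_comparison[OF _ LIMSEQ_inverse_real_of_nat])
    have "norm (K (l k) (m1 k) (m2 k) / (\<delta> k)\<^sup>2) \<le> inverse (real (Suc k))" for k
      using lm(4)[of k] \<delta>0[of k] K0[of "l k" "m1 k" "m2 k"]
      by (simp add: \<delta>_dist[symmetric] pos_divide_le_eq inverse_eq_divide less_imp_le)
    thus "\<forall>\<^sub>F k in sequentially. norm (K (l k) (m1 k) (m2 k) / (\<delta> k)\<^sup>2) \<le> inverse (real (Suc k))" by simp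
  qed
  from LIMSEQ_subseq_LIMSEQ[OF this r(1)]
  have "(\<lambda>k. K (l (r k)) (m1 (r k)) (m2 (r k)) / (\<delta> (r k))\<^sup>2) \<longlonglongrightarrow> 0" by (simp add: o_def)
  from K_quadratic_growth_seq[OF lim0[OF comp(1)] q(1) lim0[OF comp(2)] q(2) lim0[OF comp(3)] q(3) lm(1,2) \<delta>0 comp this]
  have "u' = 0" by (simp add: u' zero_prod_def)
  thus False using r(3) by simp
qed

end

section \<open>Smoothing\<close>

lemma smoothing_kernelD:
  assumes "smoothing_kernel q"
  shows "q \<in> borel_measurable borel" "\<And>y. 0 \<le> q y" "\<And>y. q (- y) = q y"
    "integrable lborel q" "(\<integral>y. q y \<partial>lborel) = 1"
    "integrable lborel (\<lambda>y. y\<^sup>2 * q y)" "(\<integral>y. y\<^sup>2 * q y \<partial>lborel) = 1"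
    "integrable lborel (\<lambda>y. \<bar>y\<bar> * q y)" "(\<integral>y. \<bar>y\<bar> * q y \<partial>lborel) \<le> 1"
    "integrable lborel (\<lambda>y. y * q y)" "(\<integral>y. y * q y \<partial>lborel) = 0"
proof -
  show m[measurable]: "q \<in> borel_measurable borel" and nn: "\<And>y. 0 \<le> q y" and even: "\<And>y. q (- y) = q y"
    and i1: "integrable lborel q" and e1: "(\<integral>y. q y \<partial>lborel) = 1"
    and i2: "integrable lborel (\<lambda>y. y\<^sup>2 * q y)" and e2: "(\<integral>y. y\<^sup>2 * q y \<partial>lborel) = 1"
    using assms unfolding smoothing_kernel_def has_bochner_integral_iff by auto
  \<comment> \<open>The first absolute moment is controlled by the mean of the moments of order 0
    and 2, both equal to 1.\<close>
  have le: "\<bar>y\<bar> * q y \<le> (q y + y\<^sup>2 * q y) / 2" for y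
  proof -
    have "0 \<le> (\<bar>y\<bar> - 1)\<^sup>2" by simp
    hence "\<bar>y\<bar> \<le> (1 + y\<^sup>2) / 2" by (simp add: power2_diff)
    from mult_right_mono[OF this nn[of y]] show ?thesis by (simp add: algebra_simps)
  qed
  have i3: "integrable lborel (\<lambda>y. (q y + y\<^sup>2 * q y) / 2)" using i1 i2 by simp
  show ia: "integrable lborel (\<lambda>y. \<bar>y\<bar> * q y)"
    by (rule Bochner_Integration.integrable_bound[OF i3]) (use le nn in \<open>auto simp: abs_mult\<close>)
  have "(\<integral>y. \<bar>y\<bar> * q y \<partial>lborel) \<le> (\<integral>y. (q y + y\<^sup>2 * q y) / 2 \<partial>lborel)"
    by (rule integral_mono[OF ia i3 le])
  also have "\<dots> = 1" using i1 i2 by (simp add: e1 e2)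
  finally show "(\<integral>y. \<bar>y\<bar> * q y \<partial>lborel) \<le> 1" .
  show "integrable lborel (\<lambda>y. y * q y)"
    by (rule Bochner_Integration.integrable_bound[OF ia]) (use nn in \<open>auto simp: abs_mult\<close>)
  have "(\<integral>y. y * q y \<partial>lborel) = (\<integral>y. (0 + - 1 * y) * q (0 + - 1 * y) \<partial>lborel)"
    by (subst lborel_integral_real_affine[where c = "- 1" and t = 0]) auto
  also have "\<dots> = - (\<integral>y. y * q y \<partial>lborel)" by (simp add: even)
  finally show "(\<integral>y. y * q y \<partial>lborel) = 0" by simp
qed

lemma kernel_cdf_eq:
  assumes "smoothing_kernel q"
  shows "kernel_cdf q t = (\<integral>y. q y * indicator {..t} y \<partial>lborel)"
  unfolding kernel_cdf_def set_lebesgue_integral_def by (simp add: mult.commute)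

lemma integrable_kernel_mult:
  assumes "smoothing_kernel q" "g \<in> borel_measurable borel" "\<And>y. \<bar>g y\<bar> \<le> (C::real)"
  shows "integrable lborel (\<lambda>y. q y * g y)"
proof (rule Bochner_Integration.integrable_bound)
  show "integrable lborel (\<lambda>y. C * q y)" using smoothing_kernelD(4)[OF assms(1)] by simp
  have "norm (q y * g y) \<le> norm (C * q y)" for y
  proof -
    have "\<bar>q y\<bar> * \<bar>g y\<bar> \<le> \<bar>q y\<bar> * \<bar>C\<bar>" using assms(3)[of y] by (intro mult_left_mono) auto
    thus ?thesis by (simp add: abs_mult mult.commute)
  qed
  thus "AE y in lborel. norm (q y * g y) \<le> norm (C * q y)" by simp
qed (use smoothing_kernelD(1)[OF assms(1)] assms(2) in measurable)

lemma kernel_cdf_bounds: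
  assumes "smoothing_kernel q"
  shows "mono (kernel_cdf q)" "0 \<le> kernel_cdf q t" "kernel_cdf q t \<le> 1"
proof -
  note q = smoothing_kernelD[OF assms]
  have i: "integrable lborel (\<lambda>y. q y * indicator {..t} y)" for t
    by (rule integrable_kernel_mult[OF assms, of _ 1]) (auto split: split_indicator)
  show "mono (kernel_cdf q)" unfolding kernel_cdf_eq[OF assms]
    by (intro monoI integral_mono i) (use q(2) in \<open>auto split: split_indicator\<close>)
  show "0 \<le> kernel_cdf q t" unfolding kernel_cdf_eq[OF assms] using q(2) by simp
  have "kernel_cdf q t \<le> (\<integral>y. q y \<partial>lborel)" unfolding kernel_cdf_eq[OF assms]
    by (intro integral_mono i q(4)) (use q(2) in \<open>auto split: split_indicator\<close>)
  thus "kernel_cdf q t \<le> 1" using q(5) by simp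
qed

lemma smooth_ecdf_bounds:
  assumes "smoothing_kernel q" "n \<ge> 1" "b n > 0"
  shows "mono (smooth_ecdf q b x n)" "0 \<le> smooth_ecdf q b x n t" "smooth_ecdf q b x n t \<le> 1"
proof -
  note k = kernel_cdf_bounds[OF assms(1)]
  show "mono (smooth_ecdf q b x n)"
    unfolding smooth_ecdf_def using assms(3)
    by (intro monoI mult_left_mono sum_mono monoD[OF k(1)] divide_right_mono) auto
  show "0 \<le> smooth_ecdf q b x n t"
    unfolding smooth_ecdf_def using k(2) by (intro mult_nonneg_nonneg sum_nonneg) auto
  have "(\<Sum>i=1..n. kernel_cdf q ((t - x i) / b n)) \<le> (\<Sum>i=1..n. 1)" by (intro sum_mono k(3))
  thus "smooth_ecdf q b x n t \<le> 1"
    unfolding smooth_ecdf_def using assms(2) by (simp add: field_simps)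
qed

section \<open>The empirical c.d.f. and the smoothing bias\<close>

lemma ecdf_bounds:
  assumes "n \<ge> 1"
  shows "mono (ecdf x n)" "0 \<le> ecdf x n t" "ecdf x n t \<le> 1"
proof -
  show "mono (ecdf x n)" unfolding ecdf_def
    by (intro monoI mult_left_mono sum_mono) (auto split: split_indicator)
  show "0 \<le> ecdf x n t" unfolding ecdf_def by (intro mult_nonneg_nonneg sum_nonneg) auto
  have "(\<Sum>i=1..n. indicator {..t} (x i) :: real) \<le> (\<Sum>i=1..n. 1)" by (intro sum_mono) (auto split: split_indicator)
  thus "ecdf x n t \<le> 1" unfolding ecdf_def using assms by (simp add: field_simps)
qed

lemma ecdf_distribution:
  assumes n: "n \<ge> 1"
  shows "real_distribution (interval_measure (ecdf x n))" "cdf (interval_measure (ecdf x n)) = ecdf x n"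
proof -
  have ind: "(indicator {..t} (x i) :: real) = indicator {x i..} t" for t i by (auto split: split_indicator)
  have m: "ecdf x n s \<le> ecdf x n t" if "s \<le> t" for s t using ecdf_bounds(1)[OF n] that by (rule monoD)
  have r: "continuous (at_right a) (ecdf x n)" for a
  proof -
    have "((\<lambda>t. indicator {x i..} t :: real) \<longlongrightarrow> indicator {x i..} a) (at_right a)" for i
    proof (cases "a < x i")
      case True
      have "\<forall>\<^sub>F t in at_right a. indicator {x i..} t = (indicator {x i..} a :: real)"
        using eventually_at_right_less[of a] eventually_at_right[OF True] True
        by (auto simp: eventually_at_right[OF True] intro!: exI[of _ "x i"])
      thus ?thesis by (rule tendsto_eventually)
    next
      case False
      have "\<forall>\<^sub>F t in at_right a. indicator {x i..} t = (indicator {x i..} a :: real)"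
        using eventually_at_right_less[of a] by eventually_elim (use False in auto)
      thus ?thesis by (rule tendsto_eventually)
    qed
    thus ?thesis unfolding continuous_within ecdf_def ind by (intro tendsto_intros)
  qed
  have bot: "(ecdf x n \<longlongrightarrow> 0) at_bot"
  proof (rule tendsto_eventually)
    have "\<forall>\<^sub>F t in at_bot. \<forall>i\<in>{1..n}. t < x i"
      by (intro eventually_ball_finite ballI eventually_gt_at_bot) auto
    thus "\<forall>\<^sub>F t in at_bot. ecdf x n t = 0"
      by eventually_elim (auto simp: ecdf_def intro!: sum.neutral split: split_indicator)
  qed
  have top: "(ecdf x n \<longlongrightarrow> 1) at_top"
  proof (rule tendsto_eventually)
    have "\<forall>\<^sub>F t in at_top. \<forall>i\<in>{1..n}. x i \<le> t"
      by (intro eventually_ball_finite ballI eventually_ge_at_top) auto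
    thus "\<forall>\<^sub>F t in at_top. ecdf x n t = 1"
    proof eventually_elim
      case (elim t)
      hence "(\<Sum>i=1..n. indicator {..t} (x i) :: real) = (\<Sum>i=1..n. 1)" by (intro sum.cong) auto
      thus ?case using n by (simp add: ecdf_def)
    qed
  qed
  show "real_distribution (interval_measure (ecdf x n))"
    by (rule real_distribution_interval_measure[OF m r bot top])
  show "cdf (interval_measure (ecdf x n)) = ecdf x n"
    by (rule cdf_interval_measure[OF m r bot])
qed

text \<open>As an average of values of the empirical c.d.f., the smoothed one inherits uniform
  bounds from it.\<close>

lemma smooth_ecdf_eq_convolution:
  assumes "smoothing_kernel q" "b n > 0"
  shows "smooth_ecdf q b x n t = (\<integral>y. q y * ecdf x n (t - b n * y) \<partial>lborel)"
proof -
  have i: "integrable lborel (\<lambda>y. q y * indicator {..t} y)" for t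
    by (rule integrable_kernel_mult[OF assms(1), of _ 1]) (auto split: split_indicator)
  have eq: "q y * ecdf x n (t - b n * y) = 1 / real n * (\<Sum>k=1..n. q y * indicator {..(t - x k) / b n} y)" for y
  proof -
    have "(indicator {..t - b n * y} (x k) :: real) = indicator {..(t - x k) / b n} y" for k
      using assms(2) by (auto simp: field_simps split: split_indicator)
    thus ?thesis by (simp only: ecdf_def mult.left_commute[of "q y"] sum_distrib_left[symmetric])
  qed
  have "(\<integral>y. q y * ecdf x n (t - b n * y) \<partial>lborel)
      = 1 / real n * (\<Sum>k=1..n. \<integral>y. q y * indicator {..(t - x k) / b n} y \<partial>lborel)"
    unfolding eq by (subst integral_mult_right_zero, subst Bochner_Integration.integral_sum) (use i in auto)
  thus ?thesis by (simp add: smooth_ecdf_def kernel_cdf_eq[OF assms(1)])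
qed

text \<open>The convolution of \<open>G\<close> with the kernel at bandwidth \<open>h\<close>, minus
  \<open>G\<close>; the subtraction sits inside because \<open>q\<close> has integral 1.\<close>

definition smooth_bias :: "(real \<Rightarrow> real) \<Rightarrow> real \<Rightarrow> (real \<Rightarrow> real) \<Rightarrow> real \<Rightarrow> real" where
  "smooth_bias q h G t = (\<integral>y. q y * (G (t - h * y) - G t) \<partial>lborel)"

text \<open>Averaging does not increase the uniform error of the empirical c.d.f., so smoothing adds
  only a deterministic bias.\<close>

lemma smooth_ecdf_diff_le:
  assumes q: "smoothing_kernel q" and n: "n \<ge> 1" "b n > 0"
    and G: "mono G" "\<And>x. 0 \<le> G x" "\<And>x. G x \<le> (1::real)"
    and \<Delta>: "\<And>x. \<bar>ecdf x' n x - G x\<bar> \<le> \<Delta>"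
  shows "\<bar>smooth_ecdf q b x' n t - G t\<bar> \<le> \<Delta> + \<bar>smooth_bias q (b n) G t\<bar>"
proof -
  note qD = smoothing_kernelD[OF q]
  have [measurable]: "G \<in> borel_measurable borel" "ecdf x' n \<in> borel_measurable borel"
    using G(1) ecdf_bounds(1)[OF n(1)] by (auto intro: borel_measurable_mono)
  have Gd: "\<bar>G u - G v\<bar> \<le> 1" for u v
    using G(2)[of u] G(3)[of u] G(2)[of v] G(3)[of v] by linarith
  have i1: "integrable lborel (\<lambda>y. q y * ecdf x' n (t - b n * y))"
    by (rule integrable_kernel_mult[OF q, of _ 1]) (use ecdf_bounds[OF n(1)] in auto)
  have i2: "integrable lborel (\<lambda>y. q y * G (t - b n * y))"
    by (rule integrable_kernel_mult[OF q, of _ 1]) (use G in auto)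
  have i3: "integrable lborel (\<lambda>y. q y * (ecdf x' n (t - b n * y) - G (t - b n * y)))"
    by (rule integrable_kernel_mult[OF q, of _ \<Delta>]) (use \<Delta> in auto)
  have i4: "integrable lborel (\<lambda>y. q y * (G (t - b n * y) - G t))"
    by (rule integrable_kernel_mult[OF q, of _ 1]) (use Gd in auto)
  have "smooth_ecdf q b x' n t - G t = (\<integral>y. q y * ecdf x' n (t - b n * y) \<partial>lborel) - (\<integral>y. q y * G t \<partial>lborel)"
    using qD(5) by (simp add: smooth_ecdf_eq_convolution[where b = b and n = n and x = x', OF q n(2)])
  also have "\<dots> = (\<integral>y. q y * ecdf x' n (t - b n * y) - q y * G t \<partial>lborel)"
    using qD(4) by (intro Bochner_Integration.integral_diff[symmetric] i1) auto
  also have "\<dots> = (\<integral>y. q y * (ecdf x' n (t - b n * y) - G (t - b n * y)) + q y * (G (t - b n * y) - G t) \<partial>lborel)"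
    by (intro Bochner_Integration.integral_cong) (auto simp: algebra_simps)
  also have "\<dots> = (\<integral>y. q y * (ecdf x' n (t - b n * y) - G (t - b n * y)) \<partial>lborel) + smooth_bias q (b n) G t"
    unfolding smooth_bias_def by (rule Bochner_Integration.integral_add[OF i3 i4])
  finally have eq: "smooth_ecdf q b x' n t - G t = \<dots>" .
  have "\<bar>\<integral>y. q y * (ecdf x' n (t - b n * y) - G (t - b n * y)) \<partial>lborel\<bar> \<le> (\<integral>y. \<bar>q y * (ecdf x' n (t - b n * y) - G (t - b n * y))\<bar> \<partial>lborel)"
    by (rule integral_abs_bound)
  also have "\<dots> \<le> (\<integral>y. q y * \<Delta> \<partial>lborel)"
    by (intro integral_mono integrable_abs i3)
       (use qD(2,4) \<Delta> in \<open>auto simp: abs_mult intro!: mult_left_mono\<close>)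
  also have "\<dots> = \<Delta>" using qD(5) by simp
  finally show ?thesis unfolding eq by linarith
qed

text \<open>The order \<open>h\<close> comes from the first absolute moment, which is at most 1. It
  is enough for consistency.\<close>

lemma smooth_bias_lipschitz:
  assumes q: "smoothing_kernel q" and h: "h > 0"
    and G: "\<And>x y. \<bar>G x - G y\<bar> \<le> L * \<bar>x - y\<bar>" "mono G" "\<And>x. 0 \<le> G x" "\<And>x. G x \<le> (1::real)"
  shows "\<bar>smooth_bias q h G t\<bar> \<le> L * h"
proof -
  note qD = smoothing_kernelD[OF q]
  have L: "0 \<le> L" using G(1)[of 1 0] by simp
  have [measurable]: "G \<in> borel_measurable borel" using G(2) by (rule borel_measurable_mono)
  have Gd: "\<bar>G u - G v\<bar> \<le> 1" for u v
    using G(3)[of u] G(4)[of u] G(3)[of v] G(4)[of v] by linarith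
  have i: "integrable lborel (\<lambda>y. q y * (G (t - h * y) - G t))"
    by (rule integrable_kernel_mult[OF q, of _ 1]) (use Gd in auto)
  have "\<bar>smooth_bias q h G t\<bar> \<le> (\<integral>y. \<bar>q y * (G (t - h * y) - G t)\<bar> \<partial>lborel)"
    unfolding smooth_bias_def by (rule integral_abs_bound)
  also have "\<dots> \<le> (\<integral>y. (L * h) * (\<bar>y\<bar> * q y) \<partial>lborel)"
  proof (rule integral_mono)
    fix y
    have "q y * \<bar>G (t - h * y) - G t\<bar> \<le> q y * (L * \<bar>t - h * y - t\<bar>)"
      by (intro mult_left_mono G(1) qD(2))
    also have "\<dots> = (L * h) * (\<bar>y\<bar> * q y)" using h by (simp add: abs_mult)
    finally show "\<bar>q y * (G (t - h * y) - G t)\<bar> \<le> (L * h) * (\<bar>y\<bar> * q y)"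
      using qD(2)[of y] by (simp add: abs_mult)
  qed (use i qD(8) in auto)
  also have "\<dots> = L * h * (\<integral>y. \<bar>y\<bar> * q y \<partial>lborel)" by simp
  also have "\<dots> \<le> L * h * 1" using L h qD(9) by (intro mult_left_mono) auto
  finally show ?thesis by simp
qed


text \<open>
  The kernel has mean zero, so \<open>G (t - h y) - G t\<close> may be replaced by
  \<open>G (t - h y) - G t + h y g t\<close>, which is bounded by the variation of \<open>g\<close> near \<open>t\<close>. Integrating
  over \<open>t\<close> before \<open>y\<close> gives the order \<open>h\<^sup>2\<close> although \<open>g'\<close> need not be bounded.
\<close>

lemma smooth_bias_L1:
  fixes G g g' :: "real \<Rightarrow> real"
  assumes q: "smoothing_kernel q" and h: "h > 0"
    and G: "mono G" "\<And>x. 0 \<le> G x" "\<And>x. G x \<le> 1"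
    and g: "\<And>x. (G has_real_derivative g x) (at x)"
    and g': "\<And>x. (g has_real_derivative g' x) (at x)" "\<And>x. isCont g' x" "integrable lborel g'"
    and \<nu>: "real_distribution \<nu>" and L: "0 \<le> L" "\<And>x y. \<bar>cdf \<nu> x - cdf \<nu> y\<bar> \<le> L * \<bar>x - y\<bar>"
    and \<sigma>: "\<sigma> = 1 \<or> \<sigma> = - 1"
  shows "(\<integral>\<^sup>+x. ennreal \<bar>smooth_bias q h G (s + \<sigma> * x)\<bar> \<partial>\<nu>) \<le> ennreal (2 * L * h\<^sup>2 * (\<integral>v. \<bar>g' v\<bar> \<partial>lborel))"
proof -
  interpret \<nu>: real_distribution \<nu> by fact
  interpret \<nu>L: pair_sigma_finite \<nu> lborel ..
  note qD = smoothing_kernelD[OF q]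
  note [measurable_cong] = \<nu>.events_eq_borel
  have [measurable]: "q \<in> borel_measurable borel" "G \<in> borel_measurable borel" "g' \<in> borel_measurable borel"
    using qD(1) borel_measurable_mono[OF G(1)] g'(3) by auto
  define I where "I = (\<integral>v. \<bar>g' v\<bar> \<partial>lborel)"
  have I0: "0 \<le> I" by (simp add: I_def)
  \<comment> \<open>A bound for the variation of \<open>g\<close> on the window of radius
    \<open>r\<close> about \<open>t\<close>, written as a joint condition on \<open>v\<close> and
    \<open>t\<close> so that the integrals can be interchanged.\<close>
  define W where "W = (\<lambda>r t. \<integral>\<^sup>+v. ennreal \<bar>g' v\<bar> * (if \<bar>v - t\<bar> \<le> r then 1 else 0) \<partial>lborel)"
  have var: "ennreal \<bar>g a - g c\<bar> \<le> W r t" if ac: "c \<le> a" "\<bar>a - t\<bar> \<le> r" "\<bar>c - t\<bar> \<le> r" for a c t r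
  proof -
    have ii: "integrable lborel (\<lambda>v. g' v * indicator {c..a} v)"
      using g'(3) by (rule integrable_mult_indicator[of "{c..a}" lborel g', simplified real_scaleR_def mult.commute[of "indicator _ _"], rotated]) simp
    have "g a - g c = (\<integral>v. g' v * indicator {c..a} v \<partial>lborel)"
      by (rule integral_FTC_Icc_real[symmetric]) (use ac g' in auto)
    hence "ennreal \<bar>g a - g c\<bar> \<le> (\<integral>\<^sup>+v. ennreal (norm (g' v * indicator {c..a} v)) \<partial>lborel)"
      using integral_norm_bound_ennreal[OF ii] by simp
    also have "\<dots> \<le> W r t"
      unfolding W_def using ac by (intro nn_integral_mono) (auto split: split_indicator)
    finally show ?thesis .
  qed
  have taylor: "ennreal \<bar>G (t - k) - G t + k * g t\<bar> \<le> ennreal \<bar>k\<bar> * W \<bar>k\<bar> t" for t k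
  proof -
    obtain \<xi> where \<xi>: "\<bar>\<xi> - t\<bar> \<le> \<bar>k\<bar>" "G (t - k) - G t = - k * g \<xi>"
    proof (cases k "0 :: real" rule: linorder_cases)
      case less
      from MVT2[of t "t - k" G g] g less obtain z where "t < z" "z < t - k" "G (t - k) - G t = (t - k - t) * g z" by auto
      thus ?thesis using that[of z] less by auto
    next
      case greater
      from MVT2[of "t - k" t G g] g greater obtain z where "t - k < z" "z < t" "G t - G (t - k) = (t - (t - k)) * g z" by auto
      thus ?thesis using that[of z] greater by auto
    qed (use that[of t] in auto)
    have "ennreal \<bar>g t - g \<xi>\<bar> \<le> W \<bar>k\<bar> t"
      using var[of \<xi> t t "\<bar>k\<bar>"] var[of t \<xi> t "\<bar>k\<bar>"] \<xi>(1) by (cases "\<xi> \<le> t") (auto simp: abs_minus_commute)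
    moreover have "G (t - k) - G t + k * g t = k * (g t - g \<xi>)" using \<xi>(2) by (simp add: algebra_simps)
    ultimately show ?thesis by (simp add: abs_mult ennreal_mult mult_left_mono)
  qed
  have Gd: "\<bar>G u - G v\<bar> \<le> 1" for u v
    using G(2)[of u] G(3)[of u] G(2)[of v] G(3)[of v] by linarith
  have bias: "ennreal \<bar>smooth_bias q h G t\<bar> \<le> (\<integral>\<^sup>+y. ennreal (q y * (h * \<bar>y\<bar>)) * W (h * \<bar>y\<bar>) t \<partial>lborel)" for t
  proof -
    have i1: "integrable lborel (\<lambda>y. q y * (G (t - h * y) - G t))"
      by (rule integrable_kernel_mult[OF q, of _ 1]) (use Gd in auto)
    have i2: "integrable lborel (\<lambda>y. h * g t * (y * q y))" using qD(10) by simp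
    have "smooth_bias q h G t = (\<integral>y. q y * (G (t - h * y) - G t) + h * g t * (y * q y) \<partial>lborel)"
      unfolding smooth_bias_def by (subst Bochner_Integration.integral_add[OF i1 i2]) (simp add: qD(11))
    also have "\<dots> = (\<integral>y. q y * (G (t - h * y) - G t + h * y * g t) \<partial>lborel)"
      by (intro Bochner_Integration.integral_cong) (auto simp: algebra_simps)
    finally have eq: "smooth_bias q h G t = \<dots>" .
    have "integrable lborel (\<lambda>y. q y * (G (t - h * y) - G t + h * y * g t))"
      using Bochner_Integration.integrable_add[OF i1 i2] by (simp add: algebra_simps)
    from integral_norm_bound_ennreal[OF this]
    have "ennreal \<bar>smooth_bias q h G t\<bar> \<le> (\<integral>\<^sup>+y. ennreal \<bar>q y * (G (t - h * y) - G t + h * y * g t)\<bar> \<partial>lborel)"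
      by (simp add: eq)
    also have "\<dots> \<le> (\<integral>\<^sup>+y. ennreal (q y * (h * \<bar>y\<bar>)) * W (h * \<bar>y\<bar>) t \<partial>lborel)"
    proof (rule nn_integral_mono)
      fix y
      have "ennreal \<bar>q y * (G (t - h * y) - G t + h * y * g t)\<bar> = ennreal (q y) * ennreal \<bar>G (t - h * y) - G t + h * y * g t\<bar>"
        using qD(2)[of y] by (simp add: abs_mult ennreal_mult)
      also have "\<dots> \<le> ennreal (q y) * (ennreal \<bar>h * y\<bar> * W \<bar>h * y\<bar> t)"
        by (intro mult_left_mono taylor) auto
      also have "\<dots> = ennreal (q y * (h * \<bar>y\<bar>)) * W (h * \<bar>y\<bar>) t"
        using qD(2)[of y] h by (simp add: abs_mult ennreal_mult mult.assoc)
      finally show "ennreal \<bar>q y * (G (t - h * y) - G t + h * y * g t)\<bar> \<le> \<dots>" .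
    qed
    finally show ?thesis .
  qed
  \<comment> \<open>For fixed \<open>v\<close> the condition confines \<open>x\<close> to an
    interval of length \<open>2 * r\<close> about \<open>\<sigma> * (v - s)\<close>, since
    \<open>\<sigma>\<close> is its own inverse. The interval is closed; enlarging it slightly on the
    left makes it a c.d.f. difference.\<close>
  have band: "(\<integral>\<^sup>+x. (if \<bar>v - (s + \<sigma> * x)\<bar> \<le> r then 1 else 0) \<partial>\<nu>) \<le> ennreal (2 * L * r)" if r: "0 \<le> r" for v r
  proof -
    define c where "c = \<sigma> * (v - s)"
    have iff: "\<bar>v - (s + \<sigma> * x)\<bar> \<le> r \<longleftrightarrow> x \<in> {c - r..c + r}" for x using \<sigma> by (auto simp: c_def)
    have "(\<integral>\<^sup>+x. (if \<bar>v - (s + \<sigma> * x)\<bar> \<le> r then 1 else 0) \<partial>\<nu>) = (\<integral>\<^sup>+x. indicator {c - r..c + r} x \<partial>\<nu>)"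
      unfolding iff by (intro nn_integral_cong) (auto split: split_indicator)
    also have "\<dots> = ennreal (measure \<nu> {c - r..c + r})" by (simp add: \<nu>.emeasure_eq_measure)
    also have "measure \<nu> {c - r..c + r} \<le> 2 * L * r"
    proof (rule field_le_epsilon)
      fix e :: real assume e: "0 < e"
      define \<eta> where "\<eta> = e / (L + 1)"
      have \<eta>: "0 < \<eta>" "L * \<eta> \<le> e" using e L(1) by (auto simp: \<eta>_def field_simps)
      have "measure \<nu> {c - r..c + r} \<le> measure \<nu> {c - r - \<eta><..c + r}"
        using \<eta>(1) by (intro \<nu>.finite_measure_mono) auto
      also have "\<dots> = cdf \<nu> (c + r) - cdf \<nu> (c - r - \<eta>)"
        using \<eta>(1) r by (intro \<nu>.cdf_diff_eq[symmetric]) auto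
      also have "\<dots> \<le> L * (2 * r + \<eta>)" using L(2)[of "c + r" "c - r - \<eta>"] \<eta>(1) r by auto
      also have "\<dots> \<le> 2 * L * r + e" using \<eta>(2) by (simp add: algebra_simps)
      finally show "measure \<nu> {c - r..c + r} \<le> 2 * L * r + e" .
    qed
    finally show ?thesis by (simp add: ennreal_leI)
  qed
  have "(\<integral>\<^sup>+x. ennreal \<bar>smooth_bias q h G (s + \<sigma> * x)\<bar> \<partial>\<nu>)
      \<le> (\<integral>\<^sup>+x. (\<integral>\<^sup>+y. ennreal (q y * (h * \<bar>y\<bar>)) * W (h * \<bar>y\<bar>) (s + \<sigma> * x) \<partial>lborel) \<partial>\<nu>)"
    by (intro nn_integral_mono bias)
  also have "\<dots> = (\<integral>\<^sup>+y. (\<integral>\<^sup>+x. ennreal (q y * (h * \<bar>y\<bar>)) * W (h * \<bar>y\<bar>) (s + \<sigma> * x) \<partial>\<nu>) \<partial>lborel)"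
    unfolding W_def by (rule \<nu>L.Fubini'[symmetric]) measurable
  also have "\<dots> = (\<integral>\<^sup>+y. ennreal (q y * (h * \<bar>y\<bar>)) * (\<integral>\<^sup>+x. W (h * \<bar>y\<bar>) (s + \<sigma> * x) \<partial>\<nu>) \<partial>lborel)"
    unfolding W_def by (intro nn_integral_cong nn_integral_cmult) measurable
  also have "\<dots> \<le> (\<integral>\<^sup>+y. ennreal (q y * (h * \<bar>y\<bar>)) * ennreal (I * (2 * L * (h * \<bar>y\<bar>))) \<partial>lborel)"
  proof (intro nn_integral_mono mult_left_mono)
    fix y :: real
    define r where "r = h * \<bar>y\<bar>"
    have r: "0 \<le> r" using h by (simp add: r_def)
    have "(\<integral>\<^sup>+x. W r (s + \<sigma> * x) \<partial>\<nu>) = (\<integral>\<^sup>+v. (\<integral>\<^sup>+x. ennreal \<bar>g' v\<bar> * (if \<bar>v - (s + \<sigma> * x)\<bar> \<le> r then 1 else 0) \<partial>\<nu>) \<partial>lborel)"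
      unfolding W_def by (rule \<nu>L.Fubini'[symmetric]) measurable
    also have "\<dots> = (\<integral>\<^sup>+v. ennreal \<bar>g' v\<bar> * (\<integral>\<^sup>+x. (if \<bar>v - (s + \<sigma> * x)\<bar> \<le> r then 1 else 0) \<partial>\<nu>) \<partial>lborel)"
      by (intro nn_integral_cong nn_integral_cmult) measurable
    also have "\<dots> \<le> (\<integral>\<^sup>+v. ennreal \<bar>g' v\<bar> * ennreal (2 * L * r) \<partial>lborel)"
      by (intro nn_integral_mono mult_left_mono band r) auto
    also have "\<dots> = (\<integral>\<^sup>+v. ennreal \<bar>g' v\<bar> \<partial>lborel) * ennreal (2 * L * r)"
      by (rule nn_integral_multc) measurable
    also have "(\<integral>\<^sup>+v. ennreal \<bar>g' v\<bar> \<partial>lborel) = ennreal I"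
      unfolding I_def using g'(3) by (intro nn_integral_eq_integral) auto
    also have "ennreal I * ennreal (2 * L * r) = ennreal (I * (2 * L * r))"
      using I0 L(1) r by (intro ennreal_mult[symmetric]) auto
    finally show "(\<integral>\<^sup>+x. W (h * \<bar>y\<bar>) (s + \<sigma> * x) \<partial>\<nu>) \<le> ennreal (I * (2 * L * (h * \<bar>y\<bar>)))"
      by (simp add: r_def)
  qed auto
  \<comment> \<open>One factor \<open>h * \<bar>y\<bar>\<close> comes from the Taylor remainder and
    one from the window width; together they give the second moment of the kernel, which is
    1.\<close>
  also have "\<dots> = (\<integral>\<^sup>+y. ennreal (2 * L * h\<^sup>2 * I * (y\<^sup>2 * q y)) \<partial>lborel)"
  proof (rule nn_integral_cong)
    fix y
    have "q y * (h * \<bar>y\<bar>) * (I * (2 * L * (h * \<bar>y\<bar>))) = 2 * L * h\<^sup>2 * I * (\<bar>y\<bar>\<^sup>2 * q y)"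
      by (simp only: power2_eq_square mult_ac)
    thus "ennreal (q y * (h * \<bar>y\<bar>)) * ennreal (I * (2 * L * (h * \<bar>y\<bar>))) = ennreal (2 * L * h\<^sup>2 * I * (y\<^sup>2 * q y))"
      using qD(2)[of y] h I0 L(1) by (subst ennreal_mult[symmetric]) auto
  qed
  also have "\<dots> = ennreal (\<integral>y. 2 * L * h\<^sup>2 * I * (y\<^sup>2 * q y) \<partial>lborel)"
    using qD(2,6) h I0 L(1) by (intro nn_integral_eq_integral) auto
  also have "\<dots> = ennreal (2 * L * h\<^sup>2 * I)" by (simp add: qD(7))
  finally show ?thesis by (simp add: I_def)
qed

section \<open>Uniform convergence of the empirical distribution function\<close>

lemma (in prob_space) ecdf_Hoeffding:
  assumes X: "indep_vars (\<lambda>_. borel) X {1..}"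
    and G: "\<And>i. i \<ge> 1 \<Longrightarrow> cdf (distr M borel (X i)) x = G"
    and n: "n \<ge> 1" and \<epsilon>: "\<epsilon> \<ge> 0"
  shows "prob {\<omega>\<in>space M. \<bar>ecdf (\<lambda>i. X i \<omega>) n x - G\<bar> \<ge> \<epsilon>} \<le> 2 * exp (- 2 * real n * \<epsilon>\<^sup>2)"
proof -
  have rv[measurable]: "random_variable borel (X i)" if "i \<ge> 1" for i
    using X that by (auto simp: indep_vars_def)
  define Y where "Y = (\<lambda>i \<omega>. indicator {..x} (X i \<omega>) :: real)"
  have E: "expectation (Y i) = G" if "i \<in> {1..n}" for i
  proof -
    have i: "i \<ge> 1" using that by simp
    have "G = prob (X i -` {..x} \<inter> space M)"
      using G[OF i] rv[OF i] by (simp add: cdf_def measure_distr)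
    also have "\<dots> = expectation (indicator (X i -` {..x} \<inter> space M))"
      by simp
    also have "\<dots> = expectation (Y i)"
      by (intro Bochner_Integration.integral_cong) (auto simp: Y_def split: split_indicator)
    finally show ?thesis ..
  qed
  interpret Hoeffding_ineq M "{1..n}" Y "\<lambda>_. 0" "\<lambda>_. 1" "\<Sum>i\<in>{1..n}. expectation (Y i)"
  proof unfold_locales
    have "indep_vars (\<lambda>_. borel) X {1..n}" by (rule indep_vars_subset[OF X]) auto
    thus "indep_vars (\<lambda>_. borel) Y {1..n}"
      unfolding Y_def by (rule indep_vars_compose2) auto
  qed (auto simp: Y_def split: split_indicator)
  have "{\<omega>\<in>space M. \<bar>ecdf (\<lambda>i. X i \<omega>) n x - G\<bar> \<ge> \<epsilon>}
     = {\<omega>\<in>space M. \<bar>(\<Sum>i\<in>{1..n}. Y i \<omega>) - (\<Sum>i\<in>{1..n}. expectation (Y i))\<bar> \<ge> real n * \<epsilon>}"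
  proof (intro Collect_cong conj_cong refl)
    fix \<omega>
    have "(\<Sum>i\<in>{1..n}. Y i \<omega>) - (\<Sum>i\<in>{1..n}. expectation (Y i)) = real n * (ecdf (\<lambda>i. X i \<omega>) n x - G)"
      using n E by (simp add: ecdf_def Y_def right_diff_distrib)
    hence "\<bar>(\<Sum>i\<in>{1..n}. Y i \<omega>) - (\<Sum>i\<in>{1..n}. expectation (Y i))\<bar> = real n * \<bar>ecdf (\<lambda>i. X i \<omega>) n x - G\<bar>"
      by (simp add: abs_mult)
    thus "(\<epsilon> \<le> \<bar>ecdf (\<lambda>i. X i \<omega>) n x - G\<bar>) = (real n * \<epsilon> \<le> \<bar>(\<Sum>i\<in>{1..n}. Y i \<omega>) - (\<Sum>i\<in>{1..n}. expectation (Y i))\<bar>)"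
      using n by simp
  qed
  moreover have "- 2 * (real n * \<epsilon>)\<^sup>2 / (\<Sum>i\<in>{1..n}. (1 - 0)\<^sup>2) = - 2 * real n * \<epsilon>\<^sup>2"
    using n by (simp add: power2_eq_square)
  ultimately show ?thesis
    using Hoeffding_ineq_abs_ge[of "real n * \<epsilon>"] n \<epsilon> by simp
qed

text \<open>Between neighbouring grid points \<open>G\<close> varies by at most
  \<open>1 / m\<close>, and monotonicity traps \<open>\<Gamma>\<close> there; before the first and
  after the last grid point the bounds 0 and 1 take over.\<close>

lemma monotone_uniform_from_grid:
  fixes G \<Gamma> :: "real \<Rightarrow> real"
  assumes G: "strict_mono G" "\<And>x. 0 < G x" "\<And>x. G x < 1"
    and \<Gamma>: "mono \<Gamma>" "\<And>x. 0 \<le> \<Gamma> x" "\<And>x. \<Gamma> x \<le> 1"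
    and m: "m \<ge> 1" and xs: "\<And>j. j \<in> {1..<m} \<Longrightarrow> G (xs j) = real j / real m"
    and \<epsilon>: "0 \<le> \<epsilon>" "\<And>j. j \<in> {1..<m} \<Longrightarrow> \<bar>\<Gamma> (xs j) - G (xs j)\<bar> \<le> \<epsilon>"
  shows "\<bar>\<Gamma> x - G x\<bar> \<le> \<epsilon> + 1 / real m"
proof -
  define j where "j = nat \<lfloor>real m * G x\<rfloor>"
  have "0 \<le> real m * G x" using G(2)[of x] by (simp add: less_imp_le)
  hence j: "real j \<le> real m * G x" "real m * G x < real j + 1"
    unfolding j_def by linarith+
  have jm: "j < m"
  proof -
    have "real m * G x < real m * 1" using G(3)[of x] m by (intro mult_strict_left_mono) auto
    thus ?thesis using j(1) by simp
  qed
  have m0: "0 < real m" using m by simp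
  have jG: "real j / real m \<le> G x" "G x < (real j + 1) / real m"
    using j m0 by (simp_all add: pos_divide_le_eq pos_less_divide_eq mult.commute)
  have low: "G x - \<epsilon> - 1 / real m \<le> \<Gamma> x"
  proof (cases "j = 0")
    case True
    thus ?thesis using jG(2) \<epsilon>(1) \<Gamma>(2)[of x] by simp
  next
    case False
    hence ji: "j \<in> {1..<m}" using jm by simp
    have "xs j \<le> x" using jG(1) xs[OF ji] G(1) by (metis strict_mono_less_eq)
    hence "\<Gamma> (xs j) \<le> \<Gamma> x" by (rule monoD[OF \<Gamma>(1)])
    thus ?thesis using \<epsilon>(2)[OF ji] xs[OF ji] jG(2) by (simp add: add_divide_distrib)
  qed
  have up: "\<Gamma> x \<le> G x + \<epsilon> + 1 / real m"
  proof (cases "j + 1 < m")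
    case True
    hence ji: "j + 1 \<in> {1..<m}" by simp
    have "x \<le> xs (j + 1)" using jG(2) xs[OF ji] G(1)
      by (metis less_imp_le of_nat_1 of_nat_add strict_mono_less_eq)
    hence "\<Gamma> x \<le> \<Gamma> (xs (j + 1))" by (rule monoD[OF \<Gamma>(1)])
    thus ?thesis using \<epsilon>(2)[OF ji] xs[OF ji] jG(1) by (simp add: add_divide_distrib)
  next
    case False
    hence "real j + 1 = real m" using jm by linarith
    hence "(real j + 1) / real m = 1" using m0 by simp
    thus ?thesis using jG(1) \<epsilon>(1) \<Gamma>(3)[of x] by (simp add: add_divide_distrib)
  qed
  show ?thesis using low up by linarith
qed

text \<open>At width \<open>n powr (\<alpha> - 1/2)\<close> Hoeffding's bound has exponent
  \<open>- 2 * n powr (2 * \<alpha>)\<close>, so a union over \<open>n - 1\<close> quantiles stays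
  summable for every positive \<open>\<alpha>\<close>. With \<open>n\<close> cells the interpolation
  error \<open>1 / n\<close> is at most the same width, hence the factor 2.\<close>

lemma (in prob_space) ecdf_uniform_rate:
  assumes X: "indep_vars (\<lambda>_. borel) X {1..}"
    and P: "real_distribution P" "strict_mono (cdf P)" "\<And>x. isCont (cdf P) x"
    and X_cdf: "\<And>i x. i \<ge> 1 \<Longrightarrow> cdf (distr M borel (X i)) x = cdf P x"
    and \<alpha>: "\<alpha> > 0"
  shows "AE \<omega> in M. \<forall>\<^sub>F n in sequentially. \<forall>x. \<bar>ecdf (\<lambda>i. X i \<omega>) n x - cdf P x\<bar> \<le> 2 * real n powr (\<alpha> - 1/2)"
proof -
  interpret P: real_distribution P by fact
  have rv[measurable]: "random_variable borel (X i)" if "i \<ge> 1" for i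
    using X that by (auto simp: indep_vars_def)
  define G where "G = cdf P"
  have G: "0 < G x" "G x < 1" for x
    using P.cdf_nonneg[of "x - 1"] P.cdf_bounded_prob[of "x + 1"] P(2)[THEN strict_monoD, of "x - 1" x]
      P(2)[THEN strict_monoD, of x "x + 1"] by (auto simp: G_def)
  have surj: "\<exists>x. G x = p" if "0 < p" "p < 1" for p
  proof -
    have "\<forall>\<^sub>F x in at_bot. G x < p" "\<forall>\<^sub>F x in at_top. p < G x"
      unfolding G_def using order_tendstoD(2)[OF P.cdf_lim_at_bot, of p] order_tendstoD(1)[OF P.cdf_lim_at_top_prob, of p] that
      by auto
    then obtain a c where ac: "\<And>x. x \<le> a \<Longrightarrow> G x < p" "\<And>x. c \<le> x \<Longrightarrow> p < G x"
      unfolding eventually_at_bot_linorder eventually_at_top_linorder by blast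
    have "\<exists>x\<ge>min a c. x \<le> c \<and> G x = p"
      using ac[of "min a c"] ac(2)[of c] P(3) by (intro IVT) (auto simp: G_def less_imp_le)
    thus ?thesis by blast
  qed
  define xs where "xs = (\<lambda>n j :: nat. SOME x. G x = real j / real n)"
  have xs: "G (xs n j) = real j / real n" if "j \<in> {1..<n}" for j n :: nat
    unfolding xs_def by (rule someI_ex, rule surj) (use that in auto)
  define \<epsilon> where "\<epsilon> = (\<lambda>n. real n powr (\<alpha> - 1/2))"
  define A where "A = (\<lambda>n. {\<omega>\<in>space M. \<exists>j\<in>{1..<n}. \<bar>ecdf (\<lambda>i. X i \<omega>) n (xs n j) - G (xs n j)\<bar> \<ge> \<epsilon> n})"
  have m: "{\<omega>\<in>space M. \<bar>ecdf (\<lambda>i. X i \<omega>) n x - G x\<bar> \<ge> e} \<in> events" for n x e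
    unfolding ecdf_def by measurable
  have A_eq: "A n = (\<Union>j\<in>{1..<n}. {\<omega>\<in>space M. \<bar>ecdf (\<lambda>i. X i \<omega>) n (xs n j) - G (xs n j)\<bar> \<ge> \<epsilon> n})" for n
    by (auto simp: A_def)
  have Am: "A n \<in> events" for n unfolding A_eq by (intro sets.finite_UN m) auto
  have bound: "prob (A n) \<le> 2 * real n * exp (- 2 * real n powr (2 * \<alpha>))" if n: "n \<ge> 1" for n
  proof -
    have "prob (A n) \<le> (\<Sum>j\<in>{1..<n}. prob {\<omega>\<in>space M. \<bar>ecdf (\<lambda>i. X i \<omega>) n (xs n j) - G (xs n j)\<bar> \<ge> \<epsilon> n})"
      unfolding A_eq by (intro finite_measure_subadditive_finite) (use m in auto)
    also have "\<dots> \<le> (\<Sum>j\<in>{1..<n}. 2 * exp (- 2 * real n * (\<epsilon> n)\<^sup>2))"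
      by (intro sum_mono ecdf_Hoeffding[OF X _ n]) (auto simp: X_cdf G_def \<epsilon>_def)
    also have "\<dots> \<le> real n * (2 * exp (- 2 * real n * (\<epsilon> n)\<^sup>2))"
      by (simp add: mult_right_mono)
    also have "real n * (\<epsilon> n)\<^sup>2 = real n powr (2 * \<alpha>)"
    proof -
      have "real n * (\<epsilon> n)\<^sup>2 = real n powr 1 * (real n powr (\<alpha> - 1/2) * real n powr (\<alpha> - 1/2))"
        using n by (simp add: \<epsilon>_def power2_eq_square)
      also have "\<dots> = real n powr (2 * \<alpha>)" unfolding powr_add[symmetric] by simp
      finally show ?thesis .
    qed
    hence "- 2 * real n * (\<epsilon> n)\<^sup>2 = - 2 * real n powr (2 * \<alpha>)" by simp
    finally show ?thesis by (simp add: mult_ac)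
  qed
  have "\<forall>\<^sub>F n in sequentially. 2 * real n * exp (- 2 * real n powr (2 * \<alpha>)) \<le> 1 / real n ^ 2"
    using \<alpha> by real_asymp
  hence "\<forall>\<^sub>F n in sequentially. norm (prob (A n)) \<le> inverse (real n ^ 2)"
    using eventually_ge_at_top[of 1]
  proof eventually_elim
    case (elim n)
    thus ?case using bound[of n] by (simp add: inverse_eq_divide)
  qed
  hence sm: "summable (\<lambda>n. prob (A n))"
    by (rule summable_comparison_test_ev) (rule inverse_power_summable, simp)
  have "AE \<omega> in M. \<forall>\<^sub>F n in sequentially. \<omega> \<in> space M - A n"
    by (rule borel_cantelli_AE1[OF Am _ sm]) (simp add: emeasure_eq_measure)
  thus ?thesis
  proof eventually_elim
    case (elim \<omega>)
    thus ?case using eventually_ge_at_top[of 1]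
    proof eventually_elim
      case (elim n)
      have n: "real n \<ge> 1" using elim(2) by simp
      show ?case
      proof
        fix x
        have ge: "mono (ecdf (\<lambda>i. X i \<omega>) n)" "\<And>t. 0 \<le> ecdf (\<lambda>i. X i \<omega>) n t" "\<And>t. ecdf (\<lambda>i. X i \<omega>) n t \<le> 1"
          using ecdf_bounds[OF elim(2)] by blast+
        have "\<bar>ecdf (\<lambda>i. X i \<omega>) n x - G x\<bar> \<le> \<epsilon> n + 1 / real n"
          by (rule monotone_uniform_from_grid[OF _ G ge elim(2) xs])
             (use P(2) elim(1) in \<open>auto simp: G_def A_def \<epsilon>_def not_le intro: less_imp_le\<close>)
        also have "1 / real n = real n powr (- 1)" using n by (simp add: powr_minus_divide)
        also have "\<dots> \<le> \<epsilon> n" unfolding \<epsilon>_def using n \<alpha> by (intro powr_mono) auto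
        finally show "\<bar>ecdf (\<lambda>i. X i \<omega>) n x - cdf P x\<bar> \<le> 2 * real n powr (\<alpha> - 1/2)"
          by (simp add: G_def \<epsilon>_def)
      qed
    qed
  qed
qed

section \<open>Consistency and rate\<close>

lemma smooth_bias_measurable [measurable]:
  assumes "smoothing_kernel q" "mono G"
  shows "smooth_bias q h G \<in> borel_measurable borel"
proof -
  note [measurable] = smoothing_kernelD(1)[OF assms(1)] borel_measurable_mono[OF assms(2)]
  show ?thesis unfolding smooth_bias_def by measurable
qed

context symmetric_mixture
begin

text \<open>Replacing the empirical measure by \<open>PG\<close> costs
  \<open>4 * C * \<Delta>\<close>, and then replacing the smoothed c.d.f. by \<open>G\<close> costs
  \<open>2 * C * (\<Delta> + e)\<close>; this is the origin of the 6. The sign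
  \<open>\<sigma> = - 1\<close> covers the reflected terms of the residual,
  \<open>\<sigma> = 1\<close> the direct one.\<close>

lemma contrast_deviation:
  assumes q: "smoothing_kernel q" and n: "n \<ge> 1" "b n > 0"
    and \<Delta>: "\<And>t. \<bar>ecdf x n t - G t\<bar> \<le> \<Delta>" and e: "0 \<le> e"
    and bias: "\<And>s \<sigma>. \<sigma> = 1 \<or> \<sigma> = - 1 \<Longrightarrow>
      (\<integral>\<^sup>+t. ennreal \<bar>smooth_bias q (b n) G (s + \<sigma> * t)\<bar> \<partial>PG) \<le> ennreal e"
    and l: "0 \<le> l" "l \<le> 1/2 - d"
  shows "\<bar>contrast q b x n (l, m1, m2) - K l m1 m2\<bar> \<le> 6 * (1 + 1 / (2 * d))\<^sup>2 * (\<Delta> + e)"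
proof -
  define C where "C = (1 + 1 / (2 * d))\<^sup>2"
  have C: "0 \<le> C" by (simp add: C_def)
  have \<Delta>0: "0 \<le> \<Delta>" using \<Delta>[of 0] by linarith
  define Gs where "Gs = smooth_ecdf q b x n"
  have Gs: "mono Gs" "\<And>x. 0 \<le> Gs x" "\<And>x. Gs x \<le> 1"
    unfolding Gs_def using smooth_ecdf_bounds[of q n b x, OF q n] by auto
  note [measurable] = smooth_bias_measurable[OF q mono_G]
  note [measurable_cong] = PG.events_eq_borel
  have le: "(\<integral>\<^sup>+t. ennreal \<bar>Gs (s + \<sigma> * t) - G (s + \<sigma> * t)\<bar> \<partial>PG) \<le> ennreal (\<Delta> + e)"
    if \<sigma>: "\<sigma> = 1 \<or> \<sigma> = - 1" for s \<sigma>
  proof -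
    have "(\<integral>\<^sup>+t. ennreal \<bar>Gs (s + \<sigma> * t) - G (s + \<sigma> * t)\<bar> \<partial>PG)
        \<le> (\<integral>\<^sup>+t. ennreal \<Delta> + ennreal \<bar>smooth_bias q (b n) G (s + \<sigma> * t)\<bar> \<partial>PG)"
    proof (rule nn_integral_mono)
      fix t
      have "\<bar>Gs (s + \<sigma> * t) - G (s + \<sigma> * t)\<bar> \<le> \<Delta> + \<bar>smooth_bias q (b n) G (s + \<sigma> * t)\<bar>"
        unfolding Gs_def by (rule smooth_ecdf_diff_le[where b = b and n = n, OF q n mono_G G_01 \<Delta>])
      thus "ennreal \<bar>Gs (s + \<sigma> * t) - G (s + \<sigma> * t)\<bar> \<le> ennreal \<Delta> + ennreal \<bar>smooth_bias q (b n) G (s + \<sigma> * t)\<bar>"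
        using \<Delta>0 by (simp add: ennreal_plus[symmetric] ennreal_leI del: ennreal_plus)
    qed
    also have "\<dots> = ennreal \<Delta> + (\<integral>\<^sup>+t. ennreal \<bar>smooth_bias q (b n) G (s + \<sigma> * t)\<bar> \<partial>PG)"
      using PG.emeasure_space_1 by (subst nn_integral_add) auto
    also have "\<dots> \<le> ennreal \<Delta> + ennreal e" by (intro add_left_mono bias \<sigma>)
    finally show ?thesis using \<Delta>0 e by simp
  qed
  have "contrast q b x n (l, m1, m2) = (\<integral>t. (residual (l, m1, m2) Gs t)\<^sup>2 \<partial>interval_measure (ecdf x n))"
    by (simp add: contrast_def model_cdf_def residual_def Gs_def)
  moreover have "\<bar>(\<integral>t. (residual (l, m1, m2) Gs t)\<^sup>2 \<partial>interval_measure (ecdf x n)) - (\<integral>t. (residual (l, m1, m2) Gs t)\<^sup>2 \<partial>PG)\<bar>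
      \<le> 4 * (1 + 1 / (2 * d))\<^sup>2 * \<Delta>"
    by (rule integral_residual_sq_measure_diff[OF l d Gs ecdf_distribution(1)[OF n(1)] PG])
       (use \<Delta> in \<open>simp add: ecdf_distribution(2)[OF n(1)]\<close>)
  moreover have "\<bar>(\<integral>t. (residual (l, m1, m2) Gs t)\<^sup>2 \<partial>PG) - (\<integral>t. (residual (l, m1, m2) G t)\<^sup>2 \<partial>PG)\<bar>
      \<le> 2 * (1 + 1 / (2 * d))\<^sup>2 * (\<Delta> + e)"
    by (rule integral_residual_sq_diff[OF l d Gs mono_G G_01 PG])
       (use \<Delta>0 e le[of "- 1"] le[of 1 0] in auto)
  moreover have "4 * C * \<Delta> \<le> 4 * C * (\<Delta> + e)" using C e by (intro mult_left_mono) auto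
  ultimately show ?thesis unfolding K_def C_def by linarith
qed

text \<open>A subsequence staying away from the true parameter would, by compactness, have a limit
  point in the parameter space; \<open>K\<close> vanishes there by continuity, against
  identifiability. Disjointness of \<open>S\<close> from the diagonal keeps the limit locations
  distinct.\<close>

lemma params_tendsto:
  assumes S: "compact S" "S \<inter> {(x, x) | x. True} = {}"
    and \<theta>: "\<And>k. \<theta> k \<in> param_space d S"
    and K: "(\<lambda>k. (case \<theta> k of (l, m1, m2) \<Rightarrow> K l m1 m2)) \<longlonglongrightarrow> 0"
  shows "\<theta> \<longlonglongrightarrow> (l0, n1, n2)"
proof (rule ccontr)
  assume "\<not> \<theta> \<longlonglongrightarrow> (l0, n1, n2)"
  then obtain e where e: "e > 0" "\<forall>N. \<exists>k\<ge>N. e \<le> dist (\<theta> k) (l0, n1, n2)"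
    unfolding lim_sequentially by (auto simp: not_less)
  define A where "A = {k. e \<le> dist (\<theta> k) (l0, n1, n2)}"
  have inf: "infinite A" using e(2) by (auto simp: A_def infinite_nat_iff_unbounded_le)
  define r where "r = enumerate A"
  have r: "strict_mono r" "\<And>k. e \<le> dist (\<theta> (r k)) (l0, n1, n2)"
    using strict_mono_enumerate[OF inf] enumerate_in_set[OF inf] by (auto simp: r_def A_def)
  have "compact (param_space d S)" unfolding param_space_def by (intro compact_Times S compact_Icc)
  moreover have "\<forall>k. (\<theta> \<circ> r) k \<in> param_space d S" using \<theta> by simp
  ultimately obtain \<theta>' r' where r': "\<theta>' \<in> param_space d S" "strict_mono r'" "((\<theta> \<circ> r) \<circ> r') \<longlonglongrightarrow> \<theta>'"
    unfolding compact_def by metis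
  obtain l m1 m2 where \<theta>': "\<theta>' = (l, m1, m2)" by (cases \<theta>') auto
  define s where "s = r \<circ> r'"
  have s: "strict_mono s" unfolding s_def using r(1) r'(2) by (rule strict_mono_o)
  have lim: "(\<lambda>k. \<theta> (s k)) \<longlonglongrightarrow> (l, m1, m2)" using r'(3) by (simp add: s_def o_def \<theta>')
  have in\<Theta>: "0 \<le> fst (\<theta> k)" "fst (\<theta> k) \<le> 1/2 - d" for k
    using \<theta>[of k] by (auto simp: param_space_def)
  have "(\<lambda>k. K (fst (\<theta> (s k))) (fst (snd (\<theta> (s k)))) (snd (snd (\<theta> (s k))))) \<longlonglongrightarrow> K l m1 m2"
    using tendsto_fst[OF lim] tendsto_fst[OF tendsto_snd[OF lim]] tendsto_snd[OF tendsto_snd[OF lim]] in\<Theta>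
    by (intro K_tendsto) auto
  moreover have "(\<lambda>k. K (fst (\<theta> (s k))) (fst (snd (\<theta> (s k)))) (snd (snd (\<theta> (s k))))) \<longlonglongrightarrow> 0"
    using LIMSEQ_subseq_LIMSEQ[OF K s] by (simp add: o_def case_prod_beta)
  ultimately have "K l m1 m2 = 0" by (rule LIMSEQ_unique)
  moreover have "0 \<le> l" "l \<le> 1/2 - d" "m1 \<noteq> m2"
    using r'(1) S(2) by (auto simp: \<theta>' param_space_def)
  ultimately have "(l, m1, m2) = (l0, n1, n2)" using K_zero_imp_params by metis
  hence "(\<lambda>k. dist (\<theta> (s k)) (l0, n1, n2)) \<longlonglongrightarrow> 0" using lim tendsto_dist_iff by metis
  hence "e \<le> 0" using r(2) by (intro LIMSEQ_le_const[of _ 0 e]) (auto simp: s_def)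
  with e(1) show False by simp
qed

text \<open>Minimality compares the contrast at the estimator with that at the true parameter, where
  \<open>K\<close> is 0, so \<open>K\<close> at the estimator is at most two deviations; 6 becomes
  12. The second conclusion leaves the bias bound \<open>e\<close> open: order \<open>b n\<close>
  yields consistency, a sharper choice yields the rate.\<close>

lemma estimator_tendsto:
  assumes q: "smoothing_kernel q" and b: "\<And>n. n \<ge> 1 \<Longrightarrow> b n > 0" "b \<longlonglongrightarrow> 0"
    and S: "compact S" "S \<inter> {(x, x) | x. True} = {}" and \<theta>0: "(l0, n1, n2) \<in> param_space d S"
    and \<theta>: "\<And>n. n \<ge> 1 \<Longrightarrow> is_arg_min (contrast q b x n) (\<lambda>\<theta>. \<theta> \<in> param_space d S) (\<theta> n)"
    and \<Delta>: "\<forall>\<^sub>F n in sequentially. \<forall>t. \<bar>ecdf x n t - G t\<bar> \<le> \<Delta> n" "\<Delta> \<longlonglongrightarrow> 0"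
  shows "\<theta> \<longlonglongrightarrow> (l0, n1, n2)"
    and "\<And>e. (\<And>n. 0 \<le> e n) \<Longrightarrow> (\<And>n s \<sigma>. n \<ge> 1 \<Longrightarrow> \<sigma> = 1 \<or> \<sigma> = - 1 \<Longrightarrow>
        (\<integral>\<^sup>+t. ennreal \<bar>smooth_bias q (b n) G (s + \<sigma> * t)\<bar> \<partial>PG) \<le> ennreal (e n)) \<Longrightarrow>
      \<forall>\<^sub>F n in sequentially. (case \<theta> n of (l, m1, m2) \<Rightarrow> K l m1 m2) \<le> 12 * (1 + 1 / (2 * d))\<^sup>2 * (\<Delta> n + e n)"
proof -
  have in\<Theta>: "\<theta> n \<in> param_space d S" "contrast q b x n (\<theta> n) \<le> contrast q b x n (l0, n1, n2)" if "n \<ge> 1" for n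
    using \<theta>[OF that] \<theta>0 by (auto simp: is_arg_min_def not_less)
  show bound: "\<forall>\<^sub>F n in sequentially. (case \<theta> n of (l, m1, m2) \<Rightarrow> K l m1 m2) \<le> 12 * (1 + 1 / (2 * d))\<^sup>2 * (\<Delta> n + e n)"
    if e: "\<And>n. 0 \<le> e n" "\<And>n s \<sigma>. n \<ge> 1 \<Longrightarrow> \<sigma> = 1 \<or> \<sigma> = - 1 \<Longrightarrow>
        (\<integral>\<^sup>+t. ennreal \<bar>smooth_bias q (b n) G (s + \<sigma> * t)\<bar> \<partial>PG) \<le> ennreal (e n)" for e
    using \<Delta>(1) eventually_ge_at_top[of 1]
  proof eventually_elim
    case (elim n)
    obtain l m1 m2 where \<theta>n: "\<theta> n = (l, m1, m2)" by (cases "\<theta> n") auto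
    have l: "0 \<le> l" "l \<le> 1/2 - d" using in\<Theta>(1)[OF elim(2)] by (auto simp: \<theta>n param_space_def)
    note dev = contrast_deviation[of q n b x "\<Delta> n" "e n", OF q elim(2) b(1)[OF elim(2)] _ e(1) e(2)[OF elim(2)]]
    have "\<bar>contrast q b x n (l, m1, m2) - K l m1 m2\<bar> \<le> 6 * (1 + 1 / (2 * d))\<^sup>2 * (\<Delta> n + e n)"
      "\<bar>contrast q b x n (l0, n1, n2) - K l0 n1 n2\<bar> \<le> 6 * (1 + 1 / (2 * d))\<^sup>2 * (\<Delta> n + e n)"
      using elim(1) l l0 by (auto intro!: dev simp: less_imp_le)
    thus ?case using in\<Theta>(2)[OF elim(2)] unfolding \<theta>n prod.case K_true_params by linarith
  qed
  define e where "e = (\<lambda>n. L * \<bar>b n\<bar>)"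
  have L: "0 \<le> L" using lipschitz by (rule lipschitz_on_nonneg)
  have eb: "(\<integral>\<^sup>+t. ennreal \<bar>smooth_bias q (b n) G (s + \<sigma> * t)\<bar> \<partial>PG) \<le> ennreal (e n)" if n: "n \<ge> 1" for n s \<sigma>
  proof -
    have "\<bar>smooth_bias q (b n) G t\<bar> \<le> e n" for t
      unfolding e_def using smooth_bias_lipschitz[OF q b(1)[OF n] G_diff_le mono_G G_01] b(1)[OF n] by simp
    hence "(\<integral>\<^sup>+t. ennreal \<bar>smooth_bias q (b n) G (s + \<sigma> * t)\<bar> \<partial>PG) \<le> (\<integral>\<^sup>+t. ennreal (e n) \<partial>PG)"
      by (intro nn_integral_mono ennreal_leI)
    also have "\<dots> = ennreal (e n)" using PG.emeasure_space_1 by simp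
    finally show ?thesis .
  qed
  have lim: "(\<lambda>n. 12 * (1 + 1 / (2 * d))\<^sup>2 * (\<Delta> n + e n)) \<longlonglongrightarrow> 12 * (1 + 1 / (2 * d))\<^sup>2 * (0 + L * \<bar>0\<bar>)"
    unfolding e_def using d by (intro tendsto_intros \<Delta>(2) b(2)) auto
  have le: "\<forall>\<^sub>F n in sequentially. (case \<theta> n of (l, m1, m2) \<Rightarrow> K l m1 m2) \<le> 12 * (1 + 1 / (2 * d))\<^sup>2 * (\<Delta> n + e n)"
    by (rule bound) (use eb L in \<open>auto simp: e_def\<close>)
  have nonneg: "0 \<le> (case \<theta> n of (l, m1, m2) \<Rightarrow> K l m1 m2)" for n
    by (simp add: K_def split: prod.split)
  have "(\<lambda>n. (case \<theta> n of (l, m1, m2) \<Rightarrow> K l m1 m2)) \<longlonglongrightarrow> 0"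
    by (rule tendsto_sandwich[OF _ le tendsto_const]) (use nonneg lim in auto)
  \<comment> \<open>The estimator is constrained only for \<open>n \<ge> 1\<close>, so the
    compactness argument runs on the shifted sequence.\<close>
  hence "(\<lambda>n. (case \<theta> (Suc n) of (l, m1, m2) \<Rightarrow> K l m1 m2)) \<longlonglongrightarrow> 0" by (rule LIMSEQ_Suc)
  hence "(\<lambda>n. \<theta> (Suc n)) \<longlonglongrightarrow> (l0, n1, n2)"
    using in\<Theta>(1) by (intro params_tendsto[OF S]) auto
  thus "\<theta> \<longlonglongrightarrow> (l0, n1, n2)" by (rule LIMSEQ_imp_Suc)
qed

end

context smooth_symmetric_mixture
begin

text \<open>With \<open>p = n powr (\<alpha> - 1/2)\<close> the bandwidth condition gives
  \<open>(b n)\<^sup>2 \<le> B * p\<close>, so the squared distance is of order \<open>p\<close>.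
  Multiplying by the squared norming factor \<open>n powr (1/2 - 2 * \<alpha>)\<close> leaves
  \<open>n powr (- \<alpha>)\<close>.\<close>

lemma estimator_rate:
  assumes q: "smoothing_kernel q" and b: "\<And>n. n \<ge> 1 \<Longrightarrow> b n > 0" "b \<longlonglongrightarrow> 0"
    and rate: "(\<lambda>n. sqrt (real n) * (b n)\<^sup>2) \<in> O(\<lambda>_. 1)"
    and S: "compact S" "S \<inter> {(x, x) | x. True} = {}" and \<theta>0: "(l0, n1, n2) \<in> param_space d S"
    and \<theta>: "\<And>n. n \<ge> 1 \<Longrightarrow> is_arg_min (contrast q b x n) (\<lambda>\<theta>. \<theta> \<in> param_space d S) (\<theta> n)"
    and lim: "\<theta> \<longlonglongrightarrow> (l0, n1, n2)" and \<alpha>: "0 < \<alpha>" "\<alpha> < 1/2"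
    and \<Delta>: "\<forall>\<^sub>F n in sequentially. \<forall>t. \<bar>ecdf x n t - G t\<bar> \<le> 2 * real n powr (\<alpha> - 1/2)"
    and f': "\<And>x. (f has_real_derivative f' x) (at x)" "\<And>x. isCont f' x" "integrable lborel f'"
  shows "(\<lambda>n. (real n powr (1/4 - \<alpha>)) *\<^sub>R (\<theta> n - (l0, n1, n2))) \<longlonglongrightarrow> 0"
proof -
  define g where "g = (\<lambda>x. l0 * f (x - n1) + (1 - l0) * f (x - n2))"
  define g' where "g' = (\<lambda>x. l0 * f' (x - n1) + (1 - l0) * f' (x - n2))"
  have Geq: "G = (\<lambda>x. l0 * F (x - n1) + (1 - l0) * F (x - n2))" using cdf_PG by auto
  have g: "(G has_real_derivative g x) (at x)" for x
    unfolding Geq g_def by (auto intro!: derivative_eq_intros DERIV_chain2[OF F_deriv])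
  have g'1: "(g has_real_derivative g' x) (at x)" for x
    unfolding g_def g'_def by (auto intro!: derivative_eq_intros DERIV_chain2[OF f'(1)])
  have g'2: "isCont g' x" for x
    unfolding g'_def by (intro continuous_intros isCont_o2[OF _ f'(2)])
  have "integrable lborel (\<lambda>x. f' (x - k))" for k
    using lborel_integrable_real_affine[OF f'(3), of 1 "- k"] by simp
  hence g'3: "integrable lborel g'" unfolding g'_def by simp
  have L: "0 \<le> L" by (rule L_nonneg)
  define I where "I = (\<integral>v. \<bar>g' v\<bar> \<partial>lborel)"
  have I: "0 \<le> I" by (simp add: I_def)
  define e where "e = (\<lambda>n. 2 * L * (b n)\<^sup>2 * I)"
  have e: "\<And>n. 0 \<le> e n" using L I by (simp add: e_def)
  have eb: "(\<integral>\<^sup>+t. ennreal \<bar>smooth_bias q (b n) G (s + \<sigma> * t)\<bar> \<partial>PG) \<le> ennreal (e n)"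
    if "n \<ge> 1" "\<sigma> = 1 \<or> \<sigma> = - 1" for n s \<sigma>
    unfolding e_def I_def
    by (rule smooth_bias_L1[OF q b(1)[OF that(1)] mono_G G_01 g g'1 g'2 g'3 PG L G_diff_le that(2)])
  have "(\<lambda>n. 2 * real n powr (\<alpha> - 1/2)) \<longlonglongrightarrow> 0" using \<alpha> by real_asymp
  from estimator_tendsto(2)[of q b S x \<theta>, OF q b S \<theta>0 \<theta> \<Delta> this e eb]
  have K1: "\<forall>\<^sub>F n in sequentially. (case \<theta> n of (l, m1, m2) \<Rightarrow> K l m1 m2)
      \<le> 12 * (1 + 1 / (2 * d))\<^sup>2 * (2 * real n powr (\<alpha> - 1/2) + e n)"
    by blast
  obtain B where B: "\<forall>\<^sub>F n in sequentially. norm (sqrt (real n) * (b n)\<^sup>2) \<le> B * norm (1::real)"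
    using landau_o.bigE[OF rate] by blast
  obtain c \<rho> where c: "0 < c" "0 < \<rho>" "\<And>l m1 m2. 0 \<le> l \<Longrightarrow> l \<le> 1/2 - d \<Longrightarrow> dist (l, m1, m2) (l0, n1, n2) < \<rho> \<Longrightarrow>
       c * (dist (l, m1, m2) (l0, n1, n2))\<^sup>2 \<le> K l m1 m2"
    using K_quadratic_growth by blast
  define C where "C = 12 * (1 + 1 / (2 * d))\<^sup>2"
  have C: "0 \<le> C" by (simp add: C_def)
  define C' where "C' = C * (2 + 2 * L * I * B) / c"
  have "\<forall>\<^sub>F n in sequentially. (norm ((real n powr (1/4 - \<alpha>)) *\<^sub>R (\<theta> n - (l0, n1, n2))))\<^sup>2 \<le> C' * real n powr (- \<alpha>)"
    using K1 B tendstoD[OF lim c(2)] eventually_ge_at_top[of 1]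
  proof eventually_elim
    case (elim n)
    have n: "1 \<le> real n" using elim(4) by simp
    obtain l m1 m2 where \<theta>n: "\<theta> n = (l, m1, m2)" by (cases "\<theta> n") auto
    have l: "0 \<le> l" "l \<le> 1/2 - d" using \<theta>[OF elim(4)] by (auto simp: \<theta>n param_space_def is_arg_min_def)
    define p where "p = real n powr (\<alpha> - 1/2)"
    have p: "0 \<le> p" by (simp add: p_def)
    have B1: "sqrt (real n) * (b n)\<^sup>2 \<le> B"
      using elim(2) abs_ge_self[of "sqrt (real n) * (b n)\<^sup>2"] unfolding real_norm_def by linarith
    moreover have "0 \<le> sqrt (real n) * (b n)\<^sup>2" by simp
    ultimately have B0: "0 \<le> B" by linarith
    have "(b n)\<^sup>2 \<le> B * p"
    proof -
      have "(b n)\<^sup>2 \<le> B / sqrt (real n)"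
        using B1 n by (simp add: pos_le_divide_eq mult.commute)
      also have "\<dots> = B * real n powr (- (1/2))"
        unfolding powr_minus by (subst powr_half_sqrt) (simp_all only: divide_inverse of_nat_0_le_iff)
      also have "\<dots> \<le> B * p" unfolding p_def using n \<alpha> B0 by (intro mult_left_mono powr_mono) auto
      finally show ?thesis .
    qed
    hence "2 * L * (b n)\<^sup>2 * I \<le> 2 * L * (B * p) * I" using L I by (intro mult_left_mono mult_right_mono) auto
    hence "2 * p + e n \<le> (2 + 2 * L * I * B) * p" by (simp add: e_def algebra_simps)
    hence "C * (2 * p + e n) \<le> C * ((2 + 2 * L * I * B) * p)" using C by (rule mult_left_mono)
    moreover have "c * (dist (\<theta> n) (l0, n1, n2))\<^sup>2 \<le> C * (2 * p + e n)"
      using c(3)[OF l, of m1 m2] elim(1,3) by (simp add: \<theta>n C_def p_def)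
    ultimately have "(dist (\<theta> n) (l0, n1, n2))\<^sup>2 \<le> C' * p"
      using c(1) by (simp add: C'_def field_simps)
    hence "(real n powr (1/4 - \<alpha>))\<^sup>2 * (dist (\<theta> n) (l0, n1, n2))\<^sup>2 \<le> (real n powr (1/4 - \<alpha>))\<^sup>2 * (C' * p)"
      by (rule mult_left_mono) simp
    also have "(real n powr (1/4 - \<alpha>))\<^sup>2 * (C' * p) = C' * (real n powr (1/4 - \<alpha>) * real n powr (1/4 - \<alpha>) * real n powr (\<alpha> - 1/2))"
      by (simp add: p_def power2_eq_square)
    also have "\<dots> = C' * real n powr (- \<alpha>)"
      unfolding powr_add[symmetric] by simp
    finally show ?case by (simp add: power_mult_distrib dist_norm)
  qed
  moreover have "(\<lambda>n. C' * real n powr (- \<alpha>)) \<longlonglongrightarrow> 0" using \<alpha> by real_asymp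
  ultimately have "(\<lambda>n. (norm ((real n powr (1/4 - \<alpha>)) *\<^sub>R (\<theta> n - (l0, n1, n2))))\<^sup>2) \<longlonglongrightarrow> 0"
    by (rule tendsto_sandwich[OF _ _ tendsto_const, rotated]) auto
  from tendsto_real_sqrt[OF this] show ?thesis
    by (simp only: real_sqrt_abs abs_norm_cancel real_sqrt_zero tendsto_norm_zero_iff)
qed

end

theorem theorem3p3:
  fixes M :: "'a measure"
    and X :: "nat \<Rightarrow> 'a \<Rightarrow> real"
    and P\<^sub>0 :: "real measure"
    and F\<^sub>0 q :: "real \<Rightarrow> real"
    and b :: "nat \<Rightarrow> real"
    and d lam\<^sub>0 \<mu>1\<^sub>0 \<mu>2\<^sub>0 :: real
    and S :: "(real \<times> real) set"
    and \<theta>\<^sub>0 :: "real \<times> real \<times> real"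
    and \<theta>hat :: "nat \<Rightarrow> 'a \<Rightarrow> real \<times> real \<times> real"
  assumes kernel: "smoothing_kernel q"
    and b_pos: "\<And>n. n \<ge> 1 \<Longrightarrow> b n > 0"
    and b_decreasing: "antimono_on {1..} b"
    and b_lim: "b \<longlonglongrightarrow> 0"
    and nb_lim: "filterlim (\<lambda>n. real n * b n) at_top sequentially"
    and b_rate: "(\<lambda>n. sqrt (real n) * (b n)\<^sup>2) \<in> O(\<lambda>_. 1)"
    and d: "0 < d" "d < 1/2"
    and S: "compact S" "S \<inter> {(x, x) | x. True} = {}"
    and \<theta>\<^sub>0: "\<theta>\<^sub>0 = (lam\<^sub>0, \<mu>1\<^sub>0, \<mu>2\<^sub>0)" "\<theta>\<^sub>0 \<in> interior (param_space d S)"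
    and P\<^sub>0: "real_distribution P\<^sub>0" "distr P\<^sub>0 borel uminus = P\<^sub>0"
    and F\<^sub>0: "F\<^sub>0 = cdf P\<^sub>0"
    and M: "prob_space M"
    and X_indep: "prob_space.indep_vars M (\<lambda>_. borel) X {1..}"
    and X_cdf: "\<And>i x. i \<ge> 1 \<Longrightarrow>
      cdf (distr M borel (X i)) x = lam\<^sub>0 * F\<^sub>0 (x - \<mu>1\<^sub>0) + (1 - lam\<^sub>0) * F\<^sub>0 (x - \<mu>2\<^sub>0)"
    and \<theta>hat: "\<And>n \<omega>. n \<ge> 1 \<Longrightarrow> \<omega> \<in> space M \<Longrightarrow>
      is_arg_min (contrast q b (\<lambda>i. X i \<omega>) n) (\<lambda>\<theta>. \<theta> \<in> param_space d S) (\<theta>hat n \<omega>)"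
    and F\<^sub>0_mono: "strict_mono F\<^sub>0"
    and F\<^sub>0_lipschitz: "\<exists>L. L-lipschitz_on UNIV F\<^sub>0"
  shows "(AE \<omega> in M. (\<lambda>n. \<theta>hat n \<omega>) \<longlonglongrightarrow> \<theta>\<^sub>0) \<and>
    ((\<forall>x. F\<^sub>0 differentiable at x) \<and> (\<forall>x. deriv F\<^sub>0 differentiable at x) \<and>
     continuous_on UNIV (deriv (deriv F\<^sub>0)) \<and> integrable lborel (deriv (deriv F\<^sub>0)) \<longrightarrow>
     (\<forall>\<alpha>>0. AE \<omega> in M.
        (\<lambda>n. (real n powr (1/4 - \<alpha>)) *\<^sub>R (\<theta>hat n \<omega> - \<theta>\<^sub>0)) \<longlonglongrightarrow> 0))"
proof -
  interpret prob_space M by fact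
  interpret P0: real_distribution P\<^sub>0 by fact
  obtain L where L: "L-lipschitz_on UNIV (cdf P\<^sub>0)" using F\<^sub>0_lipschitz F\<^sub>0 by blast
  have cont: "isCont (cdf P\<^sub>0) x" for x
    using lipschitz_on_continuous_on[OF L] by (simp add: continuous_on_eq_continuous_at)
  \<comment> \<open>Invariance of the law yields the mass of \<open>{x..}\<close>; continuity of the
    c.d.f. removes the atom at \<open>x\<close>.\<close>
  have sym: "cdf P\<^sub>0 (- x) = 1 - cdf P\<^sub>0 x" for x
  proof -
    have "cdf P\<^sub>0 (- x) = measure (distr P\<^sub>0 borel uminus) {..- x}" using P\<^sub>0(2) by (simp add: cdf_def)
    also have "\<dots> = measure P\<^sub>0 (uminus -` {..- x} \<inter> space P\<^sub>0)" by (rule measure_distr) auto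
    also have "uminus -` {..- x} \<inter> space P\<^sub>0 = {x} \<union> (space P\<^sub>0 - {..x})" by auto
    also have "measure P\<^sub>0 \<dots> = measure P\<^sub>0 {x} + measure P\<^sub>0 (space P\<^sub>0 - {..x})"
      by (rule P0.finite_measure_Union) auto
    also have "measure P\<^sub>0 (space P\<^sub>0 - {..x}) = 1 - cdf P\<^sub>0 x"
      unfolding cdf_def by (rule P0.prob_compl) simp
    also have "measure P\<^sub>0 {x} = 0" using cont P0.isCont_cdf by simp
    finally show ?thesis by simp
  qed
  have in\<Theta>: "(lam\<^sub>0, \<mu>1\<^sub>0, \<mu>2\<^sub>0) \<in> param_space d S" using \<theta>\<^sub>0 interior_subset by blast
  \<comment> \<open>A ball inside the parameter space contains a point with a smaller weight, which
    is still nonnegative.\<close>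
  have lam_pos: "0 < lam\<^sub>0"
  proof -
    obtain e where e: "e > 0" "ball \<theta>\<^sub>0 e \<subseteq> param_space d S" using \<theta>\<^sub>0(2) mem_interior by metis
    have "(lam\<^sub>0 - e / 2, \<mu>1\<^sub>0, \<mu>2\<^sub>0) \<in> ball \<theta>\<^sub>0 e" using e(1) by (simp add: \<theta>\<^sub>0(1) dist_Pair_Pair dist_real_def)
    with e(2) have "(lam\<^sub>0 - e / 2, \<mu>1\<^sub>0, \<mu>2\<^sub>0) \<in> param_space d S" by blast
    thus ?thesis using e(1) by (simp add: param_space_def)
  qed
  have lam_le: "lam\<^sub>0 \<le> 1/2 - d" and \<mu>_ne: "\<mu>1\<^sub>0 \<noteq> \<mu>2\<^sub>0"
    using in\<Theta> S(2) by (auto simp: param_space_def)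
  define PG where "PG = distr M borel (X 1)"
  have rv: "random_variable borel (X 1)" using X_indep by (simp add: indep_vars_def)
  have PG: "real_distribution PG"
    unfolding PG_def using rv by simp
  have cdf_PG: "cdf PG x = lam\<^sub>0 * cdf P\<^sub>0 (x - \<mu>1\<^sub>0) + (1 - lam\<^sub>0) * cdf P\<^sub>0 (x - \<mu>2\<^sub>0)" for x
    using X_cdf[of 1 x] by (simp add: PG_def F\<^sub>0)
  interpret mixture: symmetric_mixture P\<^sub>0 PG lam\<^sub>0 \<mu>1\<^sub>0 \<mu>2\<^sub>0 d L
    by (rule symmetric_mixture.intro)
       (use P\<^sub>0(1) PG sym F\<^sub>0_mono F\<^sub>0 L lam_pos lam_le d \<mu>_ne cdf_PG in auto)
  have uniform: "AE \<omega> in M. \<forall>\<^sub>F n in sequentially. \<forall>t. \<bar>ecdf (\<lambda>i. X i \<omega>) n t - cdf PG t\<bar> \<le> 2 * real n powr (\<alpha> - 1/2)"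
    if "\<alpha> > 0" for \<alpha>
    by (rule ecdf_uniform_rate[OF X_indep PG mixture.strict_G mixture.isCont_G _ that])
       (simp add: X_cdf cdf_PG F\<^sub>0)
  \<comment> \<open>For consistency any exponent strictly between 0 and 1/2 would do.\<close>
  have quarter: "0 < (1/4 :: real)" by simp
  have consistent: "AE \<omega> in M. (\<lambda>n. \<theta>hat n \<omega>) \<longlonglongrightarrow> \<theta>\<^sub>0"
    using uniform[OF quarter] AE_space
  proof eventually_elim
    case (elim \<omega>)
    have lim: "(\<lambda>n. 2 * real n powr (1/4 - 1/2)) \<longlonglongrightarrow> 0" by real_asymp
    show ?case unfolding \<theta>\<^sub>0(1)
      by (rule mixture.estimator_tendsto(1)[OF kernel b_pos b_lim S in\<Theta> \<theta>hat[OF _ elim(2)] elim(1) lim])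
  qed
  have rate: "AE \<omega> in M. (\<lambda>n. (real n powr (1/4 - \<alpha>)) *\<^sub>R (\<theta>hat n \<omega> - \<theta>\<^sub>0)) \<longlonglongrightarrow> 0"
    if smooth: "\<forall>x. F\<^sub>0 differentiable at x" "\<forall>x. deriv F\<^sub>0 differentiable at x"
      "continuous_on UNIV (deriv (deriv F\<^sub>0))" "integrable lborel (deriv (deriv F\<^sub>0))" and \<alpha>: "0 < \<alpha>" for \<alpha>
  proof -
    have f': "(deriv F\<^sub>0 has_real_derivative deriv (deriv F\<^sub>0) x) (at x)" for x
      using smooth(2) DERIV_deriv_iff_real_differentiable by blast
    interpret mixture: smooth_symmetric_mixture P\<^sub>0 PG lam\<^sub>0 \<mu>1\<^sub>0 \<mu>2\<^sub>0 d L "deriv F\<^sub>0"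
    proof unfold_locales
      show "(cdf P\<^sub>0 has_real_derivative deriv F\<^sub>0 x) (at x)" for x
        using smooth(1) DERIV_deriv_iff_real_differentiable unfolding F\<^sub>0 by blast
      show "isCont (deriv F\<^sub>0) x" for x using f' by (rule DERIV_isCont)
    qed
    \<comment> \<open>The rate lemma needs an exponent below 1/2. A larger \<open>\<alpha>\<close>
      asks for less, since its norming factor is smaller for \<open>n \<ge> 1\<close>.\<close>
    define \<beta> where "\<beta> = min \<alpha> (1/4)"
    have \<beta>: "0 < \<beta>" "\<beta> < 1/2" "\<beta> \<le> \<alpha>" using \<alpha> by (auto simp: \<beta>_def)
    show ?thesis
      using uniform[OF \<beta>(1)] consistent AE_space
    proof eventually_elim
      case (elim \<omega>)
      have f'': "isCont (deriv (deriv F\<^sub>0)) x" for x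
        using smooth(3) by (simp add: continuous_on_eq_continuous_at)
      have lim: "(\<lambda>n. (real n powr (1/4 - \<beta>)) *\<^sub>R (\<theta>hat n \<omega> - \<theta>\<^sub>0)) \<longlonglongrightarrow> 0"
        unfolding \<theta>\<^sub>0(1)
        by (rule mixture.estimator_rate[OF kernel b_pos b_lim b_rate S in\<Theta> \<theta>hat])
           (use elim \<beta> f' f'' smooth(4) \<theta>\<^sub>0(1) in auto)
      show ?case
      proof (rule Lim_null_comparison[OF _ tendsto_norm_zero[OF lim]])
        show "\<forall>\<^sub>F n in sequentially. norm ((real n powr (1/4 - \<alpha>)) *\<^sub>R (\<theta>hat n \<omega> - \<theta>\<^sub>0))
            \<le> norm ((real n powr (1/4 - \<beta>)) *\<^sub>R (\<theta>hat n \<omega> - \<theta>\<^sub>0))"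
          using eventually_ge_at_top[of 1]
        proof eventually_elim
          case (elim n)
          have "real n powr (1/4 - \<alpha>) \<le> real n powr (1/4 - \<beta>)"
            using elim \<beta>(3) by (intro powr_mono) auto
          thus ?case by (simp add: mult_right_mono)
        qed
      qed
    qed
  qed
  show ?thesis using consistent rate by blast
qed

end
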